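(* Let $G$ be a connected negative definite plumbing tree (all genera $0$) with non-empty set of nodes $\mathcal N$, and assume $L=L'$ (i.e. $H=0$). Let $\mathcal C$ be any chamber (of the chamber decomposition associated with the denominator of $Z(\mathbf t)$) such that $\mathrm{int}(\mathcal C\cap\mathcal S)\ne\emptyset$, where $\mathcal S$ is the real Lipman cone, and write $$\widehat{\mathcal L}^{\mathcal C}((\lambda_n)_{n\in\mathcal N}):=\mathcal L^{\mathcal C}\Big(\mathcal T,\sum_{n\in\mathcal N}\lambda_nE_n^*\Big)=\sum_{\substack{\sum_nm_n\le|\mathcal E|\\ m_n\ge0}}\widehat{\mathfrak a}^{\mathcal C}_{(m_n)_n}\prod_{n\in\mathcal N}\frac{\lambda_n^{m_n}}{m_n!},$$ where the $\widehat{\mathfrak a}^{\mathcal C}_{(m_n)_n}$ are periodic functions of $(\lambda_n)_n$. Then, with $J_{nm}=-(E_n^*,E_m^* )$, $$\widehat{\mathfrak a}^{\mathcal C}_{(\delta_n,(\delta_m-2)_{m\ne n})}=J_{nn},$$ $$\widehat{\mathfrak a}^{\mathcal C}_{(\delta_n-1,\delta_m-1,(\delta_q-2)_{q\ne n,m})}=J_{nm}\quad(n\ne m),$$ $$\widehat{\mathfrak a}^{\mathcal C}_{(\delta_n-1,(\delta_m-2)_{m\ne n})}=-\tfrac12(K,E_n^* )+\tfrac12\sum_{m\in\mathcal N}(\delta_m-2)J_{nm},$$ $$\widehat{\mathfrak a}^{\mathcal C}_{(\delta_n-2)_n}=\mathrm{pc}^{\mathcal S}(Z)-\sum_{n\in\mathcal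 N}\frac{(\delta_n-2)(K,E_n^* )}{4}+\sum_{n\in\mathcal N}\frac{(\delta_n-2)(3\delta_n-7)J_{nn}}{24}+\sum_{\substack{n,m\in\mathcal N\\ m\ne n}}\frac{(\delta_n-2)(\delta_m-2)J_{nm}}{8}.$$
   Context: **Lattice.** $\mathcal V$ is the vertex set of $G$, $b_v$ the Euler decorations, $\delta_v$ the valencies; $\mathcal N=\{v:\delta_v\ge3\}$ (nodes), $\mathcal E=\{v:\delta_v=1\}$ (ends). $L=\bigoplus_v\mathbb ZE_v$ with negative definite form $(E_v,E_v)=b_v$, $(E_v,E_w)=1$ or $0$ for $v\ne w$ adjacent or not; $L'=\{l'\in L\otimes\mathbb Q:(l',L)\subseteq\mathbb Z\}$; $E_v^*\in L'$ with $(E_v^*,E_w)=-1$ if $v=w$ and $0$ otherwise; $H=L'/L$. $K$ is defined by $(K,E_v)=-b_v-2$ for all $v$. $\le$ is the coordinatewise order. $\mathcal S=\{x\in L\otimes\mathbb R:(x,E_v)\le0\ \forall v\}$. **Series and periodic constant.** $Z(\mathbf t)=\sum_lp_l\mathbf t^l$ is the Taylor expansion at the origin of $\prod_{v\in\mathcal V}(1-\mathbf t^{E_v^*})^{\delta_v-2}$, where $\mathbf t^l=\prod t_v^{l_v}$. Put $Q(l)=\sum_{l''\not\ge l}p_{l''}$. $\mathrm{pc}^{\mathcal S}(Z)$ denotes the periodic constant of $Z$ in the cone $\mathcal S$: there are $l_*\in\mathcal S$, a finite-index sublattice $\widetilde L\subset L$ and a quasipolynomial $\widetilde Q$ on $\widetilde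 L$ with $Q(l)=\widetilde Q(l)$ for $l\in\widetilde L\cap(l_*+\mathcal S)$, and $\mathrm{pc}^{\mathcal S}(Z)=\widetilde Q(0)$ (it exists). **Chambers and Ehrhart quasipolynomial.** Let $\mathbf M$ be the list of vectors $E_e^*$ ($e\in\mathcal E$) and $-E_v$ ($v\in\mathcal V$). The chamber decomposition of $L\otimes\mathbb R$ is the common refinement of all closed cones generated by subsets of $\mathbf M$ that form a basis; a chamber is a closed cone of this subdivision with non-empty interior. Let $\mathcal L(\mathcal T,l)=\#\{x\in\mathbb Z_{\ge0}^{\mathcal E}:\sum_ex_eE_e^*\not\ge l\}$. On every chamber $\mathcal C$ this is given by a quasipolynomial in $l\in L$, denoted $\mathcal L^{\mathcal C}(\mathcal T,l)$ and viewed as an abstract quasipolynomial defined for all $l\in L$. In the expansion of $\widehat{\mathcal L}^{\mathcal C}$ the $\lambda_n$ are integers, and the index of $\widehat{\mathfrak a}^{\mathcal C}$ lists the exponents $m_n$, with the entry at each node as indicated. The equalities assert in particular that these coefficients are constant. *)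

theory Defs
  imports "HOL-Analysis.Analysis"
begin

text \<open>
  The vertex set is a finite type, so \<open>L \<otimes> \<real>\<close> is the space \<open>real^'v\<close> and the base vector
  \<open>E\<^sub>v\<close> is \<open>axis v 1\<close>. All genera are zero, hence they are not recorded.
\<close>

record 'v plumbing_graph =
  adj :: "'v \<Rightarrow> 'v \<Rightarrow> bool"
  euler :: "'v \<Rightarrow> int"

definition has_cycle :: "('v \<Rightarrow> 'v \<Rightarrow> bool) \<Rightarrow> bool" where
  "has_cycle R \<longleftrightarrow>
     (\<exists>vs. distinct vs \<and> 3 \<le> length vs \<and> successively R vs \<and> R (last vs) (hd vs))"

definition plumbing_tree :: "('v::finite) plumbing_graph \<Rightarrow> bool" where
  "plumbing_tree G \<longleftrightarrow>
     symp (adj G) \<and> irreflp (adj G) \<and>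
     (\<forall>v w. (adj G)\<^sup>*\<^sup>* v w) \<and> \<not> has_cycle (adj G)"

definition valency :: "('v::finite) plumbing_graph \<Rightarrow> 'v \<Rightarrow> nat" where
  "valency G v = card {w. adj G v w}"

definition nodes :: "('v::finite) plumbing_graph \<Rightarrow> 'v set" where
  "nodes G = {v. 3 \<le> valency G v}"

definition ends :: "('v::finite) plumbing_graph \<Rightarrow> 'v set" where
  "ends G = {v. valency G v = 1}"

abbreviation E :: "'v::finite \<Rightarrow> real^'v" where
  "E v \<equiv> axis v 1"

definition int_form :: "('v::finite) plumbing_graph \<Rightarrow> real^'v \<Rightarrow> real^'v \<Rightarrow> real" where
  "int_form G x y =
     (\<Sum>v\<in>UNIV. \<Sum>w\<in>UNIV. x $ v * y $ w *
        (if v = w then of_int (euler G v) else if adj G v w then 1 else 0))"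

definition negative_definite :: "('v::finite) plumbing_graph \<Rightarrow> bool" where
  "negative_definite G \<longleftrightarrow> (\<forall>x. x \<noteq> 0 \<longrightarrow> int_form G x x < 0)"

definition std_lattice :: "(real^'v::finite) set" where
  "std_lattice = {x. \<forall>v. x $ v \<in> \<int>}"

definition dual_lattice :: "('v::finite) plumbing_graph \<Rightarrow> (real^'v) set" where
  "dual_lattice G = {x. (\<forall>v. x $ v \<in> \<rat>) \<and> (\<forall>y\<in>std_lattice. int_form G x y \<in> \<int>)}"

text \<open>The descriptions of \<open>E\<^sub>v\<^sup>*\<close> and \<open>K\<close> are definite because the form is non-degenerate.\<close>

definition E_star :: "('v::finite) plumbing_graph \<Rightarrow> 'v \<Rightarrow> real^'v" where
  "E_star G v =
     (THE x. x \<in> dual_lattice G \<and> (\<forall>w. int_form G x (E w) = (if v = w then - 1 else 0)))"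

definition canonical_class :: "('v::finite) plumbing_graph \<Rightarrow> real^'v" where
  "canonical_class G =
     (THE x. x \<in> dual_lattice G \<and> (\<forall>v. int_form G x (E v) = - of_int (euler G v) - 2))"

definition J :: "('v::finite) plumbing_graph \<Rightarrow> 'v \<Rightarrow> 'v \<Rightarrow> real" where
  "J G v w = - int_form G (E_star G v) (E_star G w)"

definition lipman_cone :: "('v::finite) plumbing_graph \<Rightarrow> (real^'v) set" where
  "lipman_cone G = {x. \<forall>v. int_form G x (E v) \<le> 0}"

definition finite_index_sublattice :: "(real^'v::finite) set \<Rightarrow> (real^'v) set \<Rightarrow> bool" where
  "finite_index_sublattice \<Lambda>' \<Lambda> \<longleftrightarrow>
     \<Lambda>' \<subseteq> \<Lambda> \<and> 0 \<in> \<Lambda>' \<and> (\<forall>x\<in>\<Lambda>'. \<forall>y\<in>\<Lambda>'. x - y \<in> \<Lambda>') \<and>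
     finite ((\<lambda>x. (+) x ` \<Lambda>') ` \<Lambda>)"

definition quasipolynomial_on :: "(real^'v::finite) set \<Rightarrow> (real^'v \<Rightarrow> real) \<Rightarrow> bool" where
  "quasipolynomial_on \<Lambda> f \<longleftrightarrow>
     (\<exists>M c \<Lambda>'. finite (M :: ('v \<Rightarrow> nat) set) \<and> finite_index_sublattice \<Lambda>' \<Lambda> \<and>
        (\<forall>m\<in>M. \<forall>l\<in>\<Lambda>. \<forall>d\<in>\<Lambda>'. c m (l + d) = c m l) \<and>
        (\<forall>l\<in>\<Lambda>. f l = (\<Sum>m\<in>M. c m l * (\<Prod>v\<in>UNIV. (l $ v) ^ m v))))"

text \<open>
  \<open>t\<^sup>l\<close> for \<open>l\<close> in \<open>L\<close>; the floor only converts the integral coordinates from type real to int.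
  When \<open>L = L'\<close> the exponents \<open>E\<^sub>v\<^sup>*\<close> lie in \<open>L\<close>.
\<close>

definition tpow :: "complex^'v::finite \<Rightarrow> real^'v \<Rightarrow> complex" where
  "tpow t l = (\<Prod>v\<in>UNIV. (t $ v) powi \<lfloor>l $ v\<rfloor>)"

definition Z_fun :: "('v::finite) plumbing_graph \<Rightarrow> complex^'v \<Rightarrow> complex" where
  "Z_fun G t = (\<Prod>v\<in>UNIV. (1 - tpow t (E_star G v)) powi (int (valency G v) - 2))"

definition taylor_at_origin ::
  "(complex^'v::finite \<Rightarrow> complex) \<Rightarrow> (real^'v \<Rightarrow> real) \<Rightarrow> bool" where
  "taylor_at_origin f p \<longleftrightarrow>
     (\<forall>l. l \<notin> {l \<in> std_lattice. 0 \<le> l} \<longrightarrow> p l = 0) \<and>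
     (\<exists>\<epsilon>>0. \<forall>t. (\<forall>v. norm (t $ v) < \<epsilon>) \<longrightarrow>
        ((\<lambda>l. complex_of_real (p l) * tpow t l) has_sum f t) {l \<in> std_lattice. 0 \<le> l})"

definition Z_coeff :: "('v::finite) plumbing_graph \<Rightarrow> real^'v \<Rightarrow> real" where
  "Z_coeff G = (THE p. taylor_at_origin (Z_fun G) p)"

text \<open>
  Only finitely many \<open>l''\<close> in the support of the series satisfy \<open>l'' \<not>\<ge> l\<close>, because all coordinates
  of the \<open>E\<^sub>v\<^sup>*\<close> are positive; summing over the support makes this a finite sum.
\<close>

definition counting_fun :: "(real^'v::finite \<Rightarrow> real) \<Rightarrow> real^'v \<Rightarrow> real" where
  "counting_fun p l = (\<Sum>l'' | l'' \<in> std_lattice \<and> p l'' \<noteq> 0 \<and> \<not> l \<le> l''. p l'')"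

definition has_periodic_constant ::
  "(real^'v::finite) set \<Rightarrow> (real^'v \<Rightarrow> real) \<Rightarrow> real \<Rightarrow> bool" where
  "has_periodic_constant S p c \<longleftrightarrow>
     (\<exists>l\<^sub>0\<in>S. \<exists>\<Lambda> q. finite_index_sublattice \<Lambda> std_lattice \<and> quasipolynomial_on \<Lambda> q \<and>
        (\<forall>l \<in> \<Lambda> \<inter> (+) l\<^sub>0 ` S. counting_fun p l = q l) \<and> c = q 0)"

definition periodic_constant :: "(real^'v::finite) set \<Rightarrow> (real^'v \<Rightarrow> real) \<Rightarrow> real" where
  "periodic_constant S p = (THE c. has_periodic_constant S p c)"

definition chamber_vectors :: "('v::finite) plumbing_graph \<Rightarrow> (real^'v) set" where
  "chamber_vectors G = E_star G ` ends G \<union> range (\<lambda>v. - E v)"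

definition basis_cones :: "('v::finite) plumbing_graph \<Rightarrow> (real^'v) set set" where
  "basis_cones G =
     {convex_cone hull B | B. B \<subseteq> chamber_vectors G \<and> independent B \<and> span B = UNIV}"

text \<open>
  The closed cell of the common refinement that contains \<open>x\<close> in its relative interior is the
  intersection of all the basis cones through \<open>x\<close>.
\<close>

definition chamber :: "('v::finite) plumbing_graph \<Rightarrow> (real^'v) set \<Rightarrow> bool" where
  "chamber G C \<longleftrightarrow>
     (\<exists>x. C = \<Inter>{\<sigma> \<in> basis_cones G. x \<in> \<sigma>}) \<and> interior C \<noteq> {}"

definition ehrhart_count :: "('v::finite) plumbing_graph \<Rightarrow> real^'v \<Rightarrow> nat" where
  "ehrhart_count G l =
     card {x \<in> ends G \<rightarrow>\<^sub>E (UNIV :: nat set). \<not> l \<le> (\<Sum>e\<in>ends G. of_nat (x e) *\<^sub>R E_star G e)}"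

definition ehrhart_quasipolynomial ::
  "('v::finite) plumbing_graph \<Rightarrow> (real^'v) set \<Rightarrow> (real^'v \<Rightarrow> real) \<Rightarrow> bool" where
  "ehrhart_quasipolynomial G C \<L> \<longleftrightarrow>
     quasipolynomial_on std_lattice \<L> \<and>
     (\<forall>l \<in> C \<inter> std_lattice. \<L> l = of_nat (ehrhart_count G l))"

definition node_periodic :: "('v::finite) plumbing_graph \<Rightarrow> (('v \<Rightarrow> int) \<Rightarrow> real) \<Rightarrow> bool" where
  "node_periodic G f \<longleftrightarrow>
     (\<exists>N>0. \<forall>k \<in> nodes G \<rightarrow>\<^sub>E UNIV. \<forall>k' \<in> nodes G \<rightarrow>\<^sub>E UNIV.
        (\<forall>n\<in>nodes G. k n mod N = k' n mod N) \<longrightarrow> f k = f k')"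

text \<open>
  Tuples \<open>(\<lambda>\<^sub>n)\<close> and \<open>(m\<^sub>n)\<close> indexed by the nodes are extensional functions on the set of nodes.
\<close>

definition node_expansion ::
  "('v::finite) plumbing_graph \<Rightarrow> (real^'v \<Rightarrow> real) \<Rightarrow> (('v \<Rightarrow> nat) \<Rightarrow> ('v \<Rightarrow> int) \<Rightarrow> real) \<Rightarrow> bool"
where
  "node_expansion G \<L> a \<longleftrightarrow>
     (\<forall>m \<in> nodes G \<rightarrow>\<^sub>E UNIV. (\<Sum>n\<in>nodes G. m n) \<le> card (ends G) \<longrightarrow> node_periodic G (a m)) \<and>
     (\<forall>k \<in> nodes G \<rightarrow>\<^sub>E UNIV.
        \<L> (\<Sum>n\<in>nodes G. of_int (k n) *\<^sub>R E_star G n) =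
        (\<Sum>m | m \<in> nodes G \<rightarrow>\<^sub>E UNIV \<and> (\<Sum>n\<in>nodes G. m n) \<le> card (ends G).
           a m k * (\<Prod>n\<in>nodes G. of_int (k n) ^ m n / fact (m n))))"

end

theory Submission
  imports Defs
begin

text \<open>
  Write \<open>d\<^sub>n = \<delta>\<^sub>n - 2\<close> for a node \<open>n\<close>, let \<open>a\<^sub>w(l) = -(l, E\<^sub>w)\<close> be the coordinates of \<open>l\<close> in the
  basis \<open>E\<^sub>w\<^sup>*\<close> of the unimodular lattice \<open>L\<close>, and let \<open>\<chi>(l) = -(l, l + K)/2\<close>.

  The heart of the matter is that the counting function \<open>Q\<close> of \<open>Z\<close> equals \<open>\<chi>\<close> plus a constant deep
  inside the Lipman cone (\<open>defect_const\<close>); that constant is the periodic constant. Since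
  \<open>\<chi>(l + E\<^sub>v) - \<chi>(l) = a\<^sub>v(l) + 1\<close>, this is a statement about the slice of all \<open>l'' \<ge> l\<close> with the same
  \<open>v\<close>-coordinate as \<open>l\<close>: the coefficients of \<open>Z\<close> over it must add up to \<open>a\<^sub>v(l) + 1\<close>
  (\<open>slice_sum\<close>). The coefficient of \<open>Z\<close> at \<open>l''\<close> is the product over the vertices \<open>w\<close> of the
  coefficients of \<open>(1 - X)\<close> to the power \<open>\<delta>\<^sub>w - 2\<close> at \<open>a\<^sub>w(l'')\<close>, and \<open>a\<^sub>w\<close> involves only \<open>w\<close> and its
  neighbours. So with \<open>v\<close> as root of the tree the sum can be carried out branch by branch, and
  deep in the cone every branch that hangs at \<open>v\<close> contributes 1 for every value at its root
  (\<open>branch_sum_eq_1\<close>). The sum over the slice becomes the coefficient at \<open>a\<^sub>v(l)\<close> of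
  \<open>(1 - X)\<close> to the power \<open>\<delta>\<^sub>v - 2\<close> times \<open>\<delta>\<^sub>v\<close> geometric series, that is, of \<open>1/(1 - X)\<^sup>2\<close>.

  Next, \<open>Z\<close> arises from \<open>\<Prod>\<^sub>e 1/(1 - t^E\<^sub>e\<^sup>*)\<close>, whose counting function is the Ehrhart count, by
  multiplication with \<open>(1 - t^E\<^sub>n\<^sup>*)^d\<^sub>n\<close> for the nodes \<open>n\<close>. Hence \<open>Q\<close> is an iterated
  backward difference of the Ehrhart count, with \<open>d\<^sub>n\<close> steps in the direction \<open>E\<^sub>n\<^sup>*\<close>. Far out in the
  common interior of the chamber and the Lipman cone this is an identity between the iterated
  difference of the Ehrhart quasipolynomial and \<open>\<chi> + pc\<close>. Two quasipolynomials that agree far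
  out on all lines in one direction agree everywhere, so the identity holds on all of \<open>L\<close>
  (\<open>iter_diff_\<L>\<close>), in particular on the span of the \<open>E\<^sub>n\<^sup>*\<close>.

  Finally, the quasipolynomial has degree at most the number of ends (\<open>\<L>_bounded_degree\<close>), and in a
  tree this number is \<open>\<Sum>\<^sub>n d\<^sub>n + 2\<close> (\<open>card_ends\<close>). The difference operator with \<open>d\<^sub>n\<close> steps annihilates each
  monomial in which some \<open>\<lambda>\<^sub>n\<close> has an exponent below \<open>d\<^sub>n\<close>; what survives has at most two
  exponents to spare, and these are the exponents whose coefficients the theorem lists. The
  polynomial with the claimed coefficients at these exponents is also mapped to \<open>\<chi> + pc\<close>
  (\<open>iter_diff_expected_coeff\<close>). The difference of the two expansions is annihilated by the operator with unit
  steps, hence also by the one with steps \<open>N\<close>, a common period; for the latter the periodic coefficients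
  behave like constants, and they vanish one after the other from the top
  (\<open>node_expansion_coeffs\<close>).
\<close>

section \<open>The intersection form and the dual basis\<close>

locale unimodular_plumbing_tree =
  fixes G :: "('v::finite) plumbing_graph"
  assumes tree: "plumbing_tree G"
    and negdef: "negative_definite G"
    and nodes_nonempty: "nodes G \<noteq> {}"
    and unimodular: "std_lattice = dual_lattice G"
begin

definition beta :: "'v \<Rightarrow> int" where
  "beta v = - euler G v"

definition neighbours :: "'v \<Rightarrow> 'v set" where
  "neighbours v = {w. adj G v w}"

text \<open>The coefficient of \<open>E\<^sub>w\<^sup>*\<close> in the expansion of \<open>x\<close> in the dual basis.\<close>

definition dual_coord :: "real^'v \<Rightarrow> 'v \<Rightarrow> real" where
  "dual_coord x w = - int_form G x (E w)"

lemma adj_sym: "adj G v w \<longleftrightarrow> adj G w v"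
  using tree unfolding plumbing_tree_def symp_def by blast

lemma adj_irrefl: "\<not> adj G v v"
  using tree unfolding plumbing_tree_def irreflp_def by blast

lemma adj_connected: "(adj G)\<^sup>*\<^sup>* v w"
  using tree unfolding plumbing_tree_def by blast

lemma valency_neighbours: "valency G v = card (neighbours v)"
  unfolding valency_def neighbours_def ..

lemma int_form_eq_sum:
  "int_form G x y = (\<Sum>w\<in>UNIV. y $ w * int_form G x (E w))"
proof -
  define A where "A v w = (if v = w then of_int (euler G v) else if adj G v w then 1 else 0 :: real)"
    for v w
  have 1: "int_form G x (E w) = (\<Sum>v\<in>UNIV. x $ v * A v w)" for w
    unfolding int_form_def A_def[symmetric] axis_def
    by (simp add: if_distrib[of "\<lambda>t. t * _"] if_distrib[of "\<lambda>t. _ * t"] cong: if_cong)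
  have "int_form G x y = (\<Sum>w\<in>UNIV. \<Sum>v\<in>UNIV. x $ v * y $ w * A v w)"
    unfolding int_form_def A_def[symmetric] by (rule sum.swap)
  then show ?thesis
    unfolding 1 by (simp add: sum_distrib_left mult_ac)
qed

lemma int_form_axis:
  "int_form G x (E w) = x $ w * of_int (euler G w) + (\<Sum>u\<in>neighbours w. x $ u)"
proof -
  have "int_form G x (E w) = (\<Sum>v\<in>UNIV. x $ v *
      (if v = w then of_int (euler G v) else if adj G v w then 1 else 0))"
    unfolding int_form_def
  proof (rule sum.cong[OF refl])
    fix v :: 'v
    let ?c = "\<lambda>u. if v = u then of_int (euler G v) else if adj G v u then 1 else 0 :: real"
    have "(\<Sum>u\<in>UNIV. x $ v * E w $ u * ?c u) = (\<Sum>u\<in>UNIV. if u = w then x $ v * ?c u else 0)"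
      by (rule sum.cong) (auto simp: axis_def)
    then show "(\<Sum>u\<in>UNIV. x $ v * E w $ u * ?c u) = x $ v * ?c w" by simp
  qed
  also have "\<dots> = (\<Sum>v\<in>UNIV. (if v = w then x $ w * of_int (euler G w) else 0)
      + (if adj G v w then x $ v else 0))"
    by (rule sum.cong) (auto simp: adj_irrefl)
  also have "\<dots> = x $ w * of_int (euler G w) + (\<Sum>v\<in>UNIV. if adj G v w then x $ v else 0)"
    by (simp add: sum.distrib)
  also have "(\<Sum>v\<in>UNIV. if adj G v w then x $ v else 0) = (\<Sum>u\<in>neighbours w. x $ u)"
    unfolding neighbours_def by (subst sum.inter_filter[symmetric]) (auto intro!: sum.cong simp: adj_sym)
  finally show ?thesis .
qed

lemma dual_coord_eq:
  "dual_coord x w = of_int (beta w) * x $ w - (\<Sum>u\<in>neighbours w. x $ u)"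
  unfolding dual_coord_def int_form_axis beta_def by simp

lemma dual_coord_linear [simp]:
  "dual_coord (x + y) w = dual_coord x w + dual_coord y w"
  "dual_coord (x - y) w = dual_coord x w - dual_coord y w"
  "dual_coord (c *\<^sub>R x) w = c * dual_coord x w"
  "dual_coord 0 w = 0"
  by (simp_all add: dual_coord_eq sum.distrib sum_subtractf algebra_simps sum_distrib_left)

lemma dual_coord_sum [simp]: "dual_coord (\<Sum>i\<in>I. f i) w = (\<Sum>i\<in>I. dual_coord (f i) w)"
  by (induction I rule: infinite_finite_induct) auto

lemma dual_coord_axis:
  "dual_coord (E v) w = (if v = w then of_int (beta w) else if adj G v w then -1 else 0)"
proof -
  have "(\<Sum>u\<in>neighbours w. (E v :: real^'v) $ u) = (if v \<in> neighbours w then 1 else 0)"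
    unfolding axis_def by (simp add: sum.delta)
  moreover have "v \<in> neighbours w \<longleftrightarrow> adj G v w" unfolding neighbours_def by (simp add: adj_sym)
  ultimately show ?thesis by (auto simp: dual_coord_eq axis_def adj_irrefl)
qed

lemma int_form_dual_coord: "int_form G x y = - (\<Sum>w\<in>UNIV. y $ w * dual_coord x w)"
  unfolding dual_coord_def by (subst int_form_eq_sum) (simp add: sum_negf)

lemma int_form_linear:
  "int_form G (x + x') y = int_form G x y + int_form G x' y"
  "int_form G (x - x') y = int_form G x y - int_form G x' y"
  "int_form G (c *\<^sub>R x) y = c * int_form G x y"
  "int_form G x (y + y') = int_form G x y + int_form G x y'"
  "int_form G x (y - y') = int_form G x y - int_form G x y'"
  "int_form G x (c *\<^sub>R y) = c * int_form G x y"
  "int_form G 0 y = 0" "int_form G x 0 = 0"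
  by (simp_all add: int_form_dual_coord algebra_simps sum.distrib sum_subtractf sum_distrib_left)

lemma int_form_sum:
  "int_form G (\<Sum>i\<in>I. f i) y = (\<Sum>i\<in>I. int_form G (f i) y)"
  "int_form G x (\<Sum>i\<in>I. f i) = (\<Sum>i\<in>I. int_form G x (f i))"
  by (induction I rule: infinite_finite_induct) (auto simp: int_form_linear)

lemma int_form_sym: "int_form G x y = int_form G y x"
proof -
  have "int_form G x y = (\<Sum>v\<in>UNIV. \<Sum>w\<in>UNIV. y $ v * x $ w *
        (if v = w then of_int (euler G v) else if adj G v w then 1 else 0))"
    unfolding int_form_def
    by (subst sum.swap) (intro sum.cong refl, auto simp: adj_sym)
  then show ?thesis unfolding int_form_def .
qed

lemma dual_coord_inject:
  assumes "\<And>w. dual_coord x w = dual_coord y w"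
  shows "x = y"
proof (rule ccontr)
  assume "x \<noteq> y"
  then have "int_form G (x - y) (x - y) < 0"
    using negdef unfolding negative_definite_def by simp
  moreover have "int_form G (x - y) (x - y) = 0"
    by (subst int_form_dual_coord) (simp add: assms)
  ultimately show False by simp
qed

lemma det_in_Ints:
  fixes A :: "real^'n^'n"
  assumes "\<And>i j. A $ i $ j \<in> \<int>"
  shows "det A \<in> \<int>"
  unfolding det_def by (intro Ints_sum Ints_mult Ints_prod Ints_of_int assms)

text \<open>Membership in the dual lattice requires rational coordinates. Cramer's rule provides them, because
  it expresses the solution through determinants of integral matrices.\<close>

lemma E_star_exists:
  "\<exists>x. x \<in> dual_lattice G \<and> (\<forall>w. int_form G x (E w) = (if v = w then - 1 else 0))"
proof -
  define A :: "real^'v^'v" where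
    "A = (\<chi> w u. if u = w then of_int (euler G w) else if adj G w u then 1 else 0)"
  have A_mult: "(A *v x) $ w = int_form G x (E w)" for x w
  proof -
    have "(A *v x) $ w = (\<Sum>u\<in>UNIV. (if u = w then x $ w * of_int (euler G w) else 0)
      + (if adj G w u then x $ u else 0))"
      unfolding A_def matrix_vector_mult_def vec_lambda_beta
      by (rule sum.cong) (auto simp: adj_irrefl)
    also have "\<dots> = x $ w * of_int (euler G w) + (\<Sum>u\<in>UNIV. if adj G w u then x $ u else 0)"
      by (simp add: sum.distrib)
    also have "(\<Sum>u\<in>UNIV. if adj G w u then x $ u else 0) = (\<Sum>u\<in>neighbours w. x $ u)"
      unfolding neighbours_def by (subst sum.inter_filter[symmetric]) auto
    finally show ?thesis by (simp add: int_form_axis)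
  qed
  have "\<forall>x. A *v x = 0 \<longrightarrow> x = 0"
  proof (intro allI impI)
    fix x assume "A *v x = 0"
    then have "int_form G x (E w) = 0" for w using A_mult[of x w] by simp
    then show "x = 0" using dual_coord_inject[of x 0] by (simp add: dual_coord_def int_form_linear)
  qed
  then have det: "det A \<noteq> 0"
    by (simp add: invertible_det_nz[symmetric] invertible_left_inverse matrix_left_invertible_ker)
  define b :: "real^'v" where "b = (\<chi> w. if v = w then - 1 else 0)"
  define x where "x = (\<chi> k. det (\<chi> i j. if j = k then b $ i else A $ i $ j) / det A)"
  have Ax: "A *v x = b" using cramer[OF det] x_def by blast
  have A_Ints: "A $ i $ j \<in> \<int>" for i j unfolding A_def by simp
  have b_Ints: "b $ i \<in> \<int>" for i unfolding b_def by simp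
  have rat: "x $ u \<in> \<rat>" for u
    unfolding x_def vec_lambda_beta
    by (intro Rats_divide set_mp[OF Ints_subset_Rats] det_in_Ints) (simp_all add: A_Ints b_Ints)
  have form: "int_form G x (E w) = (if v = w then - 1 else 0)" for w
    using Ax unfolding A_mult[symmetric] b_def by simp
  have "int_form G x y \<in> \<int>" if "y \<in> std_lattice" for y
    using that unfolding std_lattice_def
    by (subst int_form_eq_sum) (auto simp: form intro!: Ints_sum)
  then have "x \<in> dual_lattice G" unfolding dual_lattice_def using rat by blast
  then show ?thesis using form by blast
qed

lemma E_star_spec:
  "E_star G v \<in> dual_lattice G \<and> (\<forall>w. int_form G (E_star G v) (E w) = (if v = w then - 1 else 0))"
proof -
  obtain x where x: "x \<in> dual_lattice G \<and> (\<forall>w. int_form G x (E w) = (if v = w then - 1 else 0))"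
    using E_star_exists by blast
  show ?thesis
    unfolding E_star_def
  proof (rule theI[where P = "\<lambda>x. x \<in> dual_lattice G \<and>
      (\<forall>w. int_form G x (E w) = (if v = w then - 1 else 0))", OF x])
    fix y assume "y \<in> dual_lattice G \<and> (\<forall>w. int_form G y (E w) = (if v = w then - 1 else 0))"
    then show "y = x" using x by (intro dual_coord_inject) (simp add: dual_coord_def)
  qed
qed

lemma E_star_std: "E_star G v \<in> std_lattice"
  using E_star_spec unimodular by simp

lemma dual_coord_E_star [simp]: "dual_coord (E_star G v) w = (if v = w then 1 else 0)"
  using E_star_spec by (simp add: dual_coord_def)

lemma E_star_expansion: "x = (\<Sum>w\<in>UNIV. dual_coord x w *\<^sub>R E_star G w)"
  by (rule dual_coord_inject) (simp add: if_distrib[of "\<lambda>t. _ * t"] cong: if_cong)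

lemma canonical_class_form: "int_form G (canonical_class G) (E v) = - of_int (euler G v) - 2"
proof -
  define x where "x = (\<Sum>v\<in>UNIV. of_int (euler G v + 2) *\<^sub>R E_star G v)"
  have std: "x \<in> std_lattice"
    using E_star_std unfolding x_def std_lattice_def by (auto intro!: Ints_sum Ints_mult simp del: of_int_add)
  have dc: "dual_coord x v = of_int (euler G v) + 2" for v
    unfolding x_def by (simp add: if_distrib[of "\<lambda>t. _ * t"] cong: if_cong)
  have spec: "x \<in> dual_lattice G \<and> (\<forall>v. int_form G x (E v) = - of_int (euler G v) - 2)"
  proof
    show "x \<in> dual_lattice G" using std unimodular by simp
    show "\<forall>v. int_form G x (E v) = - of_int (euler G v) - 2"
    proof
      fix v show "int_form G x (E v) = - of_int (euler G v) - 2"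
        using dc[of v] unfolding dual_coord_def by simp
    qed
  qed
  have "canonical_class G \<in> dual_lattice G \<and>
    (\<forall>v. int_form G (canonical_class G) (E v) = - of_int (euler G v) - 2)"
    unfolding canonical_class_def
  proof (rule theI[where P = "\<lambda>x. x \<in> dual_lattice G \<and>
      (\<forall>v. int_form G x (E v) = - of_int (euler G v) - 2)", OF spec])
    fix y assume "y \<in> dual_lattice G \<and> (\<forall>v. int_form G y (E v) = - of_int (euler G v) - 2)"
    then show "y = x" using spec by (intro dual_coord_inject) (simp add: dual_coord_def)
  qed
  then show ?thesis by blast
qed

lemma J_sym: "J G v w = J G w v"
  unfolding J_def by (simp add: int_form_sym)

text \<open>Split \<open>x = p - n\<close> into its positive and negative part. Then \<open>(x, n) \<le> 0\<close> by assumption, while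
  \<open>(p, n) \<ge> 0\<close> because \<open>p\<close> and \<open>n\<close> have disjoint supports. So \<open>(n, n) \<ge> 0\<close>, and \<open>n = 0\<close> by
  definiteness.\<close>

lemma nonneg_if_dual_coord_nonneg:
  assumes "\<And>w. 0 \<le> dual_coord x w"
  shows "0 \<le> x $ v"
proof -
  define p n :: "real^'v" where "p = (\<chi> w. max 0 (x $ w))" and "n = (\<chi> w. max 0 (- (x $ w)))"
  have x: "x = p - n" by (simp add: p_def n_def vec_eq_iff max_def)
  have "int_form G x n \<le> 0"
    unfolding int_form_dual_coord by (simp, intro sum_nonneg mult_nonneg_nonneg assms) (simp add: n_def)
  moreover have "0 \<le> int_form G p n"
    unfolding int_form_def
  proof (intro sum_nonneg)
    fix v w
    have "p $ v * n $ v = 0" by (simp add: p_def n_def max_def)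
    moreover have "0 \<le> p $ v * n $ w" by (simp add: p_def n_def)
    ultimately show "0 \<le> p $ v * n $ w * (if v = w then real_of_int (euler G v) else if adj G v w then 1 else 0)"
      by auto
  qed
  ultimately have "0 \<le> int_form G n n" unfolding x int_form_linear by simp
  then have "n = 0" using negdef unfolding negative_definite_def by (meson not_less)
  then have "n $ v = 0" by simp
  then show ?thesis by (simp add: n_def max_def split: if_splits)
qed

text \<open>A coordinate that vanishes forces the coordinates of all neighbours to vanish, and so, by connectedness,
  all coordinates.\<close>

lemma pos_if_dual_coord_nonneg:
  assumes "\<And>w. 0 \<le> dual_coord x w" and "x \<noteq> 0"
  shows "0 < x $ v"
proof -
  have nn: "0 \<le> x $ w" for w by (rule nonneg_if_dual_coord_nonneg) (rule assms)
  have step: "x $ u = 0" if "x $ w = 0" "adj G w u" for w u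
  proof -
    have "(\<Sum>u\<in>neighbours w. x $ u) \<le> 0"
      using assms(1)[of w] that(1) by (simp add: dual_coord_eq)
    then have "(\<Sum>u\<in>neighbours w. x $ u) = 0" using nn by (simp add: sum_nonneg order_antisym)
    then show ?thesis using that(2) nn by (subst (asm) sum_nonneg_eq_0_iff) (auto simp: neighbours_def)
  qed
  have "x $ v \<noteq> 0"
  proof
    assume 0: "x $ v = 0"
    have "x $ u = 0" for u
      using adj_connected[of v u] by (induction rule: rtranclp_induct) (auto intro: 0 step)
    then have "x = 0" by (simp add: vec_eq_iff)
    then show False using assms(2) by simp
  qed
  then show ?thesis using nn[of v] by simp
qed

lemma E_star_pos: "0 < E_star G v $ w"
proof (rule pos_if_dual_coord_nonneg)
  show "E_star G v \<noteq> 0" using dual_coord_E_star[of v v] by force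
qed simp

text \<open>Unimodularity makes the positive coordinates of \<open>E\<^sub>v\<^sup>*\<close> integral. This bound is what makes all the
  counts below finite.\<close>

lemma E_star_ge_1: "1 \<le> E_star G v $ w"
proof -
  have "E_star G v $ w \<in> \<int>" using E_star_std unfolding std_lattice_def by blast
  then show ?thesis using E_star_pos[of v w] by (auto elim!: Ints_cases)
qed

lemma beta_pos: "0 < beta v"
proof -
  have "int_form G (E v) (E v) < 0"
    using negdef unfolding negative_definite_def by (simp add: axis_eq_0_iff)
  then have "0 < dual_coord (E v) v" by (simp add: dual_coord_def)
  then show ?thesis by (simp add: dual_coord_axis)
qed

lemma std_lattice_dual_coord:
  assumes "x \<in> std_lattice" shows "dual_coord x w \<in> \<int>"
  using assms unfolding std_lattice_def dual_coord_eq by (auto intro!: Ints_diff Ints_mult Ints_sum)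

lemma std_lattice_add: "x \<in> std_lattice \<Longrightarrow> y \<in> std_lattice \<Longrightarrow> x + y \<in> std_lattice"
  and std_lattice_diff: "x \<in> std_lattice \<Longrightarrow> y \<in> std_lattice \<Longrightarrow> x - y \<in> std_lattice"
  and std_lattice_scale: "x \<in> std_lattice \<Longrightarrow> of_int c *\<^sub>R x \<in> std_lattice"
  and std_lattice_zero: "(0 :: real^'v) \<in> std_lattice"
  and std_lattice_axis: "(E v :: real^'v) \<in> std_lattice"
  for x y :: "real^'v"
  unfolding std_lattice_def by (auto simp: axis_def)

lemma std_lattice_sum: "(\<And>i. i \<in> I \<Longrightarrow> f i \<in> std_lattice) \<Longrightarrow> (\<Sum>i\<in>I. f i :: real^'v) \<in> std_lattice"
  unfolding std_lattice_def by (auto intro!: Ints_sum)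

lemma std_lattice_nat_scale: "x \<in> std_lattice \<Longrightarrow> real n *\<^sub>R (x :: real^'v) \<in> std_lattice"
  unfolding std_lattice_def by auto

lemma lipman_cone_iff: "x \<in> lipman_cone G \<longleftrightarrow> (\<forall>w. 0 \<le> dual_coord x w)"
  unfolding lipman_cone_def dual_coord_def by simp

end

section \<open>Rooting the plumbing tree\<close>

lemma simple_path_in_connected:
  assumes "(\<lambda>a b. R a b \<and> b \<in> X)\<^sup>*\<^sup>* x y" "x \<in> X"
  shows "\<exists>vs. distinct vs \<and> vs \<noteq> [] \<and> set vs \<subseteq> X \<and> successively R vs \<and> hd vs = x \<and> last vs = y"
  using assms(1)
proof (induction rule: rtranclp_induct)
  case base
  show ?case by (rule exI[of _ "[x]"]) (use assms(2) in auto)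
next
  case (step y z)
  then obtain vs where vs: "distinct vs" "vs \<noteq> []" "set vs \<subseteq> X" "successively R vs"
    "hd vs = x" "last vs = y" by blast
  show ?case
  proof (cases "z \<in> set vs")
    case False
    then show ?thesis using vs step
      by (intro exI[of _ "vs @ [z]"]) (auto simp: successively_append_iff)
  next
    case True
    then obtain as bs where ab: "vs = as @ z # bs" by (auto simp: in_set_conv_decomp)
    have "successively R (as @ [z])" using vs(4) unfolding ab
      by (auto simp: successively_append_iff successively_Cons)
    moreover have "hd (as @ [z]) = x" using vs(5) unfolding ab by (cases as) auto
    ultimately show ?thesis using vs unfolding ab
      by (intro exI[of _ "as @ [z]"]) auto
  qed
qed

context unimodular_plumbing_tree
begin

definition connected_set :: "'v set \<Rightarrow> bool" where
  "connected_set X \<longleftrightarrow> (\<forall>x\<in>X. \<forall>y\<in>X. (\<lambda>a b. adj G a b \<and> b \<in> X)\<^sup>*\<^sup>* x y)"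

text \<open>Two neighbours of \<open>w\<close> in a connected set that avoids \<open>w\<close> are joined by a simple path inside
  that set; together with \<open>w\<close> it is a cycle.\<close>

lemma unique_neighbour_in_connected_set:
  assumes X: "connected_set X" "w \<notin> X" and xy: "x \<in> X" "y \<in> X" "adj G w x" "adj G w y"
  shows "x = y"
proof (rule ccontr)
  assume "x \<noteq> y"
  obtain vs where vs: "distinct vs" "vs \<noteq> []" "set vs \<subseteq> X" "successively (adj G) vs"
    "hd vs = x" "last vs = y"
    using simple_path_in_connected[of "adj G" X x y] X(1) xy unfolding connected_set_def by blast
  obtain a b cs where "vs = a # b # cs"
    using vs(2,5,6) \<open>x \<noteq> y\<close> by (cases vs; cases "tl vs") auto
  then have len: "3 \<le> length (w # vs)" by simp
  have "distinct (w # vs)" using vs X(2) by auto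
  moreover have "successively (adj G) (w # vs)"
    using vs xy by (cases vs) auto
  moreover have "adj G (last (w # vs)) (hd (w # vs))"
    using vs xy(4) adj_sym by auto
  ultimately have "has_cycle (adj G)" unfolding has_cycle_def using len by blast
  then show False using tree unfolding plumbing_tree_def by blast
qed

lemma connected_set_insert:
  assumes X: "connected_set X" and x: "x \<in> X" "adj G w x"
  shows "connected_set (insert w X)"
proof -
  let ?R = "\<lambda>a b. adj G a b \<and> b \<in> insert w X"
  have old: "?R\<^sup>*\<^sup>* a b" if "a \<in> X" "b \<in> X" for a b
  proof -
    have "(\<lambda>a b. adj G a b \<and> b \<in> X)\<^sup>*\<^sup>* a b" using X that unfolding connected_set_def by blast
    then show ?thesis by (rule rtranclp_mono[THEN predicate2D, rotated]) auto
  qed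
  have "?R w x" "?R x w" using x adj_sym by auto
  then have w: "?R\<^sup>*\<^sup>* w x" "?R\<^sup>*\<^sup>* x w" by (simp_all add: r_into_rtranclp)
  have "?R\<^sup>*\<^sup>* a b" if "a \<in> insert w X" "b \<in> insert w X" for a b
  proof -
    have "?R\<^sup>*\<^sup>* a x" using that(1) w(1) old x(1) by (cases "a = w") auto
    moreover have "?R\<^sup>*\<^sup>* x b" using that(2) w(2) old x(1) by (cases "b = w") auto
    ultimately show ?thesis by (rule rtranclp_trans)
  qed
  then show ?thesis unfolding connected_set_def by blast
qed

lemma exists_adjacent_outside:
  assumes "r \<in> X" "X \<noteq> UNIV"
  shows "\<exists>w x. w \<notin> X \<and> x \<in> X \<and> adj G w x"
proof (rule ccontr)
  assume neg: "\<not> ?thesis"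
  obtain u where "u \<notin> X" using assms(2) by blast
  have "v \<in> X" if "(adj G)\<^sup>*\<^sup>* r v" for v
    using that by (induction rule: rtranclp_induct) (use assms(1) neg adj_sym in blast)+
  then show False using adj_connected[of r u] \<open>u \<notin> X\<close> by blast
qed

text \<open>Add one vertex after the other, always one that is adjacent to the connected set \<open>X\<close> built so far; it
  then has exactly one neighbour in \<open>X\<close>, and \<open>idx\<close> records the time of its arrival.\<close>

lemma growing_enumeration:
  assumes "1 \<le> n" "n \<le> CARD('v)"
  shows "\<exists>X (idx :: 'v \<Rightarrow> nat). r \<in> X \<and> connected_set X \<and> card X = n \<and> idx r = 0 \<and>
    inj_on idx X \<and> idx ` X \<subseteq> {..<n} \<and>
    (\<forall>w\<in>X. w \<noteq> r \<longrightarrow> (\<exists>!p. p \<in> X \<and> adj G w p \<and> idx p < idx w))"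
  using assms
proof (induction n rule: dec_induct)
  case base
  have "connected_set {r}" unfolding connected_set_def by simp
  then show ?case
    by (intro exI[of _ "{r}"] exI[of _ "\<lambda>_. 0"]) auto
next
  case (step n)
  then obtain X and idx :: "'v \<Rightarrow> nat" where IH: "r \<in> X" "connected_set X" "card X = n" "idx r = 0"
    "inj_on idx X" "idx ` X \<subseteq> {..<n}"
    "\<forall>w\<in>X. w \<noteq> r \<longrightarrow> (\<exists>!p. p \<in> X \<and> adj G w p \<and> idx p < idx w)" by auto
  have "X \<noteq> UNIV" using IH(3) step by auto
  then obtain w x where wx: "w \<notin> X" "x \<in> X" "adj G w x"
    using exists_adjacent_outside IH(1) by blast
  define idx' where "idx' = idx(w := n)"
  have idx': "idx' v = idx v" if "v \<in> X" for v using that wx(1) unfolding idx'_def by auto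
  have lt: "idx v < n" if "v \<in> X" for v using IH(6) that by auto
  have uniq: "\<exists>!p. p \<in> insert w X \<and> adj G v p \<and> idx' p < idx' v" if v: "v \<in> insert w X" "v \<noteq> r" for v
  proof (cases "v = w")
    case True
    have "x \<in> insert w X \<and> adj G v x \<and> idx' x < idx' v"
      using wx True lt[OF wx(2)] unfolding idx'_def by auto
    moreover have "p = x" if "p \<in> insert w X \<and> adj G v p \<and> idx' p < idx' v" for p
      using unique_neighbour_in_connected_set[OF IH(2) wx(1), of p x] that wx True by auto
    ultimately show ?thesis by blast
  next
    case False
    then have vX: "v \<in> X" using v by simp
    have "p \<in> insert w X \<and> adj G v p \<and> idx' p < idx' v \<longleftrightarrow> p \<in> X \<and> adj G v p \<and> idx p < idx v" for p
      using vX idx' lt[OF vX] wx(1) by (cases "p = w") (auto simp: idx'_def)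
    then show ?thesis using IH(7) vX v(2) by simp
  qed
  show ?case
  proof (intro exI conjI)
    show "r \<in> insert w X" using IH(1) by simp
    show "connected_set (insert w X)" by (rule connected_set_insert) (use IH wx in auto)
    show "card (insert w X) = Suc n" using wx IH(3) by simp
    show "idx' r = 0" using idx' IH by simp
    show "inj_on idx' (insert w X)"
      using IH(5) lt idx' wx(1) unfolding idx'_def inj_on_def by (auto split: if_splits)
    show "idx' ` insert w X \<subseteq> {..<Suc n}"
      using lt unfolding idx'_def by (auto intro: less_SucI)
    show "\<forall>v\<in>insert w X. v \<noteq> r \<longrightarrow> (\<exists>!p. p \<in> insert w X \<and> adj G v p \<and> idx' p < idx' v)"
      using uniq by blast
  qed
qed

lemma rooted_enumeration:
  "\<exists>idx :: 'v \<Rightarrow> nat. inj idx \<and> idx r = 0 \<and>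
    (\<forall>w. w \<noteq> r \<longrightarrow> (\<exists>!p. adj G w p \<and> idx p < idx w))"
proof -
  have "1 \<le> CARD('v)" using card_gt_0_iff[of "UNIV :: 'v set"] by simp
  then obtain X and idx :: "'v \<Rightarrow> nat" where X: "card X = CARD('v)" "idx r = 0" "inj_on idx X"
    "\<forall>w\<in>X. w \<noteq> r \<longrightarrow> (\<exists>!p. p \<in> X \<and> adj G w p \<and> idx p < idx w)"
    using growing_enumeration[of "CARD('v)" r] by auto
  have "X = UNIV" using X(1) by (simp add: card_eq_UNIV_imp_eq_UNIV)
  then show ?thesis using X by auto
qed

end

text \<open>An arrival order of the vertices stands in for the distance from the root: the neighbour with smaller
  index is the parent, and recursion away from the root becomes induction on the index.\<close>

locale rooted_plumbing_tree = unimodular_plumbing_tree G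
  for G :: "('v::finite) plumbing_graph" +
  fixes r :: 'v and idx :: "'v \<Rightarrow> nat"
  assumes inj_idx: "inj idx" and idx_root: "idx r = 0"
    and unique_parent: "w \<noteq> r \<Longrightarrow> \<exists>!p. adj G w p \<and> idx p < idx w"
begin

definition parent :: "'v \<Rightarrow> 'v" where
  "parent w = (THE p. adj G w p \<and> idx p < idx w)"

definition children :: "'v \<Rightarrow> 'v set" where
  "children u = {w. adj G u w \<and> idx u < idx w}"

lemma parent: "w \<noteq> r \<Longrightarrow> adj G w (parent w)" "w \<noteq> r \<Longrightarrow> idx (parent w) < idx w"
  using theI'[OF unique_parent[of w]] unfolding parent_def by blast+

lemma parent_unique: "w \<noteq> r \<Longrightarrow> adj G w p \<Longrightarrow> idx p < idx w \<Longrightarrow> p = parent w"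
  using unique_parent[of w] parent[of w] by blast

lemma idx_neq: "adj G u w \<Longrightarrow> idx u \<noteq> idx w"
  using inj_idx adj_irrefl by (metis injD)

lemma children_iff: "w \<in> children u \<longleftrightarrow> w \<noteq> r \<and> parent w = u"
proof
  assume "w \<in> children u"
  then have "adj G w u" "idx u < idx w" using adj_sym unfolding children_def by auto
  moreover from this have "w \<noteq> r" using idx_root by auto
  ultimately show "w \<noteq> r \<and> parent w = u" using parent_unique by blast
next
  assume "w \<noteq> r \<and> parent w = u"
  then show "w \<in> children u" using parent[of w] adj_sym unfolding children_def by auto
qed

lemma neighbours_root: "neighbours r = children r"
  unfolding neighbours_def children_def using idx_root idx_neq by fastforce

lemma neighbours_nonroot: "w \<noteq> r \<Longrightarrow> neighbours w = insert (parent w) (children w)"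
proof (rule set_eqI)
  fix u assume w: "w \<noteq> r"
  have "adj G w u \<longleftrightarrow> adj G w u \<and> idx u < idx w \<or> adj G w u \<and> idx w < idx u"
    using idx_neq[of w u] by auto
  moreover have "adj G w u \<and> idx u < idx w \<longleftrightarrow> u = parent w"
    using parent[OF w] parent_unique[OF w] by blast
  ultimately show "u \<in> neighbours w \<longleftrightarrow> u \<in> insert (parent w) (children w)"
    unfolding neighbours_def children_def by blast
qed

lemma parent_notin_children: "w \<noteq> r \<Longrightarrow> parent w \<notin> children w"
  unfolding children_def using parent[of w] by auto

lemma valency_root: "valency G r = card (children r)"
  by (simp add: valency_neighbours neighbours_root)

lemma valency_nonroot: "w \<noteq> r \<Longrightarrow> valency G w = Suc (card (children w))"
  by (simp add: valency_neighbours neighbours_nonroot parent_notin_children)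

lemma sum_card_children: "(\<Sum>w\<in>UNIV. card (children w)) = CARD('v) - 1"
proof -
  have "(\<Union>w. children w) = UNIV - {r}" using children_iff by auto
  moreover have "card (\<Union>w. children w) = (\<Sum>w\<in>UNIV. card (children w))"
    by (rule card_UN_disjoint) (auto simp: children_iff)
  ultimately show ?thesis by simp
qed

end

context unimodular_plumbing_tree
begin

text \<open>A vertex other than the root is adjacent to its parent and its children, and it is the child of exactly
  one vertex.\<close>

lemma sum_valency: "(\<Sum>w\<in>UNIV. int (valency G w)) = 2 * int CARD('v) - 2"
proof -
  obtain r :: 'v where True by blast
  obtain idx :: "'v \<Rightarrow> nat" where idx: "inj idx" "idx r = 0"
    "\<And>w. w \<noteq> r \<Longrightarrow> \<exists>!p. adj G w p \<and> idx p < idx w"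
    using rooted_enumeration by blast
  interpret rooted_plumbing_tree G r idx by unfold_locales (use idx in auto)
  have c: "1 \<le> CARD('v)" using card_gt_0_iff[of "UNIV :: 'v set"] by simp
  have "(\<Sum>w\<in>UNIV. int (valency G w)) =
    int (valency G r) + (\<Sum>w\<in>UNIV - {r}. int (valency G w))"
    by (subst sum.remove[of UNIV r]) auto
  also have "(\<Sum>w\<in>UNIV - {r}. int (valency G w)) = (\<Sum>w\<in>UNIV - {r}. 1 + int (card (children w)))"
    by (rule sum.cong) (auto simp: valency_nonroot)
  also have "\<dots> = int (CARD('v) - 1) + (\<Sum>w\<in>UNIV - {r}. int (card (children w)))"
    by (simp add: sum.distrib)
  also have "int (valency G r) + \<dots> = int (CARD('v) - 1) + (\<Sum>w\<in>UNIV. int (card (children w)))"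
    by (subst sum.remove[of UNIV r "\<lambda>w. int (card (children w))"]) (auto simp: valency_root)
  also have "\<dots> = int (CARD('v) - 1) + int (CARD('v) - 1)"
    by (simp add: sum_card_children flip: of_nat_sum)
  finally show ?thesis using c by (simp add: of_nat_diff)
qed

lemma valency_pos: "1 \<le> valency G v"
proof -
  obtain n where n: "3 \<le> valency G n" using nodes_nonempty unfolding nodes_def by blast
  show ?thesis
  proof (cases "n = v")
    case False
    from adj_connected[of v n] obtain u where "adj G v u"
      using False by (auto elim: converse_rtranclpE)
    then have "neighbours v \<noteq> {}" unfolding neighbours_def by blast
    then have "0 < card (neighbours v)" by (simp add: card_gt_0_iff)
    then show ?thesis unfolding valency_neighbours by simp
  qed (use n in simp)
qed

text \<open>Rewrites \<open>\<Sum>\<^sub>v (\<delta>\<^sub>v - 2) = -2\<close>. The number of ends bounds the degree of the Ehrhart quasipolynomial, and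
  the sum is the number of differences that lead from it to the counting function of \<open>Z\<close>; the excess of two is
  the degree of \<open>\<chi>\<close>.\<close>

lemma card_ends: "card (ends G) = (\<Sum>n\<in>nodes G. valency G n - 2) + 2"
proof -
  have "(\<Sum>w\<in>UNIV. int (valency G w) - 2) = - 2"
    using sum_valency by (simp add: sum_subtractf)
  moreover have "(\<Sum>w\<in>UNIV. int (valency G w) - 2) =
    (\<Sum>w\<in>UNIV. (if w \<in> nodes G then int (valency G w - 2) else 0) - (if w \<in> ends G then 1 else 0))"
  proof (rule sum.cong)
    fix w
    show "int (valency G w) - 2 = (if w \<in> nodes G then int (valency G w - 2) else 0)
      - (if w \<in> ends G then 1 else 0)"
      using valency_pos[of w] unfolding nodes_def ends_def by auto
  qed simp
  moreover have "\<dots> = int (\<Sum>n\<in>nodes G. valency G n - 2) - int (card (ends G))"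
    by (simp add: sum_subtractf sum.If_cases)
  ultimately show ?thesis by linarith
qed

end

section \<open>Power series in several variables\<close>

lemma abs_summable_prod_PiE:
  fixes f :: "'a \<Rightarrow> 'b \<Rightarrow> 'c :: {banach, real_normed_div_algebra, comm_semiring_1}"
  assumes "finite A" and "\<And>x. x \<in> A \<Longrightarrow> (\<lambda>y. norm (f x y)) summable_on B x"
  shows "(\<lambda>g. norm (\<Prod>x\<in>A. f x (g x))) summable_on PiE A B"
  using assms
proof (induction A rule: finite_induct)
  case empty
  then show ?case by simp
next
  case (insert x A)
  let ?h = "\<lambda>(y, g). g(x := y) :: 'a \<Rightarrow> 'b"
  let ?P = "\<lambda>g. \<Prod>x\<in>A. f x (g x)"
  have IH: "(\<lambda>g. norm (?P g)) summable_on PiE A B" using insert by blast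
  have inj: "inj_on ?h (B x \<times> PiE A B)"
    using inj_combinator[OF insert(2), of "B"] by simp
  have eq: "(\<Prod>z\<in>insert x A. f z ((g(x := y)) z)) = f x y * ?P g" for y g
  proof -
    have "(\<Prod>z\<in>A. f z ((g(x := y)) z)) = ?P g"
      by (rule prod.cong) (use insert(2) in auto)
    then show ?thesis using insert by simp
  qed
  have fx: "(\<lambda>y. norm (f x y)) summable_on B x" using insert by blast
  have "(\<lambda>p. norm ((\<lambda>(y, g). f x y * ?P g) p)) summable_on B x \<times> PiE A B"
    unfolding Infinite_Sum.abs_summable_on_Sigma_iff
    using IH fx infsum_nonneg[of "PiE A B" "\<lambda>g. norm (?P g)"]
    by (auto simp: norm_mult infsum_cmult_right' abs_mult intro!: summable_on_cmult_right summable_on_cmult_left)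
  moreover have "(\<lambda>g. norm (\<Prod>z\<in>insert x A. f z (g z))) \<circ> ?h =
      (\<lambda>p. norm ((\<lambda>(y, g). f x y * ?P g) p))"
    unfolding o_def case_prod_unfold eq ..
  ultimately have "(\<lambda>g. norm (\<Prod>z\<in>insert x A. f z (g z))) \<circ> ?h summable_on B x \<times> PiE A B"
    by simp
  then show ?case
    unfolding PiE_insert_eq using summable_on_reindex[OF inj] by blast
qed

lemma has_sum_prod_PiE:
  fixes f :: "'a \<Rightarrow> 'b \<Rightarrow> 'c :: {banach, real_normed_div_algebra, comm_semiring_1}"
  assumes "finite A" and "\<And>x. x \<in> A \<Longrightarrow> (\<lambda>y. norm (f x y)) summable_on B x"
    and "\<And>x. x \<in> A \<Longrightarrow> (f x has_sum s x) (B x)"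
  shows "((\<lambda>g. \<Prod>x\<in>A. f x (g x)) has_sum (\<Prod>x\<in>A. s x)) (PiE A B)"
proof -
  have "infsum (\<lambda>g. \<Prod>x\<in>A. f x (g x)) (PiE A B) = (\<Prod>x\<in>A. infsum (f x) (B x))"
    by (rule infsum_prod_PiE_abs) (use assms in auto)
  also have "\<dots> = (\<Prod>x\<in>A. s x)"
    by (rule prod.cong) (use assms(3) infsumI in auto)
  finally show ?thesis
    using has_sum_infsum[OF abs_summable_summable[OF
      abs_summable_prod_PiE[where f = f and A = A and B = B, OF assms(1,2)]]] by simp
qed

text \<open>Once the coefficients below \<open>n\<close> are known to vanish, the series divided by \<open>x^n\<close> tends to the
  coefficient \<open>a n\<close> at the origin.\<close>

lemma power_series_zero_coeffs:
  fixes a :: "nat \<Rightarrow> complex"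
  assumes "0 < s" and "\<And>x. norm x < s \<Longrightarrow> (\<lambda>n. a n * x ^ n) sums 0"
  shows "a n = 0"
proof (induction n rule: less_induct)
  case (less n)
  have "(\<lambda>j. a (j + n) * x ^ j) sums 0" if "x \<noteq> 0" "norm x < s" for x
  proof -
    have "(\<lambda>j. a (j + n) * x ^ (j + n)) sums (0 - (\<Sum>i<n. a i * x ^ i))"
      using assms(2)[OF that(2)] by (rule sums_split_initial_segment)
    also have "(\<Sum>i<n. a i * x ^ i) = 0" using less by simp
    finally have "(\<lambda>j. inverse (x ^ n) * (a (j + n) * x ^ (j + n))) sums (inverse (x ^ n) * 0)"
      by (intro sums_mult) simp
    moreover have "inverse (x ^ n) * (a (j + n) * x ^ (j + n)) = a (j + n) * x ^ j" for j
      using that(1) by (simp add: power_add)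
    ultimately show ?thesis by simp
  qed
  then have "((\<lambda>_ :: complex. 0) \<longlongrightarrow> a (0 + n)) (at 0)"
    using powser_limit_0_strong[of s "\<lambda>j. a (j + n)" "\<lambda>_. 0"] assms(1) by blast
  then show ?case using LIM_const_eq by force
qed

text \<open>Single out one variable. As a power series in it alone, the series has coefficients that are power series
  in the remaining variables; they vanish, and the induction hypothesis applies to each of them.\<close>

lemma multivariate_power_series_zero_coeffs:
  fixes c :: "('a \<Rightarrow> nat) \<Rightarrow> complex"
  assumes "finite A" "0 < s"
    and "\<And>t. (\<And>v. norm (t v) < s) \<Longrightarrow>
      ((\<lambda>m. c m * (\<Prod>v\<in>A. t v ^ m v)) has_sum 0) (PiE A (\<lambda>_. UNIV))"
    and "m \<in> PiE A (\<lambda>_. UNIV)"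
  shows "c m = 0"
  using assms(1,3,4)
proof (induction A arbitrary: c m rule: finite_induct)
  case empty
  from empty(1)[of "\<lambda>_. 0"] assms(2) have "(c has_sum 0) {\<lambda>_. undefined}" by simp
  then have "c (\<lambda>_. undefined) = 0"
    using has_sum_unique[OF has_sum_finite[of "{\<lambda>_. undefined}" c]] by simp
  then show ?case using empty by simp
next
  case (insert x A)
  let ?F = "PiE A (\<lambda>_. UNIV :: nat set)"
  let ?h = "\<lambda>(j, g). g(x := j) :: 'a \<Rightarrow> nat"
  have inj: "inj_on ?h (UNIV \<times> ?F)"
    using inj_combinator[OF insert(2), of "\<lambda>_. UNIV"] by simp
  have ins: "PiE (insert x A) (\<lambda>_. UNIV) = ?h ` (UNIV \<times> ?F)"
    by (rule PiE_insert_eq)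
  have pr: "(\<Prod>v\<in>insert x A. t v ^ (g(x := j)) v) = t x ^ j * (\<Prod>v\<in>A. t v ^ g v)" for t :: "'a \<Rightarrow> complex" and j g
  proof -
    have "(\<Prod>v\<in>A. t v ^ (g(x := j)) v) = (\<Prod>v\<in>A. t v ^ g v)"
      by (rule prod.cong) (use insert(2) in auto)
    then show ?thesis using insert by simp
  qed
  have two: "((\<lambda>(j, g). t x ^ j * (c (g(x := j)) * (\<Prod>v\<in>A. t v ^ g v))) has_sum 0) (UNIV \<times> ?F)"
    if "\<And>v. norm (t v) < s" for t
  proof -
    have "((\<lambda>m. c m * (\<Prod>v\<in>insert x A. t v ^ m v)) has_sum 0) (?h ` (UNIV \<times> ?F))"
      using insert(4)[of t] that unfolding ins by blast
    then show ?thesis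
      by (subst (asm) has_sum_reindex[OF inj]) (simp only: o_def case_prod_unfold pr mult_ac)
  qed
  have zero: "((\<lambda>g. c (g(x := j)) * (\<Prod>v\<in>A. t v ^ g v)) has_sum 0) ?F"
    if t: "\<And>v. norm (t v) < s" for t j
  proof -
    define S where "S j = infsum (\<lambda>g. c (g(x := j)) * (\<Prod>v\<in>A. t v ^ g v)) ?F" for j
    have tA: "(\<Prod>v\<in>A. (t(x := y)) v ^ g v) = (\<Prod>v\<in>A. t v ^ g v)" for y g
      by (rule prod.cong) (use insert(2) in auto)
    have two': "((\<lambda>(j, g). y ^ j * (c (g(x := j)) * (\<Prod>v\<in>A. t v ^ g v))) has_sum 0) (UNIV \<times> ?F)"
      if "norm y < s" for y
      using two[of "t(x := y)"] that t unfolding tA by simp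
    have smm: "(\<lambda>g. c (g(x := j)) * (\<Prod>v\<in>A. t v ^ g v)) summable_on ?F" for j
    proof -
      \<comment> \<open>Any fixed non-zero value of the singled out variable shows that the inner series converges.\<close>
      define y :: complex where "y = of_real (s / 2)"
      have y: "y \<noteq> 0" "norm y < s" using assms(2) unfolding y_def by auto
      have "(\<lambda>g. y ^ j * (c (g(x := j)) * (\<Prod>v\<in>A. t v ^ g v))) summable_on ?F"
        using has_sum_imp_summable[OF two'[OF y(2)]] by (rule summable_on_SigmaD1) simp
      then show ?thesis using y(1) by (simp add: summable_on_cmult_right')
    qed
    have hs: "((\<lambda>g. c (g(x := j)) * (\<Prod>v\<in>A. t v ^ g v)) has_sum S j) ?F" for j
      unfolding S_def using smm[of j] by simp
    have "(\<lambda>j. S j * y ^ j) sums 0" if y: "norm y < s" for y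
    proof -
      have "((\<lambda>j. y ^ j * S j) has_sum 0) UNIV"
        by (rule has_sum_SigmaD[OF two'[OF y]]) (simp add: has_sum_cmult_right[OF hs])
      then show ?thesis by (simp add: has_sum_imp_sums mult.commute)
    qed
    then have "S j = 0" by (rule power_series_zero_coeffs[OF assms(2)])
    then show ?thesis using hs[of j] by simp
  qed
  obtain j g where m: "m = g(x := j)" "g \<in> ?F"
    using insert(5) unfolding ins by auto
  have "c (g(x := j)) = 0"
    by (rule insert(3)[OF _ m(2), of "\<lambda>g. c (g(x := j))"]) (rule zero)
  then show ?case using m(1) by (simp only:)
qed

lemma fps_nth_one_minus_X_power:
  "fps_nth ((1 - fps_X :: real fps) ^ k) j = (-1) ^ j * of_nat (k choose j)"
proof (induction k arbitrary: j)
  case (Suc k)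
  have "fps_nth ((1 - fps_X :: real fps) ^ Suc k) j =
    fps_nth ((1 - fps_X) ^ k) j - (if j = 0 then 0 else fps_nth ((1 - fps_X) ^ k) (j - 1))"
    by (simp add: left_diff_distrib)
  then show ?case by (cases j) (simp_all add: Suc algebra_simps)
qed (simp add: binomial_eq_0 )

lemma fps_nth_inverse_one_minus_X [simp]: "fps_nth (inverse (1 - fps_X :: real fps)) j = 1"
proof -
  have "(1 - fps_X) * Abs_fps (\<lambda>_. 1 :: real) = 1"
    by (rule fps_ext) (simp add: left_diff_distrib)
  then have "inverse (1 - fps_X) = Abs_fps (\<lambda>_. 1 :: real)" by (rule fps_inverse_unique)
  then show ?thesis by simp
qed

text \<open>The expansion of \<open>(1 - X)^(d - 2)\<close> for \<open>d \<ge> 1\<close>; the only negative exponent is written as an inverse.\<close>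

definition vertex_series :: "nat \<Rightarrow> real fps" where
  "vertex_series d = (if d = 1 then inverse (1 - fps_X) else (1 - fps_X) ^ (d - 2))"

lemma vertex_series_sum:
  fixes u :: complex
  assumes "1 \<le> d" "norm u < 1"
  shows "(\<lambda>j. norm (of_real (fps_nth (vertex_series d) j) * u ^ j)) summable_on UNIV"
    and "((\<lambda>j. of_real (fps_nth (vertex_series d) j) * u ^ j) has_sum (1 - u) powi (int d - 2)) UNIV"
proof -
  let ?f = "\<lambda>j. of_real (fps_nth (vertex_series d) j) * u ^ j"
  have "(\<lambda>j. norm (?f j)) summable_on UNIV \<and> (?f has_sum (1 - u) powi (int d - 2)) UNIV"
  proof (cases "d = 1")
    case True
    then have f: "?f j = u ^ j" for j by (simp add: vertex_series_def)
    have "summable (\<lambda>j. norm (u ^ j))" using assms(2) by (simp add: norm_power summable_geometric)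
    then have "(\<lambda>j. norm (u ^ j)) summable_on UNIV"
      by (intro norm_summable_imp_summable_on) simp
    moreover have "((\<lambda>j. u ^ j) has_sum (1 / (1 - u))) UNIV"
      using assms(2) \<open>summable (\<lambda>j. norm (u ^ j))\<close> by (intro norm_summable_imp_has_sum geometric_sums)
    ultimately show ?thesis unfolding f using True by (simp add: power_int_minus field_simps)
  next
    case False
    define k where "k = d - 2"
    have d: "int d - 2 = int k" using False assms(1) k_def by simp
    have f: "?f j = of_nat (k choose j) * (- u) ^ j" for j
      using False by (simp add: vertex_series_def fps_nth_one_minus_X_power k_def power_minus[of u])
    have supp: "?f j = 0" if "j \<notin> {..k}" for j using that f by (simp add: binomial_eq_0)
    have "(\<Sum>j\<le>k. ?f j) = (1 - u) ^ k"
      using binomial_ring[of "- u" 1 k] unfolding f by simp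
    then have "(?f has_sum (1 - u) ^ k) {..k}"
      by (metis (no_types, lifting) finite_atMost has_sum_finite)
    then have "(?f has_sum (1 - u) ^ k) UNIV"
      by (subst has_sum_cong_neutral[where T = "{..k}" and g = ?f]) (use supp in auto)
    moreover have "(\<lambda>j. norm (?f j)) summable_on UNIV"
      by (subst summable_on_cong_neutral[where T = "{..k}" and g = "\<lambda>j. norm (?f j)"])
        (use supp in auto)
    ultimately show ?thesis unfolding d by simp
  qed
  then show "(\<lambda>j. norm (?f j)) summable_on UNIV" "(?f has_sum (1 - u) powi (int d - 2)) UNIV" by auto
qed

section \<open>The Taylor coefficients of the zeta function\<close>

text \<open>Coefficients indexed by integers, so that a dual coordinate can be used as an index regardless of its
  sign.\<close>

definition fps_at :: "real fps \<Rightarrow> int \<Rightarrow> real" where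
  "fps_at F i = (if i < 0 then 0 else fps_nth F (nat i))"

lemma fps_at_simps [simp]: "i < 0 \<Longrightarrow> fps_at F i = 0" "fps_at F (int n) = fps_nth F n"
  by (simp_all add: fps_at_def)

lemma tpow_add:
  assumes "0 \<le> x" "0 \<le> y" "x \<in> std_lattice" "y \<in> std_lattice"
  shows "tpow t (x + y) = tpow t x * tpow t y"
proof -
  have "(t $ v) powi \<lfloor>(x + y) $ v\<rfloor> = (t $ v) powi \<lfloor>x $ v\<rfloor> * (t $ v) powi \<lfloor>y $ v\<rfloor>" for v
  proof -
    have "x $ v \<in> \<int>" "y $ v \<in> \<int>" "0 \<le> x $ v" "0 \<le> y $ v"
      using assms by (auto simp: std_lattice_def less_eq_vec_def)
    then have "\<lfloor>(x + y) $ v\<rfloor> = \<lfloor>x $ v\<rfloor> + \<lfloor>y $ v\<rfloor>" "0 \<le> \<lfloor>x $ v\<rfloor>" "0 \<le> \<lfloor>y $ v\<rfloor>"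
      by (auto elim!: Ints_cases)
    then show ?thesis by (simp add: power_int_def nat_add_distrib power_add)
  qed
  then show ?thesis unfolding tpow_def by (simp add: prod.distrib)
qed

lemma tpow_zero [simp]: "tpow t 0 = 1"
  by (simp add: tpow_def)

lemma taylor_at_origin_unique:
  fixes p q :: "real^'v::finite \<Rightarrow> real"
  assumes p: "taylor_at_origin f p" and q: "taylor_at_origin f q"
  shows "p = q"
proof
  fix l :: "real^'v"
  let ?N = "{l \<in> std_lattice. 0 \<le> l} :: (real^'v) set"
  obtain e1 where e1: "e1 > 0" "\<And>t. (\<And>v. norm (t $ v) < e1) \<Longrightarrow>
    ((\<lambda>l. complex_of_real (p l) * tpow t l) has_sum f t) ?N"
    using p unfolding taylor_at_origin_def by blast
  obtain e2 where e2: "e2 > 0" "\<And>t. (\<And>v. norm (t $ v) < e2) \<Longrightarrow>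
    ((\<lambda>l. complex_of_real (q l) * tpow t l) has_sum f t) ?N"
    using q unfolding taylor_at_origin_def by blast
  define h :: "('v \<Rightarrow> nat) \<Rightarrow> real^'v" where "h m = (\<chi> v. real (m v))" for m
  have h: "bij_betw h UNIV ?N"
  proof (rule bij_betwI[where g = "\<lambda>l v. nat \<lfloor>l $ v\<rfloor>"])
    show "h \<in> UNIV \<rightarrow> ?N" by (auto simp: h_def std_lattice_def less_eq_vec_def)
    show "h (\<lambda>v. nat \<lfloor>l $ v\<rfloor>) = l" if "l \<in> ?N" for l
    proof -
      have "real (nat \<lfloor>l $ v\<rfloor>) = l $ v" for v
      proof -
        have "l $ v \<in> \<int>" "0 \<le> l $ v" using that by (auto simp: std_lattice_def less_eq_vec_def)
        then show ?thesis by (auto elim!: Ints_cases)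
      qed
      then show ?thesis by (simp add: h_def vec_eq_iff)
    qed
  qed (auto simp: h_def)
  have "complex_of_real (p (h m)) - complex_of_real (q (h m)) = 0" for m
  proof (rule multivariate_power_series_zero_coeffs[of UNIV "min e1 e2" "\<lambda>m. complex_of_real (p (h m)) - complex_of_real (q (h m))"])
    fix t :: "'v \<Rightarrow> complex" assume t: "\<And>v. norm (t v) < min e1 e2"
    define t' where "t' = (\<chi> v. t v)"
    have tp: "tpow t' (h m) = (\<Prod>v\<in>UNIV. t v ^ m v)" for m
      by (simp add: tpow_def t'_def h_def)
    have q': "((\<lambda>l. - (complex_of_real (q l) * tpow t' l)) has_sum - f t') ?N"
      using e2(2)[of t'] t by (subst has_sum_uminus[symmetric]) (simp add: t'_def)
    have "((\<lambda>l. complex_of_real (p l) * tpow t' l - complex_of_real (q l) * tpow t' l)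
      has_sum f t' - f t') ?N"
      using has_sum_add[OF e1(2)[of t'] q'] t
      by (simp add: t'_def)
    then have "((\<lambda>m. complex_of_real (p (h m)) * tpow t' (h m) - complex_of_real (q (h m)) * tpow t' (h m))
      has_sum 0) UNIV"
      using has_sum_reindex_bij_betw[OF h, of "\<lambda>l. complex_of_real (p l) * tpow t' l -
        complex_of_real (q l) * tpow t' l" 0] by simp
    then show "((\<lambda>m. (complex_of_real (p (h m)) - complex_of_real (q (h m))) *
      (\<Prod>v\<in>UNIV. t v ^ m v)) has_sum 0) (UNIV \<rightarrow>\<^sub>E UNIV)"
      unfolding tp by (simp add: left_diff_distrib)
  qed (use e1 e2 in auto)
  then have eq: "p (h m) = q (h m)" for m by (simp flip: of_real_diff)
  show "p l = q l"
  proof (cases "l \<in> ?N")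
    case True
    then obtain m where "l = h m" using h unfolding bij_betw_def by blast
    then show ?thesis using eq by simp
  next
    case False
    then show ?thesis using p q unfolding taylor_at_origin_def by simp
  qed
qed

context unimodular_plumbing_tree
begin

definition lcoord :: "real^'v \<Rightarrow> 'v \<Rightarrow> int" where
  "lcoord l w = \<lfloor>dual_coord l w\<rfloor>"

lemma lcoord: "l \<in> std_lattice \<Longrightarrow> of_int (lcoord l w) = dual_coord l w"
  using std_lattice_dual_coord[of l w] unfolding lcoord_def by (auto elim!: Ints_cases)

lemma lcoord_eqI: "l \<in> std_lattice \<Longrightarrow> dual_coord l w = of_int i \<Longrightarrow> lcoord l w = i"
  by (simp add: lcoord_def)

text \<open>The coefficients of the product over all \<open>w\<close> of \<open>F w\<close> evaluated at the monomial \<open>t^E\<^sub>w\<^sup>*\<close>; in the unimodular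
  case an exponent determines the powers of the single factors.\<close>

definition lattice_series :: "('v \<Rightarrow> real fps) \<Rightarrow> real^'v \<Rightarrow> real" where
  "lattice_series F l = (if l \<in> std_lattice then \<Prod>w\<in>UNIV. fps_at (F w) (lcoord l w) else 0)"

definition lattice_cone :: "(real^'v) set" where
  "lattice_cone = {l \<in> std_lattice. \<forall>w. 0 \<le> dual_coord l w}"

lemma lattice_series_nonzero: "lattice_series F l \<noteq> 0 \<Longrightarrow> l \<in> lattice_cone"
proof -
  assume nz: "lattice_series F l \<noteq> 0"
  then have std: "l \<in> std_lattice" by (auto simp: lattice_series_def split: if_splits)
  have "0 \<le> lcoord l w" for w
  proof (rule ccontr)
    assume "\<not> 0 \<le> lcoord l w"
    then have "fps_at (F w) (lcoord l w) = 0" by simp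
    then have "(\<Prod>w\<in>UNIV. fps_at (F w) (lcoord l w)) = 0" by (meson UNIV_I finite prod_zero)
    then show False using nz std by (simp add: lattice_series_def)
  qed
  then show ?thesis
    unfolding lattice_cone_def using std by (simp flip: lcoord)
qed

lemma lattice_cone_nonneg: "l \<in> lattice_cone \<Longrightarrow> 0 \<le> l"
  using nonneg_if_dual_coord_nonneg unfolding lattice_cone_def less_eq_vec_def by auto

definition lattice_point :: "('v \<Rightarrow> nat) \<Rightarrow> real^'v" where
  "lattice_point m = (\<Sum>w\<in>UNIV. real (m w) *\<^sub>R E_star G w)"

lemma dual_coord_lattice_point [simp]: "dual_coord (lattice_point m) w = real (m w)"
  unfolding lattice_point_def by (simp add: if_distrib[of "\<lambda>t. _ * t"] cong: if_cong)

lemma lattice_point_std: "lattice_point m \<in> std_lattice"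
  unfolding lattice_point_def by (intro std_lattice_sum std_lattice_nat_scale E_star_std)

lemma lcoord_lattice_point [simp]: "lcoord (lattice_point m) w = int (m w)"
  unfolding lcoord_def by simp

lemma lattice_point_surj: "l \<in> lattice_cone \<Longrightarrow> lattice_point (\<lambda>w. nat (lcoord l w)) = l"
proof (rule dual_coord_inject)
  fix w assume l: "l \<in> lattice_cone"
  then have "of_int (lcoord l w) = dual_coord l w" "0 \<le> dual_coord l w"
    using lcoord unfolding lattice_cone_def by auto
  then show "dual_coord (lattice_point (\<lambda>w. nat (lcoord l w))) w = dual_coord l w"
    by (simp add: of_nat_nat)
qed

lemma bij_lattice_point: "bij_betw lattice_point UNIV lattice_cone"
proof (rule bij_betwI[where g = "\<lambda>l w. nat (lcoord l w)"])
  show "lattice_point \<in> UNIV \<rightarrow> lattice_cone"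
    using lattice_point_std by (auto simp: lattice_cone_def)
qed (auto simp: lattice_point_surj)

text \<open>\<open>l\<close> is the sum of the \<open>a\<^sub>w(l) E\<^sub>w\<^sup>*\<close>, in which no term is negative and all coordinates of \<open>E\<^sub>w\<^sup>*\<close> are at least
  1.\<close>

lemma dual_coord_le_coord:
  assumes "\<And>w. 0 \<le> dual_coord l w"
  shows "dual_coord l w \<le> l $ v"
proof -
  have "dual_coord l w \<le> dual_coord l w * E_star G w $ v"
    using assms[of w] E_star_ge_1[of w v] by (simp add: mult_le_cancel_left1)
  also have "\<dots> \<le> (\<Sum>w\<in>UNIV. dual_coord l w * E_star G w $ v)"
    by (rule member_le_sum) (use assms E_star_pos in \<open>auto intro!: mult_nonneg_nonneg intro: less_imp_le\<close>)
  also have "\<dots> = l $ v"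
    by (subst (2) E_star_expansion[of l]) simp
  finally show ?thesis .
qed

lemma finite_not_above: "finite {l \<in> lattice_cone. \<not> l0 \<le> l}"
proof (rule finite_subset)
  define B where "B = nat \<lceil>\<Sum>v\<in>UNIV. \<bar>l0 $ v\<bar>\<rceil>"
  show "{l \<in> lattice_cone. \<not> l0 \<le> l} \<subseteq> lattice_point ` (UNIV \<rightarrow>\<^sub>E {..B})"
  proof
    fix l assume l: "l \<in> {l \<in> lattice_cone. \<not> l0 \<le> l}"
    then obtain v where v: "l $ v < l0 $ v" by (auto simp: less_eq_vec_def not_le)
    have c: "0 \<le> dual_coord l w" for w using l by (auto simp: lattice_cone_def)
    have "nat (lcoord l w) \<le> B" for w
    proof -
      have "dual_coord l w \<le> l $ v" by (rule dual_coord_le_coord[OF c])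
      also have "\<dots> \<le> \<bar>l0 $ v\<bar>" using v by simp
      also have "\<dots> \<le> (\<Sum>v\<in>UNIV. \<bar>l0 $ v\<bar>)" by (rule member_le_sum) auto
      finally show ?thesis unfolding B_def lcoord_def by linarith
    qed
    then show "l \<in> lattice_point ` (UNIV \<rightarrow>\<^sub>E {..B})"
      using lattice_point_surj[of l] l by (intro image_eqI[where x = "\<lambda>w. nat (lcoord l w)"]) auto
  qed
qed (auto intro!: finite_imageI finite_PiE)

lemma counting_fun_lattice_series:
  "counting_fun (lattice_series F) l = (\<Sum>l'' | l'' \<in> lattice_cone \<and> \<not> l \<le> l''. lattice_series F l'')"
  unfolding counting_fun_def
proof (rule sum.mono_neutral_left)
  show "finite {l'' \<in> lattice_cone. \<not> l \<le> l''}" by (rule finite_not_above)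
qed (use lattice_series_nonzero in \<open>auto simp: lattice_cone_def\<close>)

lemma tpow_lattice_point:
  "tpow t (lattice_point m) = (\<Prod>w\<in>UNIV. tpow t (E_star G w) ^ m w)"
proof -
  have E: "E_star G w \<in> lattice_cone" for w using E_star_std by (simp add: lattice_cone_def)
  have cone_add: "x + y \<in> lattice_cone" if "x \<in> lattice_cone" "y \<in> lattice_cone" for x y
    using that std_lattice_add by (auto simp: lattice_cone_def)
  have zero: "0 \<in> lattice_cone" by (simp add: lattice_cone_def std_lattice_zero)
  have add: "tpow t (x + y) = tpow t x * tpow t y" if "x \<in> lattice_cone" "y \<in> lattice_cone" for x y
    using that lattice_cone_nonneg by (intro tpow_add) (auto simp: lattice_cone_def)
  have pw: "real n *\<^sub>R E_star G w \<in> lattice_cone \<and> tpow t (real n *\<^sub>R E_star G w) = tpow t (E_star G w) ^ n" for n w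
    by (induction n) (auto simp: zero scaleR_left_distrib cone_add add E)
  have "(\<Sum>w\<in>A. real (m w) *\<^sub>R E_star G w) \<in> lattice_cone \<and>
    tpow t (\<Sum>w\<in>A. real (m w) *\<^sub>R E_star G w) = (\<Prod>w\<in>A. tpow t (E_star G w) ^ m w)" if "finite A" for A
    using that by (induction A rule: finite_induct) (auto simp: zero cone_add add pw)
  then show ?thesis unfolding lattice_point_def by simp
qed

lemma norm_tpow_E_star:
  assumes "\<And>v. norm (t $ v) < 1"
  shows "norm (tpow t (E_star G w)) < 1"
proof -
  obtain v :: 'v where True by blast
  have le: "norm ((t $ v) powi \<lfloor>E_star G w $ v\<rfloor>) < 1" for v
  proof -
    have "0 < \<lfloor>E_star G w $ v\<rfloor>" using E_star_ge_1[of w v] by linarith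
    then obtain n where n: "\<lfloor>E_star G w $ v\<rfloor> = int (Suc n)"
      by (metis gr0_implies_Suc zero_less_imp_eq_int)
    have "norm (t $ v) ^ n \<le> 1" using assms[of v] by (intro power_le_one) auto
    then have "norm (t $ v) * norm (t $ v) ^ n \<le> norm (t $ v) * 1"
      by (intro mult_left_mono) auto
    then have "norm ((t $ v) ^ Suc n) < 1" using assms[of v] by (simp add: norm_mult norm_power)
    then show ?thesis unfolding n power_int_of_nat .
  qed
  have "norm (tpow t (E_star G w)) = norm ((t $ v) powi \<lfloor>E_star G w $ v\<rfloor>) *
      (\<Prod>u\<in>UNIV - {v}. norm ((t $ u) powi \<lfloor>E_star G w $ u\<rfloor>))"
    unfolding tpow_def prod_norm[symmetric] by (subst prod.remove[of UNIV v]) auto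
  also have "\<dots> \<le> norm ((t $ v) powi \<lfloor>E_star G w $ v\<rfloor>) * 1"
    by (intro mult_left_mono prod_le_1) (use le less_imp_le in auto)
  finally show ?thesis using le[of v] by simp
qed

text \<open>For \<open>|t\<^sub>v| < 1\<close> each monomial \<open>t^E\<^sub>w\<^sup>*\<close> has modulus below 1, so the vertex series converge
  absolutely and may be multiplied; the resulting multi-index runs through the lattice points of the
  cone spanned by the \<open>E\<^sub>w\<^sup>*\<close>.\<close>

lemma taylor_lattice_series:
  "taylor_at_origin (Z_fun G) (lattice_series (\<lambda>w. vertex_series (valency G w)))"
proof -
  let ?F = "\<lambda>w. vertex_series (valency G w)"
  have zero: "lattice_series ?F l = 0" if "l \<notin> lattice_cone" for l
    using that lattice_series_nonzero by blast
  have "((\<lambda>l. complex_of_real (lattice_series ?F l) * tpow t l) has_sum Z_fun G t)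
    {l \<in> std_lattice. 0 \<le> l}" if t: "\<And>v. norm (t $ v) < 1" for t
  proof -
    let ?g = "\<lambda>w j. complex_of_real (fps_nth (?F w) j) * tpow t (E_star G w) ^ j"
    have "((\<lambda>m. \<Prod>w\<in>UNIV. ?g w (m w)) has_sum
      (\<Prod>w\<in>UNIV. (1 - tpow t (E_star G w)) powi (int (valency G w) - 2))) (PiE UNIV (\<lambda>_. UNIV))"
      by (intro has_sum_prod_PiE vertex_series_sum norm_tpow_E_star t valency_pos) auto
    then have "((\<lambda>m. \<Prod>w\<in>UNIV. ?g w (m w)) has_sum Z_fun G t) UNIV"
      by (simp add: Z_fun_def)
    moreover have "(\<Prod>w\<in>UNIV. ?g w (m w)) =
      complex_of_real (lattice_series ?F (lattice_point m)) * tpow t (lattice_point m)" for m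
      by (simp add: lattice_series_def lattice_point_std tpow_lattice_point prod.distrib)
    ultimately have "((\<lambda>m. complex_of_real (lattice_series ?F (lattice_point m)) *
      tpow t (lattice_point m)) has_sum Z_fun G t) UNIV" by simp
    then have "((\<lambda>l. complex_of_real (lattice_series ?F l) * tpow t l) has_sum Z_fun G t) lattice_cone"
      by (subst (asm) has_sum_reindex_bij_betw[OF bij_lattice_point])
    then show ?thesis
      by (subst has_sum_cong_neutral[where T = lattice_cone and
            g = "\<lambda>l. complex_of_real (lattice_series ?F l) * tpow t l"])
        (use zero lattice_cone_nonneg in \<open>auto simp: lattice_cone_def\<close>)
  qed
  moreover have "lattice_series ?F l = 0" if "l \<notin> {l \<in> std_lattice. 0 \<le> l}" for l
    using that zero[of l] lattice_cone_nonneg[of l] by (auto simp: lattice_cone_def)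
  ultimately show ?thesis
    unfolding taylor_at_origin_def by (intro conjI allI impI exI[of _ 1]) auto
qed

lemma Z_coeff_eq: "Z_coeff G = lattice_series (\<lambda>w. vertex_series (valency G w))"
  unfolding Z_coeff_def
  by (rule the_equality[where P = "taylor_at_origin (Z_fun G)", OF taylor_lattice_series])
    (rule taylor_at_origin_unique[OF _ taylor_lattice_series])

end

section \<open>Summation over a rooted tree\<close>

abbreviation geom :: "real fps" where
  "geom \<equiv> inverse (1 - fps_X)"

lemma vertex_series_Suc: "vertex_series (Suc k) = geom * (1 - fps_X) ^ k"
proof (cases k)
  case (Suc j)
  have "geom * (1 - fps_X) = 1" by (rule inverse_mult_eq_1) simp
  then show ?thesis using Suc by (simp add: vertex_series_def mult.assoc[symmetric])
qed (simp add: vertex_series_def)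

text \<open>In the relevant range, a series with coefficients 1 from \<open>\<theta>\<close> on becomes a polynomial of degree at most
  \<open>\<theta>\<close> with value 1 at 1 after multiplication by \<open>1 - X\<close>. In the product with \<open>h\<close> only coefficients of
  \<open>h\<close> that equal 1 are then summed.\<close>

lemma fps_eventually_one_mult:
  fixes U h :: "real fps"
  assumes U: "\<And>j. \<theta> \<le> j \<Longrightarrow> j \<le> A \<Longrightarrow> fps_nth U j = 1"
    and h: "\<And>j. \<theta>' \<le> j \<Longrightarrow> j \<le> A \<Longrightarrow> fps_nth h j = 1"
    and n: "\<theta> + \<theta>' \<le> n" "n \<le> A"
  shows "fps_nth (U * (1 - fps_X) * h) n = 1"
proof -
  define V where "V = U * (1 - fps_X)"
  have V: "fps_nth V j = fps_nth U j - (if j = 0 then 0 else fps_nth U (j - 1))" for j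
    unfolding V_def by (simp add: right_diff_distrib)
  \<comment> \<open>The coefficients of \<open>V\<close> are the differences of those of \<open>U\<close>.\<close>
  have tele: "(\<Sum>j=0..k. fps_nth V j) = fps_nth U k" for k
    by (induction k) (simp_all add: V)
  have V0: "fps_nth V j = 0" if "\<theta> < j" "j \<le> A" for j
    using that U[of j] U[of "j - 1"] by (simp add: V)
  have "fps_nth (V * h) n = (\<Sum>j=0..n. fps_nth V j * fps_nth h (n - j))"
    by (rule fps_mult_nth)
  also have "\<dots> = (\<Sum>j=0..\<theta>. fps_nth V j * fps_nth h (n - j))"
    by (rule sum.mono_neutral_right) (use V0 n in auto)
  also have "\<dots> = (\<Sum>j=0..\<theta>. fps_nth V j)"
    by (rule sum.cong) (use h n in auto)
  also have "\<dots> = 1" using tele U n by simp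
  finally show ?thesis unfolding V_def .
qed

lemma fps_eventually_one_prod:
  fixes H :: "'i \<Rightarrow> real fps"
  assumes "finite I" and "\<And>i j. i \<in> I \<Longrightarrow> \<theta> i \<le> j \<Longrightarrow> j \<le> A \<Longrightarrow> fps_nth (H i) j = 1"
    and "(\<Sum>i\<in>I. \<theta> i) \<le> n" "n \<le> A"
  shows "fps_nth (geom * (1 - fps_X) ^ card I * (\<Prod>i\<in>I. H i)) n = 1"
  using assms
proof (induction I arbitrary: n rule: finite_induct)
  case (insert i I)
  have "fps_nth ((geom * (1 - fps_X) ^ card I * (\<Prod>i\<in>I. H i)) * (1 - fps_X) * H i) n = 1"
    by (rule fps_eventually_one_mult[where \<theta> = "\<Sum>i\<in>I. \<theta> i" and A = A and \<theta>' = "\<theta> i"])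
      (use insert in auto)
  then show ?case using insert by (simp add: mult_ac)
qed simp

lemma sum_PiE_Un:
  fixes f :: "('b \<Rightarrow> 'c) \<Rightarrow> 'd::comm_monoid_add"
  assumes "A \<inter> B = {}"
  shows "(\<Sum>y\<in>PiE (A \<union> B) D. f y) =
    (\<Sum>y1\<in>PiE A D. \<Sum>y2\<in>PiE B D. f (\<lambda>w. if w \<in> A then y1 w else y2 w))"
proof -
  let ?g = "\<lambda>y1 y2 w. if w \<in> A then y1 w else y2 w :: 'c"
  have "(\<Sum>y\<in>PiE (A \<union> B) D. f y) = (\<Sum>(y1, y2)\<in>PiE A D \<times> PiE B D. f (?g y1 y2))"
  proof (rule sum.reindex_bij_witness[where i = "\<lambda>(y1, y2). ?g y1 y2"
        and j = "\<lambda>y. (restrict y A, restrict y B)"])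
    fix y assume y: "y \<in> PiE (A \<union> B) D"
    show eq: "(case (restrict y A, restrict y B) of (y1, y2) \<Rightarrow> ?g y1 y2) = y"
    proof
      fix w show "(case (restrict y A, restrict y B) of (y1, y2) \<Rightarrow> ?g y1 y2) w = y w"
        using PiE_arb[OF y, of w] by (cases "w \<in> A"; cases "w \<in> B") auto
    qed
    show "(restrict y A, restrict y B) \<in> PiE A D \<times> PiE B D" using y by auto
    show "(case (restrict y A, restrict y B) of (y1, y2) \<Rightarrow> f (?g y1 y2)) = f y"
      using arg_cong[OF eq, of f] by simp
  next
    fix p assume p: "p \<in> PiE A D \<times> PiE B D"
    obtain y1 y2 where p_eq: "p = (y1, y2)" by (cases p)
    then have y: "y1 \<in> PiE A D" "y2 \<in> PiE B D" using p by auto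
    have out: "w \<notin> A" if "w \<in> B" for w using assms that by blast
    have "restrict (?g y1 y2) A w = y1 w" for w using PiE_arb[OF y(1), of w] by (cases "w \<in> A") auto
    moreover have "restrict (?g y1 y2) B w = y2 w" for w
      using PiE_arb[OF y(2), of w] out[of w] by (cases "w \<in> B") auto
    ultimately show "(restrict (case p of (y1, y2) \<Rightarrow> ?g y1 y2) A,
        restrict (case p of (y1, y2) \<Rightarrow> ?g y1 y2) B) = p"
      unfolding p_eq by (auto simp: fun_eq_iff)
    show "(case p of (y1, y2) \<Rightarrow> ?g y1 y2) \<in> PiE (A \<union> B) D"
      unfolding p_eq prod.case
    proof (rule PiE_I)
      fix w assume "w \<in> A \<union> B"
      then show "?g y1 y2 w \<in> D w" using PiE_mem[OF y(1), of w] PiE_mem[OF y(2), of w] by auto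
    next
      fix w assume "w \<notin> A \<union> B"
      then show "?g y1 y2 w = undefined" using PiE_arb[OF y(2), of w] by auto
    qed
  qed
  then show ?thesis by (simp add: sum.cartesian_product)
qed

text \<open>Weights that factor over disjoint blocks \<open>B i\<close>, and are coupled only through the values at
  the base points \<open>i\<close>, are summed by multiplying the generating functions of the blocks.\<close>

lemma sum_PiE_blocks:
  fixes g :: "'b \<Rightarrow> ('b \<Rightarrow> nat) \<Rightarrow> real" and B :: "'b \<Rightarrow> 'b set"
  assumes "finite I" "\<And>w. finite (D w)"
    and "\<And>i. i \<in> I \<Longrightarrow> finite (B i)" "\<And>i. i \<in> I \<Longrightarrow> i \<in> B i"
    and "\<And>i j. i \<in> I \<Longrightarrow> j \<in> I \<Longrightarrow> i \<noteq> j \<Longrightarrow> B i \<inter> B j = {}"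
    and "\<And>i y y'. i \<in> I \<Longrightarrow> (\<And>w. w \<in> B i \<Longrightarrow> y w = y' w) \<Longrightarrow> g i y = g i y'"
  shows "(\<Sum>y\<in>PiE (\<Union>i\<in>I. B i) D. fps_at F (A - (\<Sum>i\<in>I. int (y i))) * (\<Prod>i\<in>I. g i y)) =
    fps_at (F * (\<Prod>i\<in>I. Abs_fps (\<lambda>j. \<Sum>y | y \<in> PiE (B i) D \<and> y i = j. g i y))) A"
  using assms(1,3-)
proof (induction I arbitrary: A rule: finite_induct)
  case (insert i I)
  let ?R = "\<Union>i\<in>I. B i"
  define K where "K = F * (\<Prod>i\<in>I. Abs_fps (\<lambda>j. \<Sum>y | y \<in> PiE (B i) D \<and> y i = j. g i y))"
  define h where "h j = (\<Sum>y | y \<in> PiE (B i) D \<and> y i = j. g i y)" for j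
  let ?S = "PiE (B i) D"
  have IH: "(\<Sum>y\<in>PiE ?R D. fps_at F (A - (\<Sum>i\<in>I. int (y i))) * (\<Prod>i\<in>I. g i y)) = fps_at K A" for A
    unfolding K_def
  proof (rule insert.IH)
    show "\<And>i. i \<in> I \<Longrightarrow> finite (B i)" "\<And>i. i \<in> I \<Longrightarrow> i \<in> B i"
      using insert.prems(1,2) by simp_all
    show "\<And>i j. i \<in> I \<Longrightarrow> j \<in> I \<Longrightarrow> i \<noteq> j \<Longrightarrow> B i \<inter> B j = {}"
      using insert.prems(3) by (meson insertI2)
    show "\<And>i y y'. i \<in> I \<Longrightarrow> (\<And>w. w \<in> B i \<Longrightarrow> y w = y' w) \<Longrightarrow> g i y = g i y'"
      by (rule insert.prems(4)) auto
  qed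
  have "B i \<inter> B k = {}" if "k \<in> I" for k
    by (rule insert.prems(3)) (use that insert(2) in auto)
  then have disj: "B i \<inter> ?R = {}" by blast
  have finS: "finite ?S" by (rule finite_PiE) (use insert.prems(1) assms(2) in auto)
  have split: "fps_at F (A - (\<Sum>k\<in>insert i I. int (y k))) * (\<Prod>k\<in>insert i I. g k y) =
     g i y1 * (fps_at F (A - int (y1 i) - (\<Sum>k\<in>I. int (y2 k))) * (\<Prod>k\<in>I. g k y2))"
    if y: "y = (\<lambda>w. if w \<in> B i then y1 w else y2 w)" for y y1 y2
  proof -
    have "y i = y1 i" using insert.prems(2)[of i] y by simp
    moreover have out: "w \<notin> B i" if "k \<in> I" "w \<in> B k" for k w using disj that by blast
    have "(\<Sum>k\<in>I. int (y k)) = (\<Sum>k\<in>I. int (y2 k))"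
      by (rule sum.cong) (use insert.prems(2) out y in auto)
    moreover have "g i y = g i y1" by (rule insert.prems(4)) (use y in auto)
    moreover have "(\<Prod>k\<in>I. g k y) = (\<Prod>k\<in>I. g k y2)"
      by (intro prod.cong refl insert.prems(4)) (use out y in auto)
    ultimately show ?thesis using insert(1,2) by (simp add: algebra_simps)
  qed
  have "(\<Sum>y\<in>PiE (\<Union>i\<in>insert i I. B i) D.
      fps_at F (A - (\<Sum>k\<in>insert i I. int (y k))) * (\<Prod>k\<in>insert i I. g k y)) =
    (\<Sum>y1\<in>?S. \<Sum>y2\<in>PiE ?R D.
      g i y1 * (fps_at F (A - int (y1 i) - (\<Sum>k\<in>I. int (y2 k))) * (\<Prod>k\<in>I. g k y2)))"
    unfolding UN_insert sum_PiE_Un[OF disj] by (intro sum.cong refl split)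
  also have "\<dots> = (\<Sum>y1\<in>?S. g i y1 * fps_at K (A - int (y1 i)))"
    unfolding sum_distrib_left[symmetric] IH ..
  also have "\<dots> = fps_at (K * Abs_fps h) A"
  proof (cases "A < 0")
    case False
    then obtain n where n: "A = int n" by (metis nonneg_int_cases not_less)
    define T where "T = {..n} \<union> (\<lambda>y. y i) ` ?S"
    have "(\<Sum>y1\<in>?S. g i y1 * fps_at K (A - int (y1 i))) =
      (\<Sum>j\<in>T. \<Sum>y1 | y1 \<in> ?S \<and> y1 i = j. g i y1 * fps_at K (A - int (y1 i)))"
      by (rule sum.group[symmetric]) (use finS in \<open>auto simp: T_def\<close>)
    also have "\<dots> = (\<Sum>j\<in>T. h j * fps_at K (A - int j))"
      unfolding h_def sum_distrib_right by (intro sum.cong refl) auto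
    also have "\<dots> = (\<Sum>j=0..n. h j * fps_at K (A - int j))"
      by (rule sum.mono_neutral_right) (use finS n in \<open>auto simp: T_def\<close>)
    also have "\<dots> = (\<Sum>j=0..n. h j * fps_nth K (n - j))"
      by (rule sum.cong) (auto simp: n of_nat_diff[symmetric] simp del: of_nat_diff)
    also have "\<dots> = fps_nth (Abs_fps h * K) n" by (simp add: fps_mult_nth)
    finally show ?thesis by (simp add: n mult.commute)
  qed simp
  also have "K * Abs_fps h = F * (\<Prod>i\<in>insert i I. Abs_fps (\<lambda>j. \<Sum>y | y \<in> PiE (B i) D \<and> y i = j. g i y))"
    using insert(1,2) by (simp add: K_def h_def[abs_def] mult_ac)
  finally show ?case .
qed simp

context rooted_plumbing_tree
begin

definition descendants :: "'v \<Rightarrow> 'v set" where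
  "descendants u = {w. (\<lambda>p c. c \<in> children p)\<^sup>*\<^sup>* u w}"

lemma self_descendant: "u \<in> descendants u"
  by (simp add: descendants_def)

lemma descendants_step: "w \<in> descendants u \<Longrightarrow> c \<in> children w \<Longrightarrow> c \<in> descendants u"
  unfolding descendants_def by (auto intro: rtranclp.rtrancl_into_rtrancl)

lemma descendants_idx: "w \<in> descendants u \<Longrightarrow> idx u \<le> idx w"
  unfolding descendants_def mem_Collect_eq
  by (induction rule: rtranclp_induct) (auto simp: children_def)

lemma descendants_parent: "w \<in> descendants u \<Longrightarrow> w \<noteq> u \<Longrightarrow> w \<noteq> r \<and> parent w \<in> descendants u"
  unfolding descendants_def mem_Collect_eq
  by (erule rtranclp.cases) (auto simp: children_iff)

lemma descendants_eq: "descendants u = insert u (\<Union>c\<in>children u. descendants c)"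
  unfolding descendants_def
  by (auto elim: converse_rtranclpE intro: converse_rtranclp_into_rtranclp)

lemma child_idx: "c \<in> children u \<Longrightarrow> idx u < idx c"
  by (simp add: children_def)

lemma notin_descendants_child: "c \<in> children u \<Longrightarrow> u \<notin> descendants c"
  using descendants_idx[of u c] child_idx[of c u] by auto

lemma descendants_comparable:
  assumes "(\<lambda>p c. c \<in> children p)\<^sup>*\<^sup>* c w" "w \<in> descendants c'"
  shows "c \<in> descendants c' \<or> c' \<in> descendants c"
  using assms
proof (induction rule: rtranclp_induct)
  case (step p w)
  show ?case
  proof (cases "w = c'")
    case True
    then show ?thesis using step(1,2) unfolding descendants_def by (auto intro: rtranclp.rtrancl_into_rtrancl)
  next
    case False
    then have "parent w \<in> descendants c'" using descendants_parent step(4) by blast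
    then show ?thesis using step by (simp add: children_iff)
  qed
qed simp

lemma descendants_disjoint:
  assumes "c \<in> children u" "c' \<in> children u" "c \<noteq> c'"
  shows "descendants c \<inter> descendants c' = {}"
proof -
  have no: "d \<notin> descendants d'" if "d \<in> children u" "d' \<in> children u" "d \<noteq> d'" for d d'
  proof
    assume "d \<in> descendants d'"
    then have "parent d \<in> descendants d'" using descendants_parent that by blast
    moreover have "parent d = u" using that by (simp add: children_iff)
    ultimately show False using notin_descendants_child that by blast
  qed
  have "c \<in> descendants c' \<or> c' \<in> descendants c" if "w \<in> descendants c" "w \<in> descendants c'" for w
    using descendants_comparable[of c w c'] that unfolding descendants_def by blast
  then show ?thesis using no assms by blast
qed

lemma descendants_root: "descendants r = UNIV"
proof -
  have "w \<in> descendants r" for w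
  proof (induction "idx w" arbitrary: w rule: less_induct)
    case less
    show ?case
    proof (cases "w = r")
      case False
      then have "w \<in> children (parent w)" by (simp add: children_iff)
      then show ?thesis using descendants_step less parent(2)[OF False] by blast
    qed (simp add: self_descendant)
  qed
  then show ?thesis by blast
qed

end

text \<open>The data of a slice sum with root \<open>r\<close>: \<open>a\<close> are the dual coordinates of \<open>l\<close>, the summation variable
  \<open>y\<close> is the difference \<open>l'' - l\<close>, and \<open>z\<close> will be \<open>E\<^sub>r\<^sup>*\<close>, which is positive and satisfies
  \<open>(z, E\<^sub>w) = 0\<close> away from the root. The bounds \<open>M\<close> cut off the values of \<open>y\<close>; they grow along the branches so
  fast that no non-zero term is lost, and they keep all sums finite.\<close>

locale tree_transfer = rooted_plumbing_tree G r idx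
  for G :: "('v::finite) plumbing_graph" and r idx +
  fixes a :: "'v \<Rightarrow> int" and z :: "'v \<Rightarrow> real" and M :: "'v \<Rightarrow> nat"
  assumes z_pos: "0 < z w"
    and z_super: "w \<noteq> r \<Longrightarrow> z (parent w) + (\<Sum>c\<in>children w. z c) \<le> beta w * z w"
    and a_large: "w \<noteq> r \<Longrightarrow> z (parent w) \<le> a w * z w"
    and a_root: "0 \<le> a r"
    and M_large: "c \<in> children w \<Longrightarrow> s \<le> M w \<Longrightarrow> a w + beta w * int s \<le> int (M c)"
begin

definition cube :: "'v \<Rightarrow> nat set" where
  "cube w = {..M w}"

text \<open>The factor of the vertex \<open>w\<close> in the coefficient of the zeta function at \<open>l + y\<close>, when the value of \<open>y\<close>
  at the parent of \<open>w\<close> is \<open>t\<close>.\<close>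

definition wt :: "'v \<Rightarrow> nat \<Rightarrow> ('v \<Rightarrow> nat) \<Rightarrow> real" where
  "wt w t y = fps_at (vertex_series (valency G w))
     (a w + beta w * int (y w) - int t - (\<Sum>c\<in>children w. int (y c)))"

definition branch_wt :: "'v \<Rightarrow> nat \<Rightarrow> ('v \<Rightarrow> nat) \<Rightarrow> real" where
  "branch_wt u t y = wt u t y * (\<Prod>w\<in>descendants u - {u}. wt w (y (parent w)) y)"

text \<open>The sum over all values in the branch with root \<open>u\<close>, given the value \<open>s\<close> at \<open>u\<close> and the value \<open>t\<close> at
  the parent of \<open>u\<close>.\<close>

definition branch_sum :: "'v \<Rightarrow> nat \<Rightarrow> nat \<Rightarrow> real" where
  "branch_sum u s t = (\<Sum>y | y \<in> PiE (descendants u) cube \<and> y u = s. branch_wt u t y)"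

lemma wt_cong: "y w = y' w \<Longrightarrow> (\<And>c. c \<in> children w \<Longrightarrow> y c = y' c) \<Longrightarrow> wt w t y = wt w t y'"
  unfolding wt_def by (simp cong: sum.cong)

lemma branch_wt_cong:
  assumes "\<And>w. w \<in> descendants u \<Longrightarrow> y w = y' w"
  shows "branch_wt u t y = branch_wt u t y'"
proof -
  have "wt u t y = wt u t y'"
    by (rule wt_cong) (use assms self_descendant descendants_step in blast)+
  moreover have "(\<Prod>w\<in>descendants u - {u}. wt w (y (parent w)) y) =
    (\<Prod>w\<in>descendants u - {u}. wt w (y' (parent w)) y')"
  proof (rule prod.cong[OF refl])
    fix w assume w: "w \<in> descendants u - {u}"
    then have "y (parent w) = y' (parent w)" using assms descendants_parent by blast
    moreover have "wt w t y = wt w t y'" for t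
      by (rule wt_cong) (use assms w descendants_step in blast)+
    ultimately show "wt w (y (parent w)) y = wt w (y' (parent w)) y'" by simp
  qed
  ultimately show ?thesis unfolding branch_wt_def by simp
qed

lemma branch_wt_children:
  "branch_wt u t y = wt u t y * (\<Prod>c\<in>children u. branch_wt c (y u) y)"
proof -
  have "descendants u - {u} = (\<Union>c\<in>children u. descendants c)"
    using notin_descendants_child by (subst descendants_eq) blast
  then have "(\<Prod>w\<in>descendants u - {u}. wt w (y (parent w)) y) =
    (\<Prod>c\<in>children u. \<Prod>w\<in>descendants c. wt w (y (parent w)) y)"
    using descendants_disjoint by (simp add: prod.UNION_disjoint)
  also have "\<dots> = (\<Prod>c\<in>children u. branch_wt c (y u) y)"
  proof (rule prod.cong[OF refl])
    fix c assume "c \<in> children u"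
    then have "parent c = u" by (simp add: children_iff)
    then show "(\<Prod>w\<in>descendants c. wt w (y (parent w)) y) = branch_wt c (y u) y"
      unfolding branch_wt_def by (subst prod.remove[of _ c]) (auto simp: self_descendant)
  qed
  finally show ?thesis unfolding branch_wt_def by simp
qed

text \<open>The children interact only through the factor of \<open>u\<close>, which depends on the sum of their values. The
  sum over them is therefore a coefficient of a product of generating functions.\<close>

lemma branch_sum_recursion:
  assumes "s \<in> cube u"
  shows "branch_sum u s t =
    fps_at (vertex_series (valency G u) * (\<Prod>c\<in>children u. Abs_fps (\<lambda>j. branch_sum c j s)))
      (a u + beta u * int s - int t)"
proof -
  let ?R = "\<Union>c\<in>children u. descendants c"
  have u: "u \<notin> ?R" using notin_descendants_child by blast
  have in_R: "c \<in> ?R" if "c \<in> children u" for c using that self_descendant by blast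
  have wt_u: "branch_wt u t (y(u := s)) = fps_at (vertex_series (valency G u))
      (a u + beta u * int s - int t - (\<Sum>c\<in>children u. int (y c))) *
      (\<Prod>c\<in>children u. branch_wt c s y)" for y
  proof -
    have "(\<Sum>c\<in>children u. int ((y(u := s)) c)) = (\<Sum>c\<in>children u. int (y c))"
      by (rule sum.cong) (use u in_R in auto)
    moreover have "(\<Prod>c\<in>children u. branch_wt c s (y(u := s))) = (\<Prod>c\<in>children u. branch_wt c s y)"
      by (intro prod.cong branch_wt_cong refl) (use u in auto)
    ultimately show ?thesis unfolding branch_wt_children[of u] wt_def by simp
  qed
  have "branch_sum u s t = (\<Sum>y\<in>PiE ?R cube. branch_wt u t (y(u := s)))"
    unfolding branch_sum_def
  proof (rule sum.reindex_bij_witness[where i = "\<lambda>y. y(u := s)" and j = "\<lambda>y. restrict y ?R"])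
    fix y assume y: "y \<in> {y \<in> PiE (descendants u) cube. y u = s}"
    show "(restrict y ?R)(u := s) = y"
    proof
      fix w show "((restrict y ?R)(u := s)) w = y w"
        using y descendants_eq[of u] by (cases "w \<in> descendants u") (auto simp: PiE_def extensional_def)
    qed
    then show "branch_wt u t ((restrict y ?R)(u := s)) = branch_wt u t y" by simp
    show "restrict y ?R \<in> PiE ?R cube" using y descendants_eq[of u] by auto
  next
    fix y assume y: "y \<in> PiE ?R cube"
    show "restrict (y(u := s)) ?R = y"
    proof
      fix w show "restrict (y(u := s)) ?R w = y w"
        using y u by (cases "w \<in> ?R") (auto simp: PiE_def extensional_def)
    qed
    show "y(u := s) \<in> {y \<in> PiE (descendants u) cube. y u = s}"
      using y u assms descendants_eq[of u] by (auto simp: PiE_def extensional_def)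
  qed
  also have "\<dots> = (\<Sum>y\<in>PiE ?R cube. fps_at (vertex_series (valency G u))
      (a u + beta u * int s - int t - (\<Sum>c\<in>children u. int (y c))) *
      (\<Prod>c\<in>children u. branch_wt c s y))"
    unfolding wt_u ..
  also have "\<dots> = fps_at (vertex_series (valency G u) *
    (\<Prod>c\<in>children u. Abs_fps (\<lambda>j. branch_sum c j s))) (a u + beta u * int s - int t)"
    unfolding branch_sum_def
  proof (rule sum_PiE_blocks)
    fix i j assume "i \<in> children u" "j \<in> children u" "i \<noteq> j"
    then show "descendants i \<inter> descendants j = {}" by (rule descendants_disjoint)
  next
    fix i :: 'v and y y' :: "'v \<Rightarrow> nat"
    assume "\<And>w. w \<in> descendants i \<Longrightarrow> y w = y' w"
    then show "branch_wt i s y = branch_wt i s y'" by (rule branch_wt_cong)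
  qed (auto simp: self_descendant cube_def)
  finally show ?thesis .
qed

text \<open>The vertex series of \<open>u\<close> is \<open>(1 - X)^k/(1 - X)\<close> with \<open>k\<close> the number of children. If the generating function of
  each child had only coefficients 1, the product would be \<open>1/(1 - X)\<close>. In fact the
  coefficients of the child \<open>c\<close> are 1 from \<open>z c \<cdot> s / z u\<close> on, up to rounding, which \<open>a_large\<close>
  absorbs. So the product has coefficients 1 from the sum of these thresholds on, and the
  inequality for \<open>z\<close> at \<open>u\<close> says that the coefficient in question lies beyond that sum.\<close>

lemma branch_sum_eq_1:
  assumes "u \<noteq> r" "s \<in> cube u" "z u * (real t - a u) \<le> z (parent u) * real s"
  shows "branch_sum u s t = 1"
  using assms
proof (induction "card (descendants u)" arbitrary: u s t rule: less_induct)
  case less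
  define A where "A = a u + beta u * int s - int t"
  \<comment> \<open>Rounding down keeps the sum of the thresholds small; the loss of at most 1 is covered by \<open>a_large\<close>.\<close>
  define \<theta> where "\<theta> c = nat \<lfloor>z c * real s / z u\<rfloor>" for c
  have \<theta>_le: "real (\<theta> c) \<le> z c * real s / z u" for c
    unfolding \<theta>_def using z_pos[of c] z_pos[of u] by simp
  have "(\<Sum>c\<in>children u. real (\<theta> c)) \<le> (\<Sum>c\<in>children u. z c * real s / z u)"
    by (rule sum_mono) (rule \<theta>_le)
  also have "\<dots> = (\<Sum>c\<in>children u. z c) * real s / z u"
    by (simp add: sum_distrib_right sum_divide_distrib)
  also have "\<dots> \<le> (beta u * z u - z (parent u)) * real s / z u"
    using z_super[OF less(2)] z_pos[of u] by (intro divide_right_mono mult_right_mono) auto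
  also have "\<dots> = beta u * real s - z (parent u) * real s / z u"
    using z_pos[of u] by (simp add: field_simps)
  also have "\<dots> \<le> beta u * real s - (real t - a u)"
    using less(4) z_pos[of u] by (simp add: field_simps)
  finally have "real (\<Sum>c\<in>children u. \<theta> c) \<le> real_of_int A" unfolding A_def by simp
  then have le: "int (\<Sum>c\<in>children u. \<theta> c) \<le> A" by linarith
  then obtain n where n: "A = int n" by (metis nonneg_int_cases of_nat_0_le_iff order_trans)
  have le': "(\<Sum>c\<in>children u. \<theta> c) \<le> n" using le unfolding n by (simp only: of_nat_le_iff)
  have one: "branch_sum c j s = 1" if c: "c \<in> children u" and j: "\<theta> c \<le> j" "j \<le> n" for c j
  proof (rule less(1))
    have "descendants c \<subseteq> descendants u" using descendants_eq[of u] c by blast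
    moreover have "u \<in> descendants u" "u \<notin> descendants c"
      using self_descendant notin_descendants_child[OF c] by auto
    ultimately show "card (descendants c) < card (descendants u)" by (intro psubset_card_mono) auto
    show cr: "c \<noteq> r" using c children_iff by blast
    have pc: "parent c = u" using c children_iff by blast
    have "A \<le> int (M c)" using M_large[OF c, of s] less(3) unfolding A_def cube_def by auto
    then show "j \<in> cube c" using j n unfolding cube_def by simp
    have "z c * real s / z u - 1 \<le> real j"
      using j(1) unfolding \<theta>_def by linarith
    then have "z c * real s - z u \<le> z u * real j" using z_pos[of u] by (simp add: field_simps)
    then show "z c * (real s - real_of_int (a c)) \<le> z (parent c) * real j"
      using a_large[OF cr] unfolding pc by (simp add: algebra_simps)
  qed
  have "branch_sum u s t = fps_nth (geom * (1 - fps_X) ^ card (children u) *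
    (\<Prod>c\<in>children u. Abs_fps (\<lambda>j. branch_sum c j s))) n"
    using n unfolding branch_sum_recursion[OF less(3)] valency_nonroot[OF less(2)] vertex_series_Suc A_def
    by simp
  also have "\<dots> = 1"
    by (rule fps_eventually_one_prod[where \<theta> = \<theta> and A = n]) (use one le' in auto)
  finally show ?case .
qed

text \<open>At the root the vertex series has one factor \<open>1 - X\<close> less than there are children, so \<open>1/(1 - X)\<^sup>2\<close> takes the
  place of \<open>1/(1 - X)\<close>.\<close>

lemma root_sum: "branch_sum r 0 0 = of_int (a r) + 1"
proof -
  obtain n where n: "a r = int n" using a_root by (metis nonneg_int_cases)
  obtain k where k: "card (children r) = Suc k"
    using valency_pos[of r] unfolding valency_root by (cases "card (children r)") auto
  let ?H = "\<Prod>c\<in>children r. Abs_fps (\<lambda>j. branch_sum c j 0)"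
  define U where "U = geom * (1 - fps_X) ^ card (children r) * ?H"
  have U: "fps_nth U j = 1" if "j \<le> n" for j
    unfolding U_def
  proof (rule fps_eventually_one_prod[where \<theta> = "\<lambda>_. 0" and A = n])
    fix c i assume c: "c \<in> children r" and i: "i \<le> n"
    then have cr: "c \<noteq> r" "parent c = r" by (auto simp: children_iff)
    have "i \<in> cube c" using M_large[OF c, of 0] i n unfolding cube_def by simp
    moreover have "z c * (real 0 - a c) \<le> z (parent c) * real i"
      using a_large[OF cr(1)] z_pos[of r] z_pos[of c] unfolding cr(2)
      by (smt (verit) mult_nonneg_nonneg mult_minus_right of_nat_0 of_nat_0_le_iff mult.commute)
    ultimately show "fps_nth (Abs_fps (\<lambda>j. branch_sum c j 0)) i = 1"
      using branch_sum_eq_1[OF cr(1), of i 0] by simp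
  qed (use that in auto)
  have "vertex_series (valency G r) * ?H = geom * U"
  proof -
    have "geom * (1 - fps_X) = 1" by (rule inverse_mult_eq_1) simp
    then have "geom * U = geom * (1 - fps_X) * (geom * (1 - fps_X) ^ k * ?H)"
      unfolding U_def k by (simp add: mult_ac)
    then show ?thesis
      unfolding valency_root k vertex_series_Suc \<open>geom * (1 - fps_X) = 1\<close> by simp
  qed
  then have "branch_sum r 0 0 = fps_nth (geom * U) n"
    using branch_sum_recursion[of 0 r 0] n by (simp add: cube_def)
  also have "\<dots> = (\<Sum>j=0..n. fps_nth geom j * fps_nth U (n - j))" by (rule fps_mult_nth)
  also have "\<dots> = real n + 1" by (simp add: U)
  finally show ?thesis using n by simp
qed

end

section \<open>Quasipolynomials on lines\<close>

text \<open>Among more multiples of \<open>x\<close> than there are cosets two lie in the same coset, so a multiple \<open>j x\<close> with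
  \<open>j\<close> at most the index lies in \<open>\<Lambda>'\<close>. The factorial of the index is divisible by all such \<open>j\<close>.\<close>

lemma finite_index_multiple:
  fixes \<Lambda> :: "(real^'v::finite) set"
  assumes fin: "finite_index_sublattice \<Lambda>' \<Lambda>" and "0 \<in> \<Lambda>" "\<And>x y. x \<in> \<Lambda> \<Longrightarrow> y \<in> \<Lambda> \<Longrightarrow> x - y \<in> \<Lambda>"
  shows "\<exists>N>0. \<forall>x\<in>\<Lambda>. real N *\<^sub>R x \<in> \<Lambda>'"
proof -
  have mult: "real n *\<^sub>R x \<in> X" if X: "0 \<in> X" "\<And>x y. x \<in> X \<Longrightarrow> y \<in> X \<Longrightarrow> x - y \<in> X" and x: "x \<in> X"
    for n and x :: "real^'v" and X
  proof (induction n)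
    case (Suc n)
    have "- x \<in> X" using X(2)[OF X(1) x] by simp
    from X(2)[OF Suc this] show ?case by (simp add: scaleR_left_distrib add.commute)
  qed (simp add: X)
  have sub: "0 \<in> \<Lambda>'" "\<And>x y. x \<in> \<Lambda>' \<Longrightarrow> y \<in> \<Lambda>' \<Longrightarrow> x - y \<in> \<Lambda>'"
    using fin unfolding finite_index_sublattice_def by auto
  define F where "F = (\<lambda>x. (+) x ` \<Lambda>') ` \<Lambda>"
  have finF: "finite F" using fin unfolding F_def finite_index_sublattice_def by blast
  have "real (fact (card F)) *\<^sub>R x \<in> \<Lambda>'" if x: "x \<in> \<Lambda>" for x
  proof -
    let ?h = "\<lambda>k. (+) (real k *\<^sub>R x) ` \<Lambda>'"
    have "?h ` {..card F} \<subseteq> F" unfolding F_def using mult[OF assms(2,3) x] by auto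
    then have "card (?h ` {..card F}) \<le> card F" by (rule card_mono[OF finF])
    then have "\<not> inj_on ?h {..card F}" using card_image[of ?h "{..card F}"] by auto
    then obtain i j where ij: "i \<in> {..card F}" "j \<in> {..card F}" "i < j" "?h i = ?h j"
      unfolding inj_on_def by (metis linorder_neqE_nat)
    have "real j *\<^sub>R x \<in> ?h j" using sub(1) by force
    then obtain d where d: "d \<in> \<Lambda>'" "real j *\<^sub>R x = real i *\<^sub>R x + d" unfolding ij(4)[symmetric] by auto
    have dx: "d = real (j - i) *\<^sub>R x" using d(2) ij(3) by (simp add: of_nat_diff scaleR_left_diff_distrib)
    have "(j - i) dvd fact (card F)" using ij by (intro dvd_fact) auto
    then obtain m where m: "fact (card F) = m * (j - i)" by (metis dvd_def mult.commute)
    have "real (fact (card F)) *\<^sub>R x = real m *\<^sub>R d"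
      unfolding dx m by simp
    then show ?thesis using mult[OF sub d(1)] by simp
  qed
  then show ?thesis by (intro exI[of _ "fact (card F)"]) auto
qed

lemma finite_index_sublattice_refl:
  fixes \<Lambda> :: "(real^'v::finite) set"
  assumes \<Lambda>: "0 \<in> \<Lambda>" "\<And>x y. x \<in> \<Lambda> \<Longrightarrow> y \<in> \<Lambda> \<Longrightarrow> x - y \<in> \<Lambda>"
  shows "finite_index_sublattice \<Lambda> \<Lambda>"
proof -
  have add: "x + y \<in> \<Lambda>" if "x \<in> \<Lambda>" "y \<in> \<Lambda>" for x y
    using \<Lambda>(2)[OF that(1) \<Lambda>(2)[OF \<Lambda>(1) that(2)]] by simp
  have coset: "(+) x ` \<Lambda> = \<Lambda>" if x: "x \<in> \<Lambda>" for x
  proof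
    show "\<Lambda> \<subseteq> (+) x ` \<Lambda>"
    proof
      fix y assume "y \<in> \<Lambda>"
      then have "y - x \<in> \<Lambda>" using \<Lambda>(2) x by blast
      then show "y \<in> (+) x ` \<Lambda>" by (intro image_eqI[of _ _ "y - x"]) auto
    qed
  qed (use add x in auto)
  have "(\<lambda>x. (+) x ` \<Lambda>) ` \<Lambda> \<subseteq> {\<Lambda>}" using coset by auto
  then show ?thesis
    unfolding finite_index_sublattice_def using \<Lambda> by (auto intro: finite_subset)
qed

text \<open>Along a line whose step is a period, a quasipolynomial is a polynomial in one variable. This
  reduces identities between quasipolynomials to identities far out on lines.\<close>

lemma quasipolynomial_on_line:
  assumes f: "quasipolynomial_on \<Lambda> f" and \<Lambda>: "0 \<in> \<Lambda>" "\<And>x y. x \<in> \<Lambda> \<Longrightarrow> y \<in> \<Lambda> \<Longrightarrow> x - y \<in> \<Lambda>"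
  shows "\<exists>N>0. \<forall>N'. N dvd N' \<longrightarrow> (\<forall>l\<in>\<Lambda>. \<forall>z\<in>\<Lambda>. \<exists>P. \<forall>n. f (l + real (n * N') *\<^sub>R z) = poly P (real n))"
proof -
  obtain M c \<Lambda>' where M: "finite M" "finite_index_sublattice \<Lambda>' \<Lambda>"
    "\<And>m l d. m \<in> M \<Longrightarrow> l \<in> \<Lambda> \<Longrightarrow> d \<in> \<Lambda>' \<Longrightarrow> c m (l + d) = c m l"
    "\<And>l. l \<in> \<Lambda> \<Longrightarrow> f l = (\<Sum>m\<in>M. c m l * (\<Prod>v\<in>UNIV. (l $ v) ^ m v))"
    using f unfolding quasipolynomial_on_def by blast
  obtain N where N: "N > 0" "\<And>x. x \<in> \<Lambda> \<Longrightarrow> real N *\<^sub>R x \<in> \<Lambda>'"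
    using finite_index_multiple[OF M(2) \<Lambda>] by blast
  have neg: "- x \<in> \<Lambda>" if "x \<in> \<Lambda>" for x using \<Lambda>(2)[OF \<Lambda>(1) that] by simp
  have add: "x + y \<in> \<Lambda>" if "x \<in> \<Lambda>" "y \<in> \<Lambda>" for x y using \<Lambda>(2)[OF that(1) neg[OF that(2)]] by simp
  have mult: "real n *\<^sub>R x \<in> \<Lambda>" if "x \<in> \<Lambda>" for n x
    by (induction n) (auto simp: \<Lambda>(1) scaleR_left_distrib add that)
  have "\<exists>P. \<forall>n. f (l + real (n * N') *\<^sub>R z) = poly P (real n)"
    if "N dvd N'" and l: "l \<in> \<Lambda>" and z: "z \<in> \<Lambda>" for N' l z
  proof -
    obtain k where k: "N' = N * k" using \<open>N dvd N'\<close> by blast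
    define P where "P = (\<Sum>m\<in>M. smult (c m l) (\<Prod>v\<in>UNIV. [:l $ v, real N' * z $ v:] ^ m v))"
    have "f (l + real (n * N') *\<^sub>R z) = poly P (real n)" for n
    proof -
      have "real N *\<^sub>R (real (n * k) *\<^sub>R z) \<in> \<Lambda>'" by (intro N mult z)
      then have per: "real (n * N') *\<^sub>R z \<in> \<Lambda>'" by (simp add: k mult_ac)
      have "l + real (n * N') *\<^sub>R z \<in> \<Lambda>" by (intro add mult l z)
      then have "f (l + real (n * N') *\<^sub>R z) =
        (\<Sum>m\<in>M. c m (l + real (n * N') *\<^sub>R z) * (\<Prod>v\<in>UNIV. ((l + real (n * N') *\<^sub>R z) $ v) ^ m v))"
        by (rule M(4))
      also have "\<dots> = poly P (real n)"
        unfolding P_def poly_sum poly_smult poly_prod poly_power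
        by (rule sum.cong) (use M(3)[OF _ l per] in \<open>auto simp: mult_ac\<close>)
      finally show ?thesis .
    qed
    then show ?thesis by blast
  qed
  then show ?thesis using N(1) by blast
qed

lemma poly_eq_if_eventually_eq:
  fixes P R :: "real poly"
  assumes "\<And>n. n \<ge> n0 \<Longrightarrow> poly P (real n) = poly R (real n)"
  shows "P = R"
proof (rule ccontr)
  assume "P \<noteq> R"
  then have "finite {x. poly (P - R) x = 0}" by (intro poly_roots_finite) simp
  moreover have "real ` {n0..} \<subseteq> {x. poly (P - R) x = 0}" using assms by auto
  ultimately have "finite (real ` {n0..})" by (rule finite_subset[rotated])
  then have "finite {n0..}" by (rule finite_imageD) (simp add: inj_on_def)
  then show False using infinite_Ici by blast
qed

section \<open>The counting function deep in the Lipman cone\<close>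

context unimodular_plumbing_tree
begin

text \<open>The Riemann--Roch expression \<open>-(l, l + K)/2\<close>.\<close>

definition chi :: "real^'v \<Rightarrow> real" where
  "chi l = - (int_form G l l + int_form G (canonical_class G) l) / 2"

text \<open>An upper bound for all coordinates of the \<open>E\<^sub>v\<^sup>*\<close>. As these are at least 1, it also bounds all the ratios of
  coordinates that occur as slopes in the summation over the tree.\<close>

definition deep :: int where
  "deep = \<lceil>\<Sum>v\<in>UNIV. \<Sum>w\<in>UNIV. E_star G v $ w\<rceil>"

lemma E_star_le_deep: "E_star G v $ w \<le> of_int deep"
proof -
  have "E_star G v $ w \<le> (\<Sum>w\<in>UNIV. E_star G v $ w)"
    by (rule member_le_sum) (use E_star_pos less_imp_le in auto)
  also have "\<dots> \<le> (\<Sum>v\<in>UNIV. \<Sum>w\<in>UNIV. E_star G v $ w)"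
    by (rule member_le_sum[of v UNIV "\<lambda>v. \<Sum>w\<in>UNIV. E_star G v $ w"])
      (use E_star_pos less_imp_le in \<open>auto intro!: sum_nonneg\<close>)
  also have "\<dots> \<le> of_int deep" unfolding deep_def by simp
  finally show ?thesis .
qed

lemma deep_pos: "1 \<le> deep"
  using E_star_ge_1[of undefined undefined] E_star_le_deep[of undefined undefined] by linarith

definition shift :: "real^'v \<Rightarrow> ('v \<Rightarrow> nat) \<Rightarrow> real^'v" where
  "shift l y = l + (\<Sum>w\<in>UNIV. real (y w) *\<^sub>R E w)"

lemma shift_nth [simp]: "shift l y $ w = l $ w + real (y w)"
proof -
  have "(\<Sum>u\<in>UNIV. real (y u) * (E u :: real^'v) $ w) = (\<Sum>u\<in>UNIV. if u = w then real (y w) else 0)"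
    by (rule sum.cong) (auto simp: axis_def)
  then show ?thesis unfolding shift_def by simp
qed

lemma shift_std: "l \<in> std_lattice \<Longrightarrow> shift l y \<in> std_lattice"
  unfolding std_lattice_def by simp

lemma lcoord_shift:
  assumes "l \<in> std_lattice"
  shows "lcoord (shift l y) w = lcoord l w + beta w * int (y w) - (\<Sum>u\<in>neighbours w. int (y u))"
  using lcoord[OF assms, of w]
  by (intro lcoord_eqI shift_std assms) (simp add: dual_coord_eq sum.distrib distrib_left)

text \<open>Write \<open>l'' = l + y\<close> with \<open>y \<ge> 0\<close> and \<open>y r = 0\<close>. The coefficient at \<open>l''\<close> is a product of factors that
  depend on \<open>y\<close> at a vertex and its neighbours, so the sum is the one over the tree with root \<open>r\<close>.\<close>

lemma slice_sum:
  assumes l: "l \<in> std_lattice" and large: "\<And>w. deep \<le> lcoord l w"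
  shows "(\<Sum>l'' | l'' \<in> lattice_cone \<and> l \<le> l'' \<and> l'' $ r = l $ r. Z_coeff G l'') = of_int (lcoord l r) + 1"
proof -
  obtain idx :: "'v \<Rightarrow> nat" where idx: "inj idx" "idx r = 0"
    "\<And>w. w \<noteq> r \<Longrightarrow> \<exists>!p. adj G w p \<and> idx p < idx w"
    using rooted_enumeration by blast
  interpret rooted_plumbing_tree G r idx by unfold_locales (use idx in auto)
  define \<alpha> where "\<alpha> = nat (\<Sum>w\<in>UNIV. \<bar>lcoord l w\<bar>)"
  define \<beta> where "\<beta> = nat (\<Sum>w\<in>UNIV. beta w)"
  \<comment> \<open>A solution of \<open>\<alpha> + \<beta> m(i) \<le> m(i + 1)\<close>, the growth required along a branch.\<close>
  define m where "m i = (\<alpha> + 1) * (\<beta> + 1) ^ i" for i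
  have \<alpha>: "lcoord l w \<le> int \<alpha>" for w
    using member_le_sum[of w UNIV "\<lambda>w. \<bar>lcoord l w\<bar>"] unfolding \<alpha>_def by simp
  have \<beta>: "beta w \<le> int \<beta>" for w
    using member_le_sum[of w UNIV beta] beta_pos less_imp_le unfolding \<beta>_def by fastforce
  have m_large: "lcoord l w + beta w * int s \<le> int (m (idx c))" if c: "c \<in> children w" and s: "s \<le> m (idx w)" for c w s
  proof -
    have "lcoord l w + beta w * int s \<le> int \<alpha> + int \<beta> * int (m (idx w))"
      using \<alpha>[of w] \<beta>[of w] s by (intro add_mono mult_mono) auto
    also have "int \<alpha> \<le> int (m (idx w))"
      unfolding m_def of_nat_le_iff
      using mult_le_mono[of \<alpha> "\<alpha> + 1" 1 "(\<beta> + 1) ^ idx w"] by simp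
    also have "int (m (idx w)) + int \<beta> * int (m (idx w)) = int (m (Suc (idx w)))"
      unfolding m_def by (simp add: algebra_simps)
    also have "\<dots> \<le> int (m (idx c))"
      unfolding m_def of_nat_le_iff using child_idx[OF c] by (intro mult_le_mono power_increasing) auto
    finally show ?thesis by simp
  qed
  interpret tree_transfer G r idx "lcoord l" "\<lambda>w. E_star G r $ w" "\<lambda>w. m (idx w)"
  proof
    show "0 < E_star G r $ w" for w by (rule E_star_pos)
    show "E_star G r $ parent w + (\<Sum>c\<in>children w. E_star G r $ c) \<le> beta w * E_star G r $ w"
      if "w \<noteq> r" for w
      using dual_coord_E_star[of r w] that
      by (simp add: dual_coord_eq neighbours_nonroot parent_notin_children)
    show "E_star G r $ parent w \<le> lcoord l w * E_star G r $ w" for w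
    proof -
      have "E_star G r $ parent w \<le> of_int (lcoord l w) * 1"
        unfolding mult_1_right using E_star_le_deep[of r "parent w"]
        by (rule order_trans) (simp add: large)
      also have "\<dots> \<le> of_int (lcoord l w) * E_star G r $ w"
        using E_star_ge_1[of r w] large[of w] deep_pos by (intro mult_left_mono) auto
      finally show ?thesis .
    qed
    show "0 \<le> lcoord l r" using large[of r] deep_pos by simp
  qed (rule m_large)
  let ?S = "{l'' \<in> lattice_cone. l \<le> l'' \<and> l'' $ r = l $ r}"
  let ?T = "{y \<in> PiE (descendants r) cube. y r = 0}"
  have finT: "finite ?T"
    by (rule finite_subset[of _ "PiE (descendants r) cube"]) (auto intro!: finite_PiE simp: cube_def)
  have inj: "inj_on (shift l) ?T"
    by (rule inj_onI) (auto simp: vec_eq_iff fun_eq_iff dest: spec)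
  have Z: "Z_coeff G (shift l y) = branch_wt r 0 y" if y: "y \<in> ?T" for y
  proof -
    have "Z_coeff G (shift l y) = (\<Prod>w\<in>UNIV. fps_at (vertex_series (valency G w)) (lcoord (shift l y) w))"
      by (simp add: Z_coeff_eq lattice_series_def shift_std l)
    also have "\<dots> = fps_at (vertex_series (valency G r)) (lcoord (shift l y) r) *
      (\<Prod>w\<in>UNIV - {r}. fps_at (vertex_series (valency G w)) (lcoord (shift l y) w))"
      by (subst prod.remove[of UNIV r]) auto
    also have "fps_at (vertex_series (valency G r)) (lcoord (shift l y) r) = wt r 0 y"
      using y by (simp add: wt_def lcoord_shift l neighbours_root)
    also have "(\<Prod>w\<in>UNIV - {r}. fps_at (vertex_series (valency G w)) (lcoord (shift l y) w)) =
      (\<Prod>w\<in>descendants r - {r}. wt w (y (parent w)) y)"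
      by (rule prod.cong)
        (auto simp: wt_def lcoord_shift l neighbours_nonroot parent_notin_children descendants_root algebra_simps)
    finally show ?thesis unfolding branch_wt_def .
  qed
  have sub: "?S \<subseteq> shift l ` ?T"
  proof
    fix l'' assume l'': "l'' \<in> ?S"
    define y where "y w = nat \<lfloor>l'' $ w - l $ w\<rfloor>" for w
    have std: "l'' \<in> std_lattice" using l'' by (simp add: lattice_cone_def)
    have yw: "real (y w) = l'' $ w - l $ w" for w
    proof -
      have "l'' $ w - l $ w \<in> \<int>" using std l by (auto simp: std_lattice_def intro: Ints_diff)
      moreover have "0 \<le> l'' $ w - l $ w" using l'' by (simp add: less_eq_vec_def)
      ultimately show ?thesis unfolding y_def by (auto elim!: Ints_cases)
    qed
    have eq: "l'' = shift l y" by (simp add: vec_eq_iff yw)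
    have y0: "y r = 0" using yw[of r] l'' by simp
    \<comment> \<open>A value at \<open>w\<close> beyond the bound would make the dual coordinate at the parent of \<open>w\<close> negative.\<close>
    have "y w \<le> m (idx w)" for w
    proof (induction "idx w" arbitrary: w rule: less_induct)
      case less
      show ?case
      proof (cases "w = r")
        case False
        let ?p = "parent w"
        have w: "w \<in> children ?p" using False by (simp add: children_iff)
        have "children ?p \<subseteq> neighbours ?p" by (auto simp: children_def neighbours_def)
        then have "int (y w) \<le> (\<Sum>u\<in>neighbours ?p. int (y u))"
          using w by (intro member_le_sum) auto
        also have "\<dots> \<le> lcoord l ?p + beta ?p * int (y ?p)"
        proof -
          have "0 \<le> lcoord l'' ?p" using l'' unfolding lattice_cone_def lcoord_def by simp
          then show ?thesis unfolding eq lcoord_shift[OF l] by simp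
        qed
        also have "\<dots> \<le> int (m (idx w))" using m_large[OF w] less parent(2)[OF False] by blast
        finally show ?thesis by simp
      qed (simp add: y0)
    qed
    then have "y \<in> ?T" using y0 by (auto simp: descendants_root cube_def)
    then show "l'' \<in> shift l ` ?T" using eq by blast
  qed
  have "(\<Sum>l''\<in>?S. Z_coeff G l'') = (\<Sum>l''\<in>shift l ` ?T. Z_coeff G l'')"
  proof (rule sum.mono_neutral_left)
    show "\<forall>l''\<in>shift l ` ?T - ?S. Z_coeff G l'' = 0"
      using lattice_series_nonzero unfolding Z_coeff_eq by (fastforce simp: less_eq_vec_def)
  qed (use finT sub in auto)
  also have "\<dots> = branch_sum r 0 0"
    unfolding branch_sum_def by (subst sum.reindex[OF inj]) (auto intro!: sum.cong Z)
  also have "\<dots> = of_int (lcoord l r) + 1" by (rule root_sum)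
  finally show ?thesis by simp
qed

text \<open>Passing from \<open>l\<close> to \<open>l + E\<^sub>r\<close> adds exactly the slice of the \<open>l'' \<ge> l\<close> with the same \<open>r\<close>-coordinate.\<close>

lemma counting_fun_step:
  assumes l: "l \<in> std_lattice" and large: "\<And>w. deep \<le> lcoord l w"
  shows "counting_fun (Z_coeff G) (l + E r) = counting_fun (Z_coeff G) l + of_int (lcoord l r) + 1"
proof -
  let ?A = "{l'' \<in> lattice_cone. \<not> l \<le> l''}" and ?B = "{l'' \<in> lattice_cone. l \<le> l'' \<and> l'' $ r = l $ r}"
  have El: "(l + E r :: real^'v) $ w = l $ w + (if w = r then 1 else 0)" for w by (simp add: axis_def)
  have le_iff: "l + E r \<le> l'' \<longleftrightarrow> l \<le> l'' \<and> l'' $ r \<noteq> l $ r" if "l'' \<in> lattice_cone" for l''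
  proof -
    have "l'' $ r \<in> \<int>" "l $ r \<in> \<int>" using that l by (auto simp: lattice_cone_def std_lattice_def)
    then have *: "l $ r + 1 \<le> l'' $ r \<longleftrightarrow> l $ r \<le> l'' $ r \<and> l'' $ r \<noteq> l $ r"
      by (auto elim!: Ints_cases)
    show ?thesis
    proof
      assume le: "l + E r \<le> l''"
      then have "l $ w \<le> l'' $ w" for w using El[of w] unfolding less_eq_vec_def by (smt (verit))
      moreover have "l $ r + 1 \<le> l'' $ r" using le El[of r] unfolding less_eq_vec_def by (metis (full_types))
      ultimately show "l \<le> l'' \<and> l'' $ r \<noteq> l $ r" using * by (simp add: less_eq_vec_def)
    next
      assume "l \<le> l'' \<and> l'' $ r \<noteq> l $ r"
      then show "l + E r \<le> l''" using * El unfolding less_eq_vec_def by auto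
    qed
  qed
  have eq: "{l'' \<in> lattice_cone. \<not> l + E r \<le> l''} = ?A \<union> ?B" using le_iff by blast
  have fin: "finite (?A \<union> ?B)" unfolding eq[symmetric] by (rule finite_not_above)
  have "counting_fun (Z_coeff G) (l + E r) = (\<Sum>l''\<in>?A \<union> ?B. Z_coeff G l'')"
    unfolding Z_coeff_eq counting_fun_lattice_series eq ..
  also have "\<dots> = (\<Sum>l''\<in>?A. Z_coeff G l'') + (\<Sum>l''\<in>?B. Z_coeff G l'')"
    by (rule sum.union_disjoint) (use fin in auto)
  also have "(\<Sum>l''\<in>?B. Z_coeff G l'') = of_int (lcoord l r) + 1"
    by (rule slice_sum[OF l large])
  also have "(\<Sum>l''\<in>?A. Z_coeff G l'') = counting_fun (Z_coeff G) l"
    unfolding Z_coeff_eq counting_fun_lattice_series ..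
  finally show ?thesis by simp
qed

lemma chi_step:
  assumes "l \<in> std_lattice"
  shows "chi (l + E r) = chi l + of_int (lcoord l r) + 1"
proof -
  have "int_form G l (E r) = - dual_coord l r" "int_form G (E r) (E r) = of_int (euler G r)"
    using dual_coord_axis[of r r] by (simp_all add: dual_coord_def beta_def)
  moreover have "int_form G (E r) l = int_form G l (E r)" by (rule int_form_sym)
  ultimately show ?thesis
    by (simp add: chi_def int_form_linear canonical_class_form lcoord assms field_simps)
qed

definition defect :: "real^'v \<Rightarrow> real" where
  "defect l = counting_fun (Z_coeff G) l - chi l"

text \<open>Add the basis vectors one at a time: each step lowers a dual coordinate by at most 1, so all intermediate
  points stay deep in the cone.\<close>

lemma defect_shift:
  assumes "l \<in> std_lattice" "\<And>w. deep + int (\<Sum>u\<in>UNIV. y u) \<le> lcoord l w"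
  shows "defect (shift l y) = defect l"
  using assms
proof (induction "\<Sum>u\<in>UNIV. y u" arbitrary: y l)
  case 0
  then have "shift l y = l" by (simp add: vec_eq_iff)
  then show ?case by simp
next
  case (Suc n)
  then obtain v where v: "0 < y v" by (metis gr0I sum.neutral zero_neq_numeral nat.distinct(1))
  define y' where "y' = y(v := y v - 1)"
  have "(\<Sum>u\<in>UNIV. y u) = y v + (\<Sum>u\<in>UNIV - {v}. y u)" by (subst sum.remove[of UNIV v]) auto
  moreover have "(\<Sum>u\<in>UNIV. y' u) = y' v + (\<Sum>u\<in>UNIV - {v}. y' u)" by (subst sum.remove[of UNIV v]) auto
  moreover have "(\<Sum>u\<in>UNIV - {v}. y' u) = (\<Sum>u\<in>UNIV - {v}. y u)"
    by (rule sum.cong) (auto simp: y'_def)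
  ultimately have n: "n = (\<Sum>u\<in>UNIV. y' u)" using Suc(2) v by (simp add: y'_def)
  have std: "l + E v \<in> std_lattice" by (intro std_lattice_add Suc std_lattice_axis)
  have "lcoord l w - 1 \<le> lcoord (l + E v) w" for w
  proof -
    have "dual_coord l w - 1 \<le> dual_coord (l + E v) w"
      using beta_pos[of w] by (simp add: dual_coord_axis)
    then show ?thesis using lcoord[OF std, of w] lcoord[OF Suc(3), of w] by linarith
  qed
  then have "deep + int (\<Sum>u\<in>UNIV. y' u) \<le> lcoord (l + E v) w" for w
    using Suc(4)[of w] Suc(2) n by (smt (verit) of_nat_Suc)
  then have "defect (shift (l + E v) y') = defect (l + E v)"
    by (intro Suc(1) n std)
  also have "\<dots> = defect l"
  proof -
    have "deep \<le> lcoord l w" for w using Suc(4)[of w] by linarith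
    then show ?thesis using counting_fun_step chi_step Suc(3) by (simp add: defect_def)
  qed
  also have "shift (l + E v) y' = shift l y"
    using v by (auto simp: vec_eq_iff y'_def axis_def of_nat_diff)
  finally show ?case .
qed

text \<open>Any two points that are deep enough can be joined through a common point above both, using only steps
  \<open>+E\<^sub>v\<close> in the deep region: first move along the interior direction \<open>z\<close>, which costs nothing, and then
  make up for the difference.\<close>

lemma defect_const:
  "\<exists>c A. \<forall>l\<in>std_lattice. (\<forall>w. real_of_int A \<le> dual_coord l w) \<longrightarrow> counting_fun (Z_coeff G) l = chi l + c"
proof -
  define z where "z = lattice_point (\<lambda>_. 1)"
  have z: "z \<in> std_lattice" "\<And>w. dual_coord z w = 1" unfolding z_def by (simp_all add: lattice_point_std)
  then have "0 \<le> z $ w" for w by (intro nonneg_if_dual_coord_nonneg) simp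
  define y0 where "y0 w = nat \<lfloor>z $ w\<rfloor>" for w
  have y0: "real (y0 w) = z $ w" for w
    using z(1) \<open>0 \<le> z $ w\<close> unfolding y0_def std_lattice_def by (auto elim!: Ints_cases dest!: spec[of _ w])
  define A where "A = deep + int (\<Sum>u\<in>UNIV. y0 u)"
  have line: "defect (l + real n *\<^sub>R z) = defect l"
    if l: "l \<in> std_lattice" "\<And>w. A \<le> lcoord l w" for l n
  proof (induction n)
    case (Suc n)
    let ?l = "l + real n *\<^sub>R z"
    have std: "?l \<in> std_lattice" by (intro std_lattice_add l std_lattice_nat_scale z)
    have "dual_coord l w \<le> dual_coord ?l w" for w by (simp add: z)
    then have "lcoord l w \<le> lcoord ?l w" for w unfolding lcoord_def by (rule floor_mono)
    then have "defect (shift ?l y0) = defect ?l"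
      using l(2) by (intro defect_shift std) (auto simp: A_def intro: order_trans)
    moreover have "shift ?l y0 = l + real (Suc n) *\<^sub>R z" by (simp add: vec_eq_iff y0 algebra_simps)
    ultimately show ?case using Suc by simp
  qed simp
  have const: "defect l = defect l'"
    if l: "l \<in> std_lattice" "\<And>w. A \<le> lcoord l w" and l': "l' \<in> std_lattice" "\<And>w. A \<le> lcoord l' w" for l l'
  proof -
    define p where "p w = nat \<lfloor>l' $ w - l $ w\<rfloor>" for w
    define q where "q w = nat \<lfloor>l $ w - l' $ w\<rfloor>" for w
    have pq: "real (p w) - real (q w) = l' $ w - l $ w" for w
    proof -
      have "l' $ w \<in> \<int>" "l $ w \<in> \<int>" using l l' by (auto simp: std_lattice_def)
      then obtain i j where "l' $ w = of_int i" "l $ w = of_int j" by (auto elim!: Ints_cases)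
      moreover have "\<lfloor>real_of_int i - real_of_int j\<rfloor> = i - j" for i j
        by (metis floor_of_int of_int_diff)
      ultimately show ?thesis unfolding p_def q_def by simp
    qed
    define n where "n = (\<Sum>u\<in>UNIV. p u) + (\<Sum>u\<in>UNIV. q u)"
    have up: "defect (shift (x + real n *\<^sub>R z) y) = defect x"
      if x: "x \<in> std_lattice" "\<And>w. A \<le> lcoord x w" and y: "(\<Sum>u\<in>UNIV. y u) \<le> n" for x y
    proof -
      have std: "x + real n *\<^sub>R z \<in> std_lattice" by (intro std_lattice_add x std_lattice_nat_scale z)
      have "lcoord (x + real n *\<^sub>R z) w = lcoord x w + int n" for w
        by (rule lcoord_eqI[OF std]) (simp add: lcoord x z)
      moreover have "deep + int (\<Sum>u\<in>UNIV. y u) \<le> lcoord x w + int n" for w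
        using x(2)[of w] y unfolding A_def by linarith
      ultimately have "defect (shift (x + real n *\<^sub>R z) y) = defect (x + real n *\<^sub>R z)"
        by (intro defect_shift std) simp
      then show ?thesis using line[OF x] by simp
    qed
    have "shift (l + real n *\<^sub>R z) p = shift (l' + real n *\<^sub>R z) q"
      unfolding vec_eq_iff using pq by (simp add: algebra_simps)
    then show ?thesis using up[OF l, of p] up[OF l', of q] unfolding n_def by simp
  qed
  define l0 where "l0 = lattice_point (\<lambda>_. nat A)"
  have l0: "l0 \<in> std_lattice" "\<And>w. A \<le> lcoord l0 w" unfolding l0_def by (simp_all add: lattice_point_std)
  have "counting_fun (Z_coeff G) l = chi l + defect l0"
    if l: "l \<in> std_lattice" "\<And>w. real_of_int A \<le> dual_coord l w" for l
  proof -
    have "A \<le> lcoord l w" for w using l(2)[of w] unfolding lcoord_def by (simp add: le_floor_iff)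
    then have "defect l = defect l0" by (intro const l l0)
    then show ?thesis by (simp add: defect_def)
  qed
  then show ?thesis by blast
qed

end

section \<open>Polynomial functions and iterated differences\<close>

text \<open>Exponents are extensional functions, so that each monomial on \<open>S\<close> occurs once.\<close>

definition exponents :: "'i set \<Rightarrow> nat \<Rightarrow> ('i \<Rightarrow> nat) set" where
  "exponents S d = {m \<in> S \<rightarrow>\<^sub>E UNIV. (\<Sum>n\<in>S. m n) \<le> d}"

definition poly_fun :: "'i set \<Rightarrow> nat \<Rightarrow> (('i \<Rightarrow> real) \<Rightarrow> real) \<Rightarrow> bool" where
  "poly_fun S d g \<longleftrightarrow> (\<exists>c. \<forall>x. g x = (\<Sum>m\<in>exponents S d. c m * (\<Prod>n\<in>S. x n ^ m n)))"

lemma finite_exponents: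
  assumes "finite S" shows "finite (exponents S d)"
proof (rule finite_subset)
  show "exponents S d \<subseteq> S \<rightarrow>\<^sub>E {..d}"
  proof
    fix m assume m: "m \<in> exponents S d"
    have "m n \<le> d" if "n \<in> S" for n
      using m that member_le_sum[of n S m] assms unfolding exponents_def by fastforce
    then show "m \<in> S \<rightarrow>\<^sub>E {..d}" using m unfolding exponents_def by auto
  qed
qed (simp add: assms finite_PiE)

lemma poly_fun_mono:
  assumes "finite S" "poly_fun S d g" "d \<le> d'" shows "poly_fun S d' g"
proof -
  obtain c where c: "\<And>x. g x = (\<Sum>m\<in>exponents S d. c m * (\<Prod>n\<in>S. x n ^ m n))"
    using assms(2) unfolding poly_fun_def by blast
  have "g x = (\<Sum>m\<in>exponents S d'. (if m \<in> exponents S d then c m else 0) * (\<Prod>n\<in>S. x n ^ m n))" for x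
    unfolding c using assms(3)
    by (intro sum.mono_neutral_cong_left finite_exponents assms) (auto simp: exponents_def)
  then show ?thesis
    unfolding poly_fun_def by (intro exI[of _ "\<lambda>m. if m \<in> exponents S d then c m else 0"]) blast
qed

lemma poly_fun_const:
  assumes "finite S" shows "poly_fun S d (\<lambda>_. a)"
proof -
  have "exponents S 0 = {\<lambda>n\<in>S. 0}"
    using assms unfolding exponents_def by (auto simp: PiE_def extensional_def restrict_def fun_eq_iff)
  then have "poly_fun S 0 (\<lambda>_. a)" unfolding poly_fun_def by (intro exI[of _ "\<lambda>_. a"]) simp
  then show ?thesis using poly_fun_mono assms by blast
qed

lemma poly_fun_add:
  assumes "poly_fun S d f" "poly_fun S d g" shows "poly_fun S d (\<lambda>x. f x + g x)"
proof -
  obtain c where "\<And>x. f x = (\<Sum>m\<in>exponents S d. c m * (\<Prod>n\<in>S. x n ^ m n))"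
    using assms(1) unfolding poly_fun_def by blast
  moreover obtain c' where "\<And>x. g x = (\<Sum>m\<in>exponents S d. c' m * (\<Prod>n\<in>S. x n ^ m n))"
    using assms(2) unfolding poly_fun_def by blast
  ultimately show ?thesis unfolding poly_fun_def
    by (intro exI[of _ "\<lambda>m. c m + c' m"]) (simp add: distrib_right sum.distrib)
qed

lemma poly_fun_cmult:
  assumes "poly_fun S d g" shows "poly_fun S d (\<lambda>x. a * g x)"
proof -
  obtain c where "\<And>x. g x = (\<Sum>m\<in>exponents S d. c m * (\<Prod>n\<in>S. x n ^ m n))"
    using assms unfolding poly_fun_def by blast
  then show ?thesis unfolding poly_fun_def
    by (intro exI[of _ "\<lambda>m. a * c m"]) (simp add: sum_distrib_left mult_ac)
qed

lemma poly_fun_sum: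
  assumes "finite S" "\<And>i. i \<in> I \<Longrightarrow> poly_fun S d (f i)" shows "poly_fun S d (\<lambda>x. \<Sum>i\<in>I. f i x)"
  using assms(2)
proof (induction I rule: infinite_finite_induct)
  case (insert i I)
  then have "poly_fun S d (\<lambda>x. f i x + (\<Sum>i\<in>I. f i x))" by (intro poly_fun_add) auto
  then show ?case using insert by simp
qed (simp_all add: poly_fun_const assms(1))

lemma poly_fun_coord_mult:
  assumes "finite S" "poly_fun S d g" "k \<in> S" shows "poly_fun S (Suc d) (\<lambda>x. x k * g x)"
proof -
  obtain c where c: "\<And>x. g x = (\<Sum>m\<in>exponents S d. c m * (\<Prod>n\<in>S. x n ^ m n))"
    using assms(2) unfolding poly_fun_def by blast
  let ?up = "\<lambda>m. m(k := Suc (m k))"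
  have pr: "(\<Prod>n\<in>S. x n ^ (?up m) n) = x k * (\<Prod>n\<in>S. x n ^ m n)" for x :: "'a \<Rightarrow> real" and m
  proof -
    have "(\<Prod>n\<in>S - {k}. x n ^ (?up m) n) = (\<Prod>n\<in>S - {k}. x n ^ m n)"
      by (rule prod.cong) auto
    then show ?thesis using assms(1,3) by (simp add: prod.remove[of S k] mult_ac)
  qed
  have sm: "(\<Sum>n\<in>S. (?up m) n) = Suc (\<Sum>n\<in>S. m n)" for m
  proof -
    have "(\<Sum>n\<in>S - {k}. (?up m) n) = (\<Sum>n\<in>S - {k}. m n)"
      by (rule sum.cong) auto
    then show ?thesis using assms(1,3) by (simp add: sum.remove[of S k])
  qed
  have inj: "inj_on ?up (exponents S d)"
  proof (rule inj_onI)
    fix m m' assume "?up m = ?up m'"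
    then have "m n = m' n" for n by (metis fun_upd_apply nat.inject)
    then show "m = m'" by blast
  qed
  have sub: "?up ` exponents S d \<subseteq> exponents S (Suc d)"
    using sm assms(3) unfolding exponents_def by (auto simp: PiE_def extensional_def simp del: fun_upd_apply) (auto)
  define c' where "c' m = (if m \<in> ?up ` exponents S d then c (m(k := m k - 1)) else 0)" for m
  have c'_up: "c' (?up m) = c m" if "m \<in> exponents S d" for m
  proof -
    have "(?up m)(k := (?up m) k - 1) = m" by auto
    then show ?thesis unfolding c'_def using that by (metis (no_types, lifting) imageI)
  qed
  have "x k * g x = (\<Sum>m\<in>exponents S (Suc d). c' m * (\<Prod>n\<in>S. x n ^ m n))" for x
  proof -
    have "x k * g x = (\<Sum>m\<in>exponents S d. c' (?up m) * (\<Prod>n\<in>S. x n ^ (?up m) n))"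
      unfolding c pr sum_distrib_left by (rule sum.cong) (simp_all add: c'_up mult_ac del: fun_upd_apply)
    also have "\<dots> = (\<Sum>m\<in>?up ` exponents S d. c' m * (\<Prod>n\<in>S. x n ^ m n))"
      by (subst sum.reindex[OF inj]) (simp add: o_def)
    also have "\<dots> = (\<Sum>m\<in>exponents S (Suc d). c' m * (\<Prod>n\<in>S. x n ^ m n))"
      by (intro sum.mono_neutral_left finite_exponents assms sub) (simp add: c'_def)
    finally show ?thesis .
  qed
  then show ?thesis unfolding poly_fun_def by blast
qed

lemma poly_fun_linear_mult:
  assumes "finite S" "poly_fun S d g"
  shows "poly_fun S (Suc d) (\<lambda>x. (\<Sum>k\<in>S. x k * e k) * g x)"
proof -
  have "poly_fun S (Suc d) (\<lambda>x. \<Sum>k\<in>S. e k * (x k * g x))"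
    by (intro poly_fun_sum poly_fun_cmult poly_fun_coord_mult assms)
  moreover have "(\<Sum>k\<in>S. x k * e k) * g x = (\<Sum>k\<in>S. e k * (x k * g x))" for x
    by (subst sum_distrib_right) (simp add: mult_ac)
  ultimately show ?thesis by simp
qed

lemma poly_fun_linear_prod:
  assumes "finite S" "finite A"
  shows "poly_fun S (\<Sum>v\<in>A. m v) (\<lambda>x. \<Prod>v\<in>A. (\<Sum>k\<in>S. x k * e v k) ^ m v)"
  using assms(2)
proof (induction A rule: finite_induct)
  case (insert v A)
  have "poly_fun S (j + (\<Sum>v\<in>A. m v))
    (\<lambda>x. (\<Sum>k\<in>S. x k * e v k) ^ j * (\<Prod>v\<in>A. (\<Sum>k\<in>S. x k * e v k) ^ m v))" for j
    by (induction j) (auto simp: insert.IH mult.assoc intro: poly_fun_linear_mult assms)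
  then show ?case using insert by simp
qed (simp add: poly_fun_const assms)

lemma quasipolynomial_on_poly_fun:
  assumes g: "poly_fun UNIV d g" and \<Lambda>: "0 \<in> \<Lambda>" "\<And>x y. x \<in> \<Lambda> \<Longrightarrow> y \<in> \<Lambda> \<Longrightarrow> x - y \<in> \<Lambda>"
  shows "quasipolynomial_on \<Lambda> (\<lambda>l :: real^'v::finite. g (\<lambda>v. l $ v))"
proof -
  obtain c where c: "\<And>x. g x = (\<Sum>m\<in>exponents UNIV d. c m * (\<Prod>n\<in>UNIV. x n ^ m n))"
    using g unfolding poly_fun_def by blast
  have "finite_index_sublattice \<Lambda> \<Lambda>" using \<Lambda> by (rule finite_index_sublattice_refl)
  then show ?thesis
    unfolding quasipolynomial_on_def
    by (intro exI[of _ "exponents UNIV d"] exI[of _ "\<lambda>m _. c m"] exI[of _ \<Lambda>])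
      (simp add: c finite_exponents)
qed

fun iter_diff :: "'a::ab_group_add list \<Rightarrow> ('a \<Rightarrow> real) \<Rightarrow> 'a \<Rightarrow> real" where
  "iter_diff [] f x = f x"
| "iter_diff (s # ss) f x = iter_diff ss f x - iter_diff ss f (x - s)"

lemma iter_diff_cong:
  assumes "x \<in> X" "\<And>y s. y \<in> X \<Longrightarrow> s \<in> set ss \<Longrightarrow> y - s \<in> X" "\<And>y. y \<in> X \<Longrightarrow> f y = g y"
  shows "iter_diff ss f x = iter_diff ss g x"
  using assms by (induction ss arbitrary: x) auto

lemma iter_diff_translate: "iter_diff ss (\<lambda>x. f (x - t)) x = iter_diff ss f (x - t)"
  by (induction ss arbitrary: x) (auto simp: algebra_simps diff_diff_eq)

lemma iter_diff_sum: "iter_diff ss (\<lambda>x. \<Sum>i\<in>I. f i x) x = (\<Sum>i\<in>I. iter_diff ss (f i) x)"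
  by (induction ss arbitrary: x) (auto simp: sum_subtractf)

lemma iter_diff_diff: "iter_diff ss (\<lambda>x. f x - g x) x = iter_diff ss f x - iter_diff ss g x"
  by (induction ss arbitrary: x) auto

lemma iter_diff_append: "iter_diff (ss @ ss') f x = iter_diff ss (iter_diff ss' f) x"
  by (induction ss arbitrary: x) auto

section \<open>The periodic constant and the Ehrhart count\<close>

context unimodular_plumbing_tree
begin

lemma chi_quasipolynomial:
  "quasipolynomial_on std_lattice (\<lambda>l. chi l + c)"
proof -
  define A where "A v w = (if v = w then of_int (euler G v) else if adj G v w then 1 else 0 :: real)" for v w
  define k where "k w = int_form G (canonical_class G) (E w)" for w
  let ?q = "\<lambda>x. (- 1 / 2) * ((\<Sum>v\<in>UNIV. (\<Sum>w\<in>UNIV. x w * A v w) * ((\<Sum>w\<in>UNIV. x w * (if w = v then 1 else 0)) * 1)) +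
    (\<Sum>w\<in>UNIV. x w * k w) * 1) + c"
  have "poly_fun UNIV 2 ?q"
    unfolding numeral_2_eq_2
    by (intro poly_fun_add poly_fun_cmult poly_fun_sum poly_fun_linear_mult poly_fun_const) auto
  then have "quasipolynomial_on std_lattice (\<lambda>l :: real^'v. ?q (\<lambda>v. l $ v))"
    by (rule quasipolynomial_on_poly_fun) (auto intro: std_lattice_zero std_lattice_diff)
  moreover have "?q (\<lambda>v. l $ v) = chi l + c" for l
  proof -
    have "int_form G l l = (\<Sum>v\<in>UNIV. (\<Sum>w\<in>UNIV. l $ w * A v w) * l $ v)"
      unfolding int_form_def A_def[symmetric] by (simp add: sum_distrib_left sum_distrib_right mult_ac)
    moreover have "int_form G (canonical_class G) l = (\<Sum>w\<in>UNIV. l $ w * k w)"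
      unfolding k_def by (rule int_form_eq_sum)
    moreover have "(\<Sum>w\<in>UNIV. l $ w * (if w = v then 1 else 0)) = l $ v" for v
      by (simp add: if_distrib[of "\<lambda>t. _ * t"] cong: if_cong)
    ultimately show ?thesis unfolding chi_def by (simp add: field_simps)
  qed
  ultimately show ?thesis by (simp only:)
qed

text \<open>On the multiples of an interior lattice vector that lies in all sublattices and is a common period, both
  quasipolynomials are polynomials in one variable. Far out both are the counting function, hence they also
  agree at 0.\<close>

lemma has_periodic_constant_unique:
  assumes "has_periodic_constant (lipman_cone G) p c" "has_periodic_constant (lipman_cone G) p c'"
  shows "c = c'"
proof -
  obtain l1 \<Lambda>1 q1 where 1: "finite_index_sublattice \<Lambda>1 std_lattice" "quasipolynomial_on \<Lambda>1 q1"
    "\<And>l. l \<in> \<Lambda>1 \<inter> (+) l1 ` lipman_cone G \<Longrightarrow> counting_fun p l = q1 l" "c = q1 0"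
    using assms(1) unfolding has_periodic_constant_def by blast
  obtain l2 \<Lambda>2 q2 where 2: "finite_index_sublattice \<Lambda>2 std_lattice" "quasipolynomial_on \<Lambda>2 q2"
    "\<And>l. l \<in> \<Lambda>2 \<inter> (+) l2 ` lipman_cone G \<Longrightarrow> counting_fun p l = q2 l" "c' = q2 0"
    using assms(2) unfolding has_periodic_constant_def by blast
  have g1: "0 \<in> \<Lambda>1" "\<And>x y. x \<in> \<Lambda>1 \<Longrightarrow> y \<in> \<Lambda>1 \<Longrightarrow> x - y \<in> \<Lambda>1"
    and g2: "0 \<in> \<Lambda>2" "\<And>x y. x \<in> \<Lambda>2 \<Longrightarrow> y \<in> \<Lambda>2 \<Longrightarrow> x - y \<in> \<Lambda>2"
    using 1(1) 2(1) unfolding finite_index_sublattice_def by auto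
  obtain N1 where N1: "N1 > 0" "\<And>x. x \<in> std_lattice \<Longrightarrow> real N1 *\<^sub>R x \<in> \<Lambda>1"
    using finite_index_multiple[OF 1(1) std_lattice_zero std_lattice_diff] by blast
  obtain N2 where N2: "N2 > 0" "\<And>x. x \<in> std_lattice \<Longrightarrow> real N2 *\<^sub>R x \<in> \<Lambda>2"
    using finite_index_multiple[OF 2(1) std_lattice_zero std_lattice_diff] by blast
  obtain K1 where K1: "K1 > 0" "\<forall>N'. K1 dvd N' \<longrightarrow> (\<forall>l\<in>\<Lambda>1. \<forall>z\<in>\<Lambda>1.
    \<exists>P. \<forall>n. q1 (l + real (n * N') *\<^sub>R z) = poly P (real n))"
    using quasipolynomial_on_line[OF 1(2) g1] by blast
  obtain K2 where K2: "K2 > 0" "\<forall>N'. K2 dvd N' \<longrightarrow> (\<forall>l\<in>\<Lambda>2. \<forall>z\<in>\<Lambda>2.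
    \<exists>P. \<forall>n. q2 (l + real (n * N') *\<^sub>R z) = poly P (real n))"
    using quasipolynomial_on_line[OF 2(2) g2] by blast
  define e where "e = lattice_point (\<lambda>_. 1)"
  define z where "z = real (N1 * N2) *\<^sub>R e"
  have e: "e \<in> std_lattice" unfolding e_def by (rule lattice_point_std)
  have z1: "z \<in> \<Lambda>1" unfolding z_def using N1(2)[OF std_lattice_nat_scale[OF e, of N2]] by simp
  have z2: "z \<in> \<Lambda>2" unfolding z_def using N2(2)[OF std_lattice_nat_scale[OF e, of N1]] by (simp add: mult_ac)
  obtain P1 where P1: "\<And>n. q1 (0 + real (n * (K1 * K2)) *\<^sub>R z) = poly P1 (real n)"
    using K1(2)[rule_format, of "K1 * K2" 0 z] g1(1) z1 by auto
  obtain P2 where P2: "\<And>n. q2 (0 + real (n * (K1 * K2)) *\<^sub>R z) = poly P2 (real n)"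
    using K2(2)[rule_format, of "K1 * K2" 0 z] g2(1) z2 by auto
  define n0 where "n0 = nat \<lceil>\<Sum>w\<in>UNIV. \<bar>dual_coord l1 w\<bar> + \<bar>dual_coord l2 w\<bar>\<rceil>"
  have "poly P1 (real n) = poly P2 (real n)" if n: "n0 \<le> n" for n
  proof -
    let ?l = "real (n * (K1 * K2)) *\<^sub>R z"
    have big: "\<bar>dual_coord l1 w\<bar> + \<bar>dual_coord l2 w\<bar> \<le> dual_coord ?l w" for w
    proof -
      have "\<bar>dual_coord l1 w\<bar> + \<bar>dual_coord l2 w\<bar> \<le> (\<Sum>w\<in>UNIV. \<bar>dual_coord l1 w\<bar> + \<bar>dual_coord l2 w\<bar>)"
        by (rule member_le_sum) auto
      also have "\<dots> \<le> real n0" unfolding n0_def by linarith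
      also have "\<dots> \<le> real n" using n by simp
      also have "real n \<le> real (n * (K1 * K2) * (N1 * N2))"
        using K1(1) K2(1) N1(1) N2(1) by (simp only: of_nat_le_iff) (simp add: mult.assoc)
      also have "\<dots> = dual_coord ?l w" by (simp add: z_def e_def)
      finally show ?thesis .
    qed
    have "?l - l1 \<in> lipman_cone G" "?l - l2 \<in> lipman_cone G"
      unfolding lipman_cone_iff dual_coord_linear(2) using big by (smt (verit))+
    then have in1: "?l \<in> (+) l1 ` lipman_cone G" and in2: "?l \<in> (+) l2 ` lipman_cone G"
      by (auto intro: image_eqI[of _ _ "?l - l1"] image_eqI[of _ _ "?l - l2"])
    have m1: "?l \<in> \<Lambda>1" "?l \<in> \<Lambda>2"
    proof -
      have "?l = real N1 *\<^sub>R (real (n * (K1 * K2) * N2) *\<^sub>R e)" "?l = real N2 *\<^sub>R (real (n * (K1 * K2) * N1) *\<^sub>R e)"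
        by (simp_all add: z_def mult_ac)
      then show "?l \<in> \<Lambda>1" "?l \<in> \<Lambda>2" using N1(2) N2(2) std_lattice_nat_scale[OF e] by metis+
    qed
    have "q1 ?l = q2 ?l" using 1(3)[of ?l] 2(3)[of ?l] in1 in2 m1 by auto
    then show ?thesis using P1[of n] P2[of n] by simp
  qed
  then have "P1 = P2" by (rule poly_eq_if_eventually_eq)
  then show ?thesis using P1[of 0] P2[of 0] 1(4) 2(4) by simp
qed

definition pc :: real where
  "pc = periodic_constant (lipman_cone G) (Z_coeff G)"

text \<open>The constant of \<open>defect_const\<close> is the periodic constant because \<open>\<chi>(0) = 0\<close>.\<close>

lemma counting_fun_deep:
  "\<exists>l0. \<forall>l\<in>std_lattice. l - l0 \<in> lipman_cone G \<longrightarrow> counting_fun (Z_coeff G) l = chi l + pc"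
proof -
  obtain c A where cA: "\<And>l. l \<in> std_lattice \<Longrightarrow> (\<And>w. real_of_int A \<le> dual_coord l w) \<Longrightarrow>
    counting_fun (Z_coeff G) l = chi l + c"
    using defect_const by blast
  define l0 where "l0 = lattice_point (\<lambda>_. nat A)"
  have deep: "counting_fun (Z_coeff G) l = chi l + c" if "l \<in> std_lattice" "l - l0 \<in> lipman_cone G" for l
  proof (rule cA[OF that(1)])
    fix w
    have "real (nat A) \<le> dual_coord l w" using that(2) unfolding lipman_cone_iff l0_def by simp
    then show "real_of_int A \<le> dual_coord l w" by linarith
  qed
  have "has_periodic_constant (lipman_cone G) (Z_coeff G) c"
    unfolding has_periodic_constant_def
  proof (intro bexI[of _ l0] exI[of _ std_lattice] exI[of _ "\<lambda>l. chi l + c"] conjI ballI)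
    show "finite_index_sublattice std_lattice (std_lattice :: (real^'v) set)"
      by (intro finite_index_sublattice_refl std_lattice_zero std_lattice_diff)
    show "quasipolynomial_on std_lattice (\<lambda>l. chi l + c)" by (rule chi_quasipolynomial)
    show "c = chi 0 + c" by (simp add: chi_def int_form_linear)
    show "l0 \<in> lipman_cone G" unfolding l0_def lipman_cone_iff by simp
  qed (use deep in auto)
  then have "pc = c"
    unfolding pc_def periodic_constant_def using has_periodic_constant_unique by (intro the_equality)
  then show ?thesis using deep by blast
qed

text \<open>The factors of the geometric series of all ends multiplied by \<open>1 - t^E\<^sub>n\<^sup>*\<close> for every entry \<open>n\<close> of the list; this allows
  to build up \<open>Z\<close> one factor at a time.\<close>

definition numerator_series :: "'v list \<Rightarrow> 'v \<Rightarrow> real fps" where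
  "numerator_series ns w = (1 - fps_X) ^ count_list ns w * (if w \<in> ends G then geom else 1)"

lemma fps_at_one_minus_X_mult: "fps_at ((1 - fps_X) * F) i = fps_at F i - fps_at F (i - 1)"
proof (cases "i \<le> 0")
  case True
  then show ?thesis by (cases "i = 0") (auto simp: fps_at_def left_diff_distrib)
next
  case False
  then obtain n where n: "i = int (Suc n)" by (metis gr0_implies_Suc zero_less_imp_eq_int not_le)
  then have "i - 1 = int n" by simp
  then show ?thesis unfolding \<open>i - 1 = int n\<close> unfolding n fps_at_simps by (simp add: left_diff_distrib)
qed

lemma lattice_series_numerator_Cons:
  "lattice_series (numerator_series (n # ns)) l =
    lattice_series (numerator_series ns) l - lattice_series (numerator_series ns) (l - E_star G n)"
proof (cases "l \<in> std_lattice")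
  case True
  then have True': "l - E_star G n \<in> std_lattice" using std_lattice_diff E_star_std by blast
  let ?F = "numerator_series ns"
  have lc: "lcoord (l - E_star G n) w = lcoord l w - (if w = n then 1 else 0)" for w
    by (rule lcoord_eqI[OF True']) (simp add: lcoord True)
  let ?R = "\<Prod>w\<in>UNIV - {n}. fps_at (?F w) (lcoord l w)"
  have R1: "(\<Prod>w\<in>UNIV - {n}. fps_at (numerator_series (n # ns) w) (lcoord l w)) = ?R"
    by (rule prod.cong) (auto simp: numerator_series_def)
  have R2: "(\<Prod>w\<in>UNIV - {n}. fps_at (?F w) (lcoord (l - E_star G n) w)) = ?R"
    by (rule prod.cong) (auto simp: lc)
  have eq: "numerator_series (n # ns) n = (1 - fps_X) * ?F n" by (simp add: numerator_series_def mult_ac)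
  have "fps_at (numerator_series (n # ns) n) i = fps_at (?F n) i - fps_at (?F n) (i - 1)" for i
    unfolding eq by (rule fps_at_one_minus_X_mult)
  then show ?thesis
    using True True' by (simp add: lattice_series_def prod.remove[of UNIV n] R1 R2 lc left_diff_distrib)
next
  case False
  then have "l - E_star G n \<notin> std_lattice" using std_lattice_add[OF _ E_star_std[of n], of "l - E_star G n"] by auto
  then show ?thesis using False by (simp add: lattice_series_def)
qed

text \<open>Multiplication by \<open>1 - t^E\<^sub>n\<^sup>*\<close> subtracts a translate of the series by \<open>E\<^sub>n\<^sup>*\<close>, and the exponents of the translate that
  are not \<open>\<ge> l\<close> come from those of the series that are not \<open>\<ge> l - E\<^sub>n\<^sup>*\<close>.\<close>

lemma counting_fun_numerator_Cons:
  "counting_fun (lattice_series (numerator_series (n # ns))) l =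
    counting_fun (lattice_series (numerator_series ns)) l -
    counting_fun (lattice_series (numerator_series ns)) (l - E_star G n)"
proof -
  let ?p = "lattice_series (numerator_series ns)" and ?e = "E_star G n"
  let ?A = "{l'' \<in> lattice_cone. \<not> l \<le> l''}" and ?B = "{x \<in> lattice_cone. \<not> l - ?e \<le> x}"
  have le: "l - ?e \<le> x \<longleftrightarrow> l \<le> x + ?e" for x by (simp add: less_eq_vec_def algebra_simps)
  have "(\<Sum>l''\<in>?A. ?p (l'' - ?e)) = (\<Sum>x\<in>(\<lambda>l''. l'' - ?e) ` ?A. ?p x)"
    by (subst sum.reindex) (auto simp: inj_on_def)
  also have "\<dots> = (\<Sum>x\<in>?B. ?p x)"
  proof (rule sum.mono_neutral_right)
    show "finite ((\<lambda>l''. l'' - ?e) ` ?A)" by (intro finite_imageI finite_not_above)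
    show "?B \<subseteq> (\<lambda>l''. l'' - ?e) ` ?A"
    proof
      fix x assume x: "x \<in> ?B"
      then have "x + ?e \<in> ?A" using le std_lattice_add E_star_std by (auto simp: lattice_cone_def)
      then show "x \<in> (\<lambda>l''. l'' - ?e) ` ?A" by (intro image_eqI[of _ _ "x + ?e"]) auto
    qed
    show "\<forall>x\<in>(\<lambda>l''. l'' - ?e) ` ?A - ?B. ?p x = 0"
      using lattice_series_nonzero[of "numerator_series ns"] le by auto
  qed
  finally show ?thesis
    unfolding counting_fun_lattice_series lattice_series_numerator_Cons by (simp add: sum_subtractf)
qed

text \<open>Without numerator the coefficients are 1 on the combinations of the \<open>E\<^sub>e\<^sup>*\<close> of the ends with coefficients in
  \<open>\<nat>\<close> and 0 elsewhere.\<close>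

lemma counting_fun_numerator_Nil:
  "counting_fun (lattice_series (numerator_series [])) l = real (ehrhart_count G l)"
proof -
  let ?p = "lattice_series (numerator_series [])"
  let ?A = "{l'' \<in> lattice_cone. \<not> l \<le> l''}"
  let ?X = "{x \<in> ends G \<rightarrow>\<^sub>E (UNIV :: nat set). \<not> l \<le> (\<Sum>e\<in>ends G. of_nat (x e) *\<^sub>R E_star G e)}"
  let ?h = "\<lambda>x. \<Sum>e\<in>ends G. real (x e) *\<^sub>R E_star G e"
  have dc: "dual_coord (?h x) w = (if w \<in> ends G then real (x w) else 0)" for x w
    by (simp add: if_distrib[of "\<lambda>t. _ * t"] cong: if_cong)
  have inj: "inj_on ?h ?X"
  proof (rule inj_onI)
    fix x y assume xy: "x \<in> ?X" "y \<in> ?X" "?h x = ?h y"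
    have "x w = y w" for w
      using dc[of x w] dc[of y w] xy by (cases "w \<in> ends G") (auto simp: PiE_def extensional_def)
    then show "x = y" by blast
  qed
  have p: "?p l'' = (if \<forall>w. w \<notin> ends G \<longrightarrow> lcoord l'' w = 0 then 1 else 0)" if l'': "l'' \<in> lattice_cone" for l''
  proof -
    have nn: "0 \<le> lcoord l'' w" for w using l'' unfolding lattice_cone_def lcoord_def by simp
    have "fps_at (numerator_series [] w) (lcoord l'' w) =
      (if w \<notin> ends G \<longrightarrow> lcoord l'' w = 0 then 1 else 0)" for w
      using nn[of w] by (auto simp: fps_at_def numerator_series_def nat_eq_iff)
    then have "?p l'' = (\<Prod>w\<in>UNIV. if w \<notin> ends G \<longrightarrow> lcoord l'' w = 0 then 1 else 0)"
      using l'' by (simp add: lattice_series_def lattice_cone_def)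
    then show ?thesis by (auto simp: prod_zero_iff)
  qed
  have img: "?h ` ?X = {l'' \<in> ?A. \<forall>w. w \<notin> ends G \<longrightarrow> lcoord l'' w = 0}"
  proof (intro set_eqI iffI)
    fix l'' assume "l'' \<in> ?h ` ?X"
    then obtain x where x: "x \<in> ?X" "l'' = ?h x" by blast
    have "?h x \<in> std_lattice" by (intro std_lattice_sum std_lattice_nat_scale E_star_std)
    then show "l'' \<in> {l'' \<in> ?A. \<forall>w. w \<notin> ends G \<longrightarrow> lcoord l'' w = 0}"
      using x dc by (auto simp: lattice_cone_def lcoord_def simp del: dual_coord_sum)
  next
    fix l'' assume l'': "l'' \<in> {l'' \<in> ?A. \<forall>w. w \<notin> ends G \<longrightarrow> lcoord l'' w = 0}"
    define x where "x = (\<lambda>e\<in>ends G. nat (lcoord l'' e))"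
    have std: "l'' \<in> std_lattice" using l'' by (simp add: lattice_cone_def)
    have "?h x = l''"
    proof (rule dual_coord_inject)
      fix w
      have "0 \<le> lcoord l'' w" using l'' unfolding lattice_cone_def lcoord_def by simp
      then show "dual_coord (?h x) w = dual_coord l'' w"
        unfolding dc using l'' lcoord[OF std, of w] by (auto simp: x_def of_nat_nat)
    qed
    moreover have "x \<in> ?X" using calculation l'' unfolding x_def by auto
    ultimately show "l'' \<in> ?h ` ?X" by blast
  qed
  have "counting_fun ?p l = (\<Sum>l''\<in>?A. if \<forall>w. w \<notin> ends G \<longrightarrow> lcoord l'' w = 0 then 1 else 0)"
    unfolding counting_fun_lattice_series by (rule sum.cong) (auto simp: p)
  also have "\<dots> = (\<Sum>l''\<in>?h ` ?X. 1)"
    unfolding img by (rule sum.inter_filter[symmetric]) (rule finite_not_above)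
  also have "\<dots> = real (card ?X)" using card_image[OF inj] by simp
  finally show ?thesis unfolding ehrhart_count_def by simp
qed

lemma counting_fun_numerator:
  "counting_fun (lattice_series (numerator_series ns)) l =
    iter_diff (map (E_star G) ns) (\<lambda>l. real (ehrhart_count G l)) l"
  by (induction ns arbitrary: l) (simp_all add: counting_fun_numerator_Nil counting_fun_numerator_Cons)

lemma counting_fun_Z_coeff:
  assumes "\<And>w. count_list ns w = (if w \<in> nodes G then valency G w - 2 else 0)"
  shows "counting_fun (Z_coeff G) l = iter_diff (map (E_star G) ns) (\<lambda>l. real (ehrhart_count G l)) l"
proof -
  have "vertex_series (valency G w) = numerator_series ns w" for w
    using valency_pos[of w] assms[of w]
    by (auto simp: vertex_series_def numerator_series_def nodes_def ends_def)
  then have "Z_coeff G = lattice_series (numerator_series ns)"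
    unfolding Z_coeff_eq by presburger
  then show ?thesis by (simp add: counting_fun_numerator)
qed

end

section \<open>The difference equation of the Ehrhart quasipolynomial\<close>

locale ehrhart_chamber = unimodular_plumbing_tree G
  for G :: "('v::finite) plumbing_graph" +
  fixes C :: "(real^'v) set" and \<L> :: "real^'v \<Rightarrow> real"
  assumes chamber: "chamber G C"
    and interior_nonempty: "interior (C \<inter> lipman_cone G) \<noteq> {}"
    and ehrhart: "ehrhart_quasipolynomial G C \<L>"
begin

definition lipman_chamber :: "(real^'v) set" where
  "lipman_chamber = C \<inter> lipman_cone G"

lemma lipman_chamber_scale:
  assumes x: "x \<in> lipman_chamber" and c: "0 < c"
  shows "c *\<^sub>R x \<in> lipman_chamber"
proof -
  obtain x0 where C: "C = \<Inter>{\<sigma> \<in> basis_cones G. x0 \<in> \<sigma>}" using chamber unfolding chamber_def by blast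
  have cone: "c *\<^sub>R x \<in> \<sigma>" if \<sigma>: "\<sigma> \<in> basis_cones G" "x \<in> \<sigma>" for \<sigma>
  proof -
    obtain B where "\<sigma> = convex_cone hull B" using \<sigma>(1) unfolding basis_cones_def by auto
    then show ?thesis using convex_cone_hull_mul[of x B c] \<sigma>(2) c by simp
  qed
  have "x \<in> C" "x \<in> lipman_cone G" using x unfolding lipman_chamber_def by simp_all
  then have "c *\<^sub>R x \<in> C" unfolding C using cone by simp
  moreover have "c *\<^sub>R x \<in> lipman_cone G"
    using \<open>x \<in> lipman_cone G\<close> c by (simp add: lipman_cone_iff)
  ultimately show ?thesis unfolding lipman_chamber_def by simp
qed

text \<open>\<open>x + j z\<close> is \<open>j\<close> times a point that tends to \<open>z\<close>, and the set is closed under multiplication by positive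
  numbers.\<close>

lemma interior_absorbs_line:
  assumes "z \<in> interior lipman_chamber"
  shows "\<exists>j0. \<forall>j\<ge>j0. x + real j *\<^sub>R z \<in> interior lipman_chamber"
proof -
  obtain e where e: "e > 0" "ball z e \<subseteq> lipman_chamber" using assms unfolding mem_interior by blast
  define j0 where "j0 = Suc (nat \<lceil>2 * norm x / e\<rceil>)"
  have "x + real j *\<^sub>R z \<in> interior lipman_chamber" if j: "j0 \<le> j" for j
  proof -
    have jpos: "0 < real j" using j unfolding j0_def by simp
    have "2 * norm x / e \<le> real j" using j unfolding j0_def by linarith
    then have nx: "norm x \<le> real j * e / 2" using e(1) by (simp add: field_simps)
    have "ball (x + real j *\<^sub>R z) (real j * e / 2) \<subseteq> lipman_chamber"
    proof
      fix p assume "p \<in> ball (x + real j *\<^sub>R z) (real j * e / 2)"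
      then have p: "norm (x + real j *\<^sub>R z - p) < real j * e / 2" by (simp add: dist_norm)
      have "norm (real j *\<^sub>R z - p) \<le> norm (x + real j *\<^sub>R z - p) + norm x"
        using norm_triangle_ineq4[of "x + real j *\<^sub>R z - p" x] by simp
      then have "norm (real j *\<^sub>R z - p) < real j * e" using p nx by simp
      moreover have "real j *\<^sub>R z - p = real j *\<^sub>R (z - (1 / real j) *\<^sub>R p)"
        using jpos by (simp add: algebra_simps)
      ultimately have "norm (z - (1 / real j) *\<^sub>R p) < e" using jpos by simp
      then have "(1 / real j) *\<^sub>R p \<in> lipman_chamber" using e(2) by (auto simp: dist_norm)
      from lipman_chamber_scale[OF this jpos] show "p \<in> lipman_chamber" using jpos by simp
    qed
    then show ?thesis unfolding mem_interior using jpos e(1) by (intro exI[of _ "real j * e / 2"]) auto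
  qed
  then show ?thesis by blast
qed

text \<open>Rounding a large multiple of an interior point moves it by a bounded amount, while the distance to the
  boundary grows.\<close>

lemma lattice_point_in_interior: "\<exists>z \<in> std_lattice. z \<in> interior lipman_chamber"
proof -
  obtain x0 where "x0 \<in> interior lipman_chamber" using interior_nonempty unfolding lipman_chamber_def by blast
  then obtain e where e: "e > 0" "ball x0 e \<subseteq> lipman_chamber" unfolding mem_interior by blast
  define k where "k = Suc (nat \<lceil>2 * real CARD('v) / e\<rceil>)"
  have kpos: "0 < real k" unfolding k_def by simp
  have "2 * real CARD('v) / e \<le> real k" unfolding k_def by linarith
  then have ke: "real CARD('v) \<le> real k * e / 2" using e(1) by (simp add: field_simps)
  define z :: "real^'v" where "z = (\<chi> v. of_int \<lfloor>real k * x0 $ v\<rfloor>)"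
  have "norm (real k *\<^sub>R x0 - z) \<le> (\<Sum>v\<in>UNIV. \<bar>(real k *\<^sub>R x0 - z) $ v\<bar>)"
    by (rule norm_le_l1_cart)
  also have "\<dots> \<le> (\<Sum>v\<in>(UNIV :: 'v set). 1)"
    by (rule sum_mono) (simp add: z_def, linarith)
  finally have near: "norm (real k *\<^sub>R x0 - z) \<le> real CARD('v)" by simp
  have "ball z (real k * e / 2) \<subseteq> lipman_chamber"
  proof
    fix p assume "p \<in> ball z (real k * e / 2)"
    then have p: "norm (z - p) < real k * e / 2" by (simp add: dist_norm)
    have "norm (real k *\<^sub>R x0 - p) \<le> norm (real k *\<^sub>R x0 - z) + norm (z - p)"
      using norm_triangle_ineq[of "real k *\<^sub>R x0 - z" "z - p"] by simp
    then have "norm (real k *\<^sub>R x0 - p) < real k * e" using p near ke by simp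
    moreover have "real k *\<^sub>R x0 - p = real k *\<^sub>R (x0 - (1 / real k) *\<^sub>R p)"
      using kpos by (simp add: algebra_simps)
    ultimately have "norm (x0 - (1 / real k) *\<^sub>R p) < e" using kpos by simp
    then have "(1 / real k) *\<^sub>R p \<in> lipman_chamber" using e(2) by (auto simp: dist_norm)
    from lipman_chamber_scale[OF this kpos] show "p \<in> lipman_chamber" using kpos by simp
  qed
  then have "z \<in> interior lipman_chamber" unfolding mem_interior
    using kpos e(1) by (intro exI[of _ "real k * e / 2"]) auto
  moreover have "z \<in> std_lattice" unfolding z_def std_lattice_def by simp
  ultimately show ?thesis by blast
qed

lemma \<L>_eq_count: "l \<in> lipman_chamber \<Longrightarrow> l \<in> std_lattice \<Longrightarrow> \<L> l = real (ehrhart_count G l)"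
  using ehrhart unfolding ehrhart_quasipolynomial_def lipman_chamber_def by blast

lemma quasi_\<L>: "quasipolynomial_on std_lattice \<L>"
  using ehrhart unfolding ehrhart_quasipolynomial_def by (rule conjunct1)

lemma iter_diff_eventually_count:
  assumes z: "z \<in> std_lattice" "z \<in> interior lipman_chamber" and ss: "set ss \<subseteq> std_lattice" and l: "l \<in> std_lattice"
  shows "\<exists>n0. \<forall>n\<ge>n0. iter_diff ss \<L> (l + real n *\<^sub>R z) =
    iter_diff ss (\<lambda>l. real (ehrhart_count G l)) (l + real n *\<^sub>R z)"
  using ss l
proof (induction ss arbitrary: l)
  case Nil
  obtain n0 where n0: "\<And>n. n0 \<le> n \<Longrightarrow> l + real n *\<^sub>R z \<in> interior lipman_chamber"
    using interior_absorbs_line[OF z(2)] by blast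
  have "\<L> (l + real n *\<^sub>R z) = real (ehrhart_count G (l + real n *\<^sub>R z))" if "n0 \<le> n" for n
    using n0[OF that] interior_subset[of lipman_chamber] Nil(2) z(1)
    by (intro \<L>_eq_count) (auto intro: std_lattice_add std_lattice_nat_scale)
  then show ?case by (auto intro!: exI[of _ n0])
next
  case (Cons s ss)
  then have s: "l - s \<in> std_lattice" and ss': "set ss \<subseteq> std_lattice" using std_lattice_diff by auto
  obtain n1 where n1: "\<forall>n\<ge>n1. iter_diff ss \<L> (l + real n *\<^sub>R z) =
    iter_diff ss (\<lambda>l. real (ehrhart_count G l)) (l + real n *\<^sub>R z)"
    using Cons.IH[OF ss' Cons.prems(2)] by blast
  obtain n2 where n2: "\<forall>n\<ge>n2. iter_diff ss \<L> (l - s + real n *\<^sub>R z) =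
    iter_diff ss (\<lambda>l. real (ehrhart_count G l)) (l - s + real n *\<^sub>R z)"
    using Cons.IH[OF ss' s] by blast
  have eq: "l + real n *\<^sub>R z - s = l - s + real n *\<^sub>R z" for n by simp
  show ?case
  proof (intro exI[of _ "max n1 n2"] allI impI)
    fix n assume "max n1 n2 \<le> n"
    then show "iter_diff (s # ss) \<L> (l + real n *\<^sub>R z) =
      iter_diff (s # ss) (\<lambda>l. real (ehrhart_count G l)) (l + real n *\<^sub>R z)"
      using n1 n2 unfolding iter_diff.simps eq by simp
  qed
qed

lemma iter_diff_on_line:
  assumes f: "\<forall>l\<in>std_lattice. \<exists>P. \<forall>n. f (l + real (n * N) *\<^sub>R z) = poly P (real n)"
    and ss: "set ss \<subseteq> std_lattice" and l: "(l :: real^'v) \<in> std_lattice"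
  shows "\<exists>P. \<forall>n. iter_diff ss f (l + real (n * N) *\<^sub>R z) = poly P (real n)"
  using ss l
proof (induction ss arbitrary: l)
  case Nil
  then show ?case using f by simp
next
  case (Cons s ss)
  then have s: "l - s \<in> std_lattice" and ss': "set ss \<subseteq> std_lattice" using std_lattice_diff by auto
  obtain P1 where P1: "\<And>n. iter_diff ss f (l + real (n * N) *\<^sub>R z) = poly P1 (real n)"
    using Cons.IH[OF ss' Cons.prems(2)] by blast
  obtain P2 where P2: "\<And>n. iter_diff ss f (l - s + real (n * N) *\<^sub>R z) = poly P2 (real n)"
    using Cons.IH[OF ss' s] by blast
  have eq: "l + real (n * N) *\<^sub>R z - s = l - s + real (n * N) *\<^sub>R z" for n by simp
  show ?case
    by (intro exI[of _ "P1 - P2"] allI) (simp only: iter_diff.simps eq P1 P2 poly_diff)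
qed

text \<open>Far out in the chamber both sides are the counting function of the series; along a line whose
  step is a common period they are polynomials, hence they agree everywhere.\<close>

lemma iter_diff_\<L>:
  assumes ns: "\<And>w. count_list ns w = (if w \<in> nodes G then valency G w - 2 else 0)"
    and l: "l \<in> std_lattice"
  shows "iter_diff (map (E_star G) ns) \<L> l = chi l + pc"
proof -
  let ?ss = "map (E_star G) ns"
  have ss: "set ?ss \<subseteq> std_lattice" using E_star_std by auto
  obtain z where z: "z \<in> std_lattice" "z \<in> interior lipman_chamber" using lattice_point_in_interior by blast
  obtain N1 where N1: "N1 > 0" "\<forall>N'. N1 dvd N' \<longrightarrow> (\<forall>l\<in>std_lattice. \<forall>z\<in>std_lattice.
    \<exists>P. \<forall>n. \<L> (l + real (n * N') *\<^sub>R z) = poly P (real n))"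
    using quasipolynomial_on_line[OF quasi_\<L> std_lattice_zero std_lattice_diff] by blast
  obtain N2 where N2: "N2 > 0" "\<forall>N'. N2 dvd N' \<longrightarrow> (\<forall>l\<in>std_lattice. \<forall>z\<in>std_lattice.
    \<exists>P. \<forall>n. chi (l + real (n * N') *\<^sub>R z) + pc = poly P (real n))"
    using quasipolynomial_on_line[OF chi_quasipolynomial[of pc] std_lattice_zero std_lattice_diff] by blast
  define N where "N = N1 * N2"
  have Npos: "N > 0" using N1(1) N2(1) by (simp add: N_def)
  have "\<forall>l\<in>std_lattice. \<exists>P. \<forall>n. \<L> (l + real (n * N) *\<^sub>R z) = poly P (real n)"
    using N1(2)[rule_format, of N _ z] z(1) by (auto simp: N_def)
  then obtain P where P: "\<And>n. iter_diff ?ss \<L> (l + real (n * N) *\<^sub>R z) = poly P (real n)"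
    using iter_diff_on_line[OF _ ss l] by blast
  obtain R where R: "\<And>n. chi (l + real (n * N) *\<^sub>R z) + pc = poly R (real n)"
    using N2(2)[rule_format, of N l z] z(1) l by (auto simp: N_def)
  obtain n1 where n1: "\<And>n. n1 \<le> n \<Longrightarrow> iter_diff ?ss \<L> (l + real n *\<^sub>R z) =
    iter_diff ?ss (\<lambda>l. real (ehrhart_count G l)) (l + real n *\<^sub>R z)"
    using iter_diff_eventually_count[OF z ss l] by blast
  obtain l0 where l0: "\<And>l. l \<in> std_lattice \<Longrightarrow> l - l0 \<in> lipman_cone G \<Longrightarrow>
    counting_fun (Z_coeff G) l = chi l + pc"
    using counting_fun_deep by blast
  obtain n2 where n2: "\<And>n. n2 \<le> n \<Longrightarrow> l - l0 + real n *\<^sub>R z \<in> interior lipman_chamber"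
    using interior_absorbs_line[OF z(2)] by blast
  have "poly P (real n) = poly R (real n)" if n: "n1 + n2 \<le> n" for n
  proof -
    have nN: "n1 \<le> n * N" "n2 \<le> n * N"
      using n Npos by (metis add_leD1 add_leD2 le_trans mult_le_mono2 nat_mult_1_right Suc_leI One_nat_def)+
    let ?l = "l + real (n * N) *\<^sub>R z"
    have std: "?l \<in> std_lattice" by (intro std_lattice_add std_lattice_nat_scale l z)
    have "l - l0 + real (n * N) *\<^sub>R z \<in> lipman_chamber" using n2[OF nN(2)] interior_subset by blast
    then have deep: "?l - l0 \<in> lipman_cone G" unfolding lipman_chamber_def by (simp add: algebra_simps)
    have "poly P (real n) = counting_fun (Z_coeff G) ?l"
      unfolding P[symmetric] n1[OF nN(1)] counting_fun_Z_coeff[OF ns] ..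
    also have "\<dots> = chi ?l + pc" by (rule l0[OF std deep])
    finally show ?thesis unfolding R .
  qed
  then have "P = R" by (rule poly_eq_if_eventually_eq)
  then show ?thesis using P[of 0] R[of 0] by simp
qed

text \<open>If \<open>\<Sum> x\<^sub>e E\<^sub>e\<^sup>*\<close> is smaller than \<open>l\<close> in some coordinate, all \<open>x\<^sub>e\<close> are smaller than that coordinate of \<open>l\<close>.
  This leaves as many degrees of freedom as there are ends.\<close>

lemma ehrhart_count_bound:
  "real (ehrhart_count G l) \<le> ((\<Sum>v\<in>UNIV. \<bar>l $ v\<bar>) + 1) ^ card (ends G)"
proof -
  define B where "B = nat \<lfloor>\<Sum>v\<in>UNIV. \<bar>l $ v\<bar>\<rfloor>"
  let ?X = "{x \<in> ends G \<rightarrow>\<^sub>E (UNIV :: nat set). \<not> l \<le> (\<Sum>e\<in>ends G. of_nat (x e) *\<^sub>R E_star G e)}"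
  have "?X \<subseteq> ends G \<rightarrow>\<^sub>E {..B}"
  proof
    fix x assume x: "x \<in> ?X"
    let ?s = "\<Sum>e\<in>ends G. real (x e) *\<^sub>R E_star G e"
    obtain v where v: "?s $ v < l $ v" using x by (auto simp: less_eq_vec_def not_le)
    have dc: "dual_coord ?s w = (if w \<in> ends G then real (x w) else 0)" for w
      by (simp add: if_distrib[of "\<lambda>t. _ * t"] cong: if_cong)
    have "x e \<le> B" if "e \<in> ends G" for e
    proof -
      have "real (x e) \<le> ?s $ v" using dual_coord_le_coord[of ?s e v] dc that by simp
      also have "\<dots> \<le> \<bar>l $ v\<bar>" using v by simp
      also have "\<dots> \<le> (\<Sum>v\<in>UNIV. \<bar>l $ v\<bar>)" by (rule member_le_sum) auto
      finally show ?thesis unfolding B_def by (simp add: le_nat_floor)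
    qed
    then show "x \<in> ends G \<rightarrow>\<^sub>E {..B}" using x by auto
  qed
  then have "card ?X \<le> card (ends G \<rightarrow>\<^sub>E {..B})" by (intro card_mono finite_PiE) auto
  also have "\<dots> = (B + 1) ^ card (ends G)" by (simp add: card_PiE)
  finally have "real (ehrhart_count G l) \<le> real ((B + 1) ^ card (ends G))"
    unfolding ehrhart_count_def of_nat_le_iff .
  also have "\<dots> = (real B + 1) ^ card (ends G)" by (simp add: add.commute)
  also have "\<dots> \<le> ((\<Sum>v\<in>UNIV. \<bar>l $ v\<bar>) + 1) ^ card (ends G)"
    by (intro power_mono) (auto simp: B_def intro: sum_nonneg)
  finally show ?thesis .
qed

end

section \<open>The degree of the Ehrhart quasipolynomial\<close>

lemma tendsto_monomial_on_line:
  fixes x y :: "real^'v::finite"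
  assumes "(\<Sum>v\<in>UNIV. m v) \<le> D"
  shows "(\<lambda>n. (\<Prod>v\<in>UNIV. (x $ v + real n * y $ v) ^ m v) / real n ^ D)
    \<longlonglongrightarrow> (if (\<Sum>v\<in>UNIV. m v) = D then \<Prod>v\<in>UNIV. y $ v ^ m v else 0)"
proof -
  define s where "s = (\<Sum>v\<in>UNIV. m v)"
  have inv: "(\<lambda>n. 1 / real n) \<longlonglongrightarrow> 0" by (rule lim_1_over_n)
  have "(\<lambda>n. x $ v * (1 / real n) + y $ v) \<longlonglongrightarrow> x $ v * 0 + y $ v" for v
    by (intro tendsto_intros inv)
  then have "(\<lambda>n. (\<Prod>v\<in>UNIV. (x $ v * (1 / real n) + y $ v) ^ m v) * (1 / real n) ^ (D - s))
    \<longlonglongrightarrow> (\<Prod>v\<in>UNIV. y $ v ^ m v) * 0 ^ (D - s)"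
    by (intro tendsto_intros inv) simp
  moreover have "(\<Prod>v\<in>UNIV. y $ v ^ m v) * 0 ^ (D - s) = (if s = D then \<Prod>v\<in>UNIV. y $ v ^ m v else 0)"
    using assms unfolding s_def[symmetric] by auto
  moreover have "eventually (\<lambda>n. (\<Prod>v\<in>UNIV. (x $ v * (1 / real n) + y $ v) ^ m v) * (1 / real n) ^ (D - s) =
    (\<Prod>v\<in>UNIV. (x $ v + real n * y $ v) ^ m v) / real n ^ D) sequentially"
    using eventually_gt_at_top[of 0]
  proof eventually_elim
    case (elim n)
    have "x $ v * (1 / real n) + y $ v = (x $ v + real n * y $ v) / real n" for v
      using elim by (simp add: field_simps)
    then have "(\<Prod>v\<in>UNIV. (x $ v * (1 / real n) + y $ v) ^ m v) =
      (\<Prod>v\<in>UNIV. (x $ v + real n * y $ v) ^ m v) / real n ^ s"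
      by (simp add: power_divide prod_dividef s_def power_sum)
    moreover have "real n ^ D = real n ^ s * real n ^ (D - s)"
      using assms unfolding s_def[symmetric] by (simp flip: power_add)
    ultimately show ?case by (simp add: power_divide)
  qed
  ultimately show ?thesis unfolding s_def[symmetric]
    by (simp only:) (rule Lim_transform_eventually)
qed

context ehrhart_chamber
begin

text \<open>Descending induction on the degree \<open>D\<close>. With the higher parts gone, the part of degree \<open>D\<close> is the limit of
  \<open>\<L>(l + n N y)/n^D\<close>, and for \<open>y\<close> in the interior of the chamber this limit is 0 because \<open>\<L>\<close>
  is the Ehrhart count there, whose order in \<open>n\<close> is at most the number of ends. Every lattice point \<open>x\<close> is reached from the interior along
  the line \<open>x + j z\<close>, on which the part of degree \<open>D\<close> is a polynomial in \<open>j\<close>.\<close>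

lemma \<L>_homogeneous_part_zero:
  assumes M: "finite M" and N: "N > 0"
    and per: "\<And>m l x. m \<in> M \<Longrightarrow> l \<in> std_lattice \<Longrightarrow> x \<in> std_lattice \<Longrightarrow> c m (l + real N *\<^sub>R x) = c m l"
    and eq: "\<And>l. l \<in> std_lattice \<Longrightarrow> \<L> l = (\<Sum>m\<in>M. c m l * (\<Prod>v\<in>UNIV. (l $ v) ^ m v))"
    and D: "card (ends G) < D" and l: "l \<in> std_lattice" and x: "x \<in> std_lattice"
  shows "(\<Sum>m | m \<in> M \<and> (\<Sum>v\<in>UNIV. m v) = D. c m l * (\<Prod>v\<in>UNIV. (x $ v) ^ m v)) = 0"
proof -
  define H where "H D l x = (\<Sum>m | m \<in> M \<and> (\<Sum>v\<in>UNIV. m v) = D. c m l * (\<Prod>v\<in>UNIV. (x $ v) ^ m v))"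
    for D l and x :: "real^'v"
  define D0 where "D0 = Max (insert 0 ((\<lambda>m. \<Sum>v\<in>UNIV. m v) ` M))"
  have D0: "(\<Sum>v\<in>UNIV. m v) \<le> D0" if "m \<in> M" for m
    unfolding D0_def using M that by (intro Max_ge) auto
  have "H D l x = 0" if "card (ends G) < D" "l \<in> std_lattice" "x \<in> std_lattice" for D l x
    using that
  proof (induction "D0 - D" arbitrary: D l x rule: less_induct)
    case less
    show ?case
    proof (cases "D0 < D")
      case True
      then have none: "{m. m \<in> M \<and> (\<Sum>v\<in>UNIV. m v) = D} = {}" using D0 by fastforce
      show ?thesis unfolding H_def none by simp
    next
      case False
      have higher: "H D' l x = 0" if "D < D'" "l \<in> std_lattice" "x \<in> std_lattice" for D' l x
      proof (cases "D' \<le> D0")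
        case True
        then show ?thesis using less(1)[of D' l x] that less(2) by auto
      next
        case False
        then have none: "{m. m \<in> M \<and> (\<Sum>v\<in>UNIV. m v) = D'} = {}" using D0 by fastforce
        show ?thesis unfolding H_def none by simp
      qed
      have inner: "H D l y = 0" if y: "y \<in> std_lattice" "y \<in> interior lipman_chamber" for y
      proof -
        let ?p = "\<lambda>n. l + real n *\<^sub>R (real N *\<^sub>R y)"
        let ?M = "{m \<in> M. (\<Sum>v\<in>UNIV. m v) \<le> D}"
        have std: "?p n \<in> std_lattice" for n
          by (intro std_lattice_add std_lattice_nat_scale less y)
        have c_eq: "c m (?p n) = c m l" if "m \<in> M" for m n
        proof -
          have "real n *\<^sub>R (real N *\<^sub>R y) = real N *\<^sub>R (real n *\<^sub>R y)" by (simp add: mult.commute)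
          then show ?thesis using per[OF that less(3) std_lattice_nat_scale[OF y(1), of n]] by (simp only:)
        qed
        have L: "\<L> (?p n) = (\<Sum>m\<in>?M. c m l * (\<Prod>v\<in>UNIV. (?p n $ v) ^ m v))" for n
        proof -
          let ?t = "\<lambda>m. c m l * (\<Prod>v\<in>UNIV. (?p n $ v) ^ m v)"
          have "\<L> (?p n) = (\<Sum>m\<in>M. ?t m)"
            unfolding eq[OF std] by (rule sum.cong[OF refl]) (simp only: c_eq)
          also have "\<dots> = (\<Sum>m\<in>?M. ?t m) + (\<Sum>m\<in>M - ?M. ?t m)"
            using sum.subset_diff[of ?M M ?t] M by (simp add: add.commute)
          also have "(\<Sum>m\<in>M - ?M. ?t m) = (\<Sum>D'\<in>{D<..D0}. \<Sum>m | m \<in> M - ?M \<and> (\<Sum>v\<in>UNIV. m v) = D'. ?t m)"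
            by (rule sum.group[symmetric]) (use M D0 in auto)
          also have "\<dots> = (\<Sum>D'\<in>{D<..D0}. H D' l (?p n))"
            unfolding H_def by (intro sum.cong refl) auto
          also have "\<dots> = 0"
            using higher[OF _ less(3) std] by simp
          finally show ?thesis by simp
        qed
        have "(\<lambda>n. \<Sum>m\<in>?M. c m l * ((\<Prod>v\<in>UNIV. (l $ v + real n * (real N *\<^sub>R y) $ v) ^ m v) / real n ^ D))
          \<longlonglongrightarrow> (\<Sum>m\<in>?M. c m l * (if (\<Sum>v\<in>UNIV. m v) = D then \<Prod>v\<in>UNIV. ((real N *\<^sub>R y) $ v) ^ m v else 0))"
          by (intro tendsto_intros tendsto_monomial_on_line) auto
        moreover have "(\<Sum>m\<in>?M. c m l * ((\<Prod>v\<in>UNIV. (l $ v + real n * (real N *\<^sub>R y) $ v) ^ m v) / real n ^ D)) =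
          \<L> (?p n) / real n ^ D" for n
          unfolding L by (simp add: sum_divide_distrib mult.assoc)
        moreover have "(\<Sum>m\<in>?M. c m l * (if (\<Sum>v\<in>UNIV. m v) = D then \<Prod>v\<in>UNIV. ((real N *\<^sub>R y) $ v) ^ m v else 0)) =
          H D l (real N *\<^sub>R y)"
          unfolding H_def using M
          by (intro sum.mono_neutral_cong_right) auto
        ultimately have lim: "(\<lambda>n. \<L> (?p n) / real n ^ D) \<longlonglongrightarrow> H D l (real N *\<^sub>R y)" by simp
        define b where "b = (\<Sum>v\<in>UNIV. \<bar>l $ v\<bar>) + (\<Sum>v\<in>UNIV. \<bar>(real N *\<^sub>R y) $ v\<bar>) + 1"
        obtain n0 where n0: "\<And>n. n0 \<le> n \<Longrightarrow> l + real n *\<^sub>R y \<in> interior lipman_chamber"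
          using interior_absorbs_line[OF y(2)] by blast
        have bound: "\<bar>\<L> (?p n) / real n ^ D\<bar> \<le> b ^ card (ends G) * (1 / real n)" if n: "Suc n0 \<le> n" for n
        proof -
          have "n0 \<le> n * N" using n N by (metis Suc_leD le_trans mult.right_neutral mult_le_mono2 Suc_leI One_nat_def)
          then have "l + real (n * N) *\<^sub>R y \<in> lipman_chamber" using n0 interior_subset by blast
          then have "?p n \<in> lipman_chamber" by simp
          then have Lc: "\<L> (?p n) = real (ehrhart_count G (?p n))" by (rule \<L>_eq_count[OF _ std])
          have n1: "1 \<le> real n" using n by simp
          have "(\<Sum>v\<in>UNIV. \<bar>?p n $ v\<bar>) \<le> (\<Sum>v\<in>UNIV. \<bar>l $ v\<bar> + real n * \<bar>(real N *\<^sub>R y) $ v\<bar>)"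
          proof (rule sum_mono)
            fix v show "\<bar>?p n $ v\<bar> \<le> \<bar>l $ v\<bar> + real n * \<bar>(real N *\<^sub>R y) $ v\<bar>"
              using abs_triangle_ineq[of "l $ v" "real n * (real N *\<^sub>R y) $ v"] by (simp add: abs_mult mult.assoc)
          qed
          also have "\<dots> = (\<Sum>v\<in>UNIV. \<bar>l $ v\<bar>) + real n * (\<Sum>v\<in>UNIV. \<bar>(real N *\<^sub>R y) $ v\<bar>)"
            by (simp only: sum.distrib sum_distrib_left)
          also have "\<dots> + 1 \<le> real n * b"
          proof -
            have "0 \<le> (\<Sum>v\<in>UNIV. \<bar>l $ v\<bar>)" by (intro sum_nonneg) simp
            then have "1 * ((\<Sum>v\<in>UNIV. \<bar>l $ v\<bar>) + 1) \<le> real n * ((\<Sum>v\<in>UNIV. \<bar>l $ v\<bar>) + 1)"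
              using n1 by (intro mult_right_mono) auto
            then show ?thesis unfolding b_def by (simp add: distrib_left)
          qed
          finally have le: "(\<Sum>v\<in>UNIV. \<bar>?p n $ v\<bar>) + 1 \<le> real n * b" by simp
          have bpos: "0 \<le> b" unfolding b_def by (intro add_nonneg_nonneg sum_nonneg) auto
          have "\<L> (?p n) \<le> ((\<Sum>v\<in>UNIV. \<bar>?p n $ v\<bar>) + 1) ^ card (ends G)"
            unfolding Lc by (rule ehrhart_count_bound)
          also have "\<dots> \<le> (real n * b) ^ card (ends G)"
            by (rule power_mono[OF le]) (intro add_nonneg_nonneg sum_nonneg, auto)
          also have "\<dots> = b ^ card (ends G) * real n ^ card (ends G)" by (simp add: power_mult_distrib)
          also have "\<dots> \<le> b ^ card (ends G) * real n ^ (D - 1)"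
            using n1 less(2) bpos by (intro mult_left_mono power_increasing) auto
          finally have "\<L> (?p n) / real n ^ D \<le> b ^ card (ends G) * real n ^ (D - 1) / real n ^ D"
            by (intro divide_right_mono) auto
          also have "\<dots> = b ^ card (ends G) * (1 / real n)"
            using n1 less(2) by (cases D) (auto simp: field_simps)
          finally show ?thesis unfolding Lc by simp
        qed
        have "(\<lambda>n. b ^ card (ends G) * (1 / real n)) \<longlonglongrightarrow> b ^ card (ends G) * 0"
          by (intro tendsto_intros lim_1_over_n)
        then have null: "(\<lambda>n. b ^ card (ends G) * (1 / real n)) \<longlonglongrightarrow> 0" by (simp only: mult_zero_right)
        have "eventually (\<lambda>n. norm (\<L> (?p n) / real n ^ D) \<le> b ^ card (ends G) * (1 / real n)) sequentially"
          unfolding real_norm_def by (rule eventually_sequentiallyI[of "Suc n0"]) (rule bound)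
        then have "(\<lambda>n. \<L> (?p n) / real n ^ D) \<longlonglongrightarrow> 0"
          using null by (rule Lim_null_comparison)
        then have "H D l (real N *\<^sub>R y) = 0" using lim LIMSEQ_unique by blast
        moreover have "H D l (real N *\<^sub>R y) = real N ^ D * H D l y"
          unfolding H_def sum_distrib_left
          by (rule sum.cong) (auto simp: power_mult_distrib prod.distrib mult_ac power_sum)
        ultimately show ?thesis using N by simp
      qed
      obtain z where z: "z \<in> std_lattice" "z \<in> interior lipman_chamber" using lattice_point_in_interior by blast
      obtain j0 where j0: "\<And>j. j0 \<le> j \<Longrightarrow> x + real j *\<^sub>R z \<in> interior lipman_chamber"
        using interior_absorbs_line[OF z(2)] by blast
      define P where "P = (\<Sum>m | m \<in> M \<and> (\<Sum>v\<in>UNIV. m v) = D. smult (c m l) (\<Prod>v\<in>UNIV. [:x $ v, z $ v:] ^ m v))"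
      have P: "poly P (real j) = H D l (x + real j *\<^sub>R z)" for j
        unfolding P_def H_def by (simp add: poly_sum poly_prod poly_power)
      have "poly P (real j) = poly 0 (real j)" if "j0 \<le> j" for j
        unfolding P using inner[OF _ j0[OF that]] less(4) z(1)
        by (simp add: std_lattice_add std_lattice_nat_scale)
      then have "P = 0" by (rule poly_eq_if_eventually_eq)
      then show ?thesis using P[of 0] by simp
    qed
  qed
  then show ?thesis using D l x unfolding H_def by blast
qed

lemma \<L>_bounded_degree:
  obtains M c N where "finite M" "N > 0" "\<And>m. m \<in> M \<Longrightarrow> (\<Sum>v\<in>UNIV. m v) \<le> card (ends G)"
    "\<And>m l x. m \<in> M \<Longrightarrow> l \<in> std_lattice \<Longrightarrow> x \<in> std_lattice \<Longrightarrow> c m (l + real N *\<^sub>R x) = c m l"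
    "\<And>l. l \<in> std_lattice \<Longrightarrow> \<L> l = (\<Sum>m\<in>M. c m l * (\<Prod>v\<in>UNIV. (l $ v) ^ m v))"
proof -
  obtain M c \<Lambda>' where M: "finite M" "finite_index_sublattice \<Lambda>' std_lattice"
    "\<And>m l d. m \<in> M \<Longrightarrow> l \<in> std_lattice \<Longrightarrow> d \<in> \<Lambda>' \<Longrightarrow> c m (l + d) = c m l"
    "\<And>l. l \<in> std_lattice \<Longrightarrow> \<L> l = (\<Sum>m\<in>M. c m l * (\<Prod>v\<in>UNIV. (l $ v) ^ m v))"
    using quasi_\<L> unfolding quasipolynomial_on_def by blast
  obtain N where N: "N > 0" "\<And>x. x \<in> std_lattice \<Longrightarrow> real N *\<^sub>R x \<in> \<Lambda>'"
    using finite_index_multiple[OF M(2) std_lattice_zero std_lattice_diff] by blast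
  have per: "c m (l + real N *\<^sub>R x) = c m l" if "m \<in> M" "l \<in> std_lattice" "x \<in> std_lattice" for m l x
    by (intro M(3) that N(2))
  let ?M = "{m \<in> M. (\<Sum>v\<in>UNIV. m v) \<le> card (ends G)}"
  have "\<L> l = (\<Sum>m\<in>?M. c m l * (\<Prod>v\<in>UNIV. (l $ v) ^ m v))" if l: "l \<in> std_lattice" for l
  proof -
    let ?t = "\<lambda>m. c m l * (\<Prod>v\<in>UNIV. (l $ v) ^ m v)"
    let ?deg = "\<lambda>m. \<Sum>v\<in>UNIV. m v"
    have "\<L> l = (\<Sum>m\<in>?M. ?t m) + (\<Sum>m\<in>M - ?M. ?t m)"
      using sum.subset_diff[of ?M M ?t] M(1) M(4)[OF l] by (simp add: add.commute)
    also have "(\<Sum>m\<in>M - ?M. ?t m) = (\<Sum>D\<in>?deg ` (M - ?M). \<Sum>m | m \<in> M - ?M \<and> ?deg m = D. ?t m)"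
      by (rule sum.group[symmetric]) (use M(1) in auto)
    also have "\<dots> = 0"
    proof (rule sum.neutral, rule ballI)
      fix D assume "D \<in> ?deg ` (M - ?M)"
      then have D: "card (ends G) < D" by auto
      then have "{m. m \<in> M - ?M \<and> ?deg m = D} = {m. m \<in> M \<and> ?deg m = D}" by auto
      then show "(\<Sum>m | m \<in> M - ?M \<and> ?deg m = D. ?t m) = 0"
        using \<L>_homogeneous_part_zero[of M N c D l l] M(1,4) N(1) per D l by simp
    qed
    finally show ?thesis by simp
  qed
  then show thesis
    using M(1) N(1) per by (intro that[of ?M N c]) auto
qed

definition node_vector :: "('v \<Rightarrow> int) \<Rightarrow> real^'v" where
  "node_vector k = (\<Sum>n\<in>nodes G. of_int (k n) *\<^sub>R E_star G n)"

lemma node_vector_std: "node_vector k \<in> std_lattice"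
  unfolding node_vector_def by (intro std_lattice_sum std_lattice_scale E_star_std)

text \<open>Substitute \<open>l = \<Sum>\<^sub>n \<lambda>\<^sub>n E\<^sub>n\<^sup>*\<close>: each monomial in the coordinates of \<open>l\<close> is a product of linear forms in the \<open>\<lambda>\<^sub>n\<close> and
  expands into monomials of the same degree.\<close>

lemma node_expansion_exists: "\<exists>a. node_expansion G \<L> a"
proof -
  let ?d = "card (ends G)" and ?S = "nodes G"
  obtain M c N where M: "finite M" "N > 0" "\<And>m. m \<in> M \<Longrightarrow> (\<Sum>v\<in>UNIV. m v) \<le> ?d"
    "\<And>m l x. m \<in> M \<Longrightarrow> l \<in> std_lattice \<Longrightarrow> x \<in> std_lattice \<Longrightarrow> c m (l + real N *\<^sub>R x) = c m l"
    "\<And>l. l \<in> std_lattice \<Longrightarrow> \<L> l = (\<Sum>m\<in>M. c m l * (\<Prod>v\<in>UNIV. (l $ v) ^ m v))"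
    by (rule \<L>_bounded_degree) (rule that)
  have "\<exists>b. \<forall>x. (\<Prod>v\<in>UNIV. (\<Sum>n\<in>?S. x n * E_star G n $ v) ^ m v) =
    (\<Sum>m'\<in>exponents ?S ?d. b m' * (\<Prod>n\<in>?S. x n ^ m' n))" if m: "m \<in> M" for m
  proof -
    have "poly_fun ?S (\<Sum>v\<in>UNIV. m v) (\<lambda>x. \<Prod>v\<in>UNIV. (\<Sum>n\<in>?S. x n * E_star G n $ v) ^ m v)"
      by (rule poly_fun_linear_prod) auto
    then show ?thesis using poly_fun_mono[OF _ _ M(3)[OF m], of ?S] unfolding poly_fun_def[of ?S ?d, symmetric] by simp
  qed
  then have "\<forall>m\<in>M. \<exists>b. \<forall>x. (\<Prod>v\<in>UNIV. (\<Sum>n\<in>?S. x n * E_star G n $ v) ^ m v) =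
    (\<Sum>m'\<in>exponents ?S ?d. b m' * (\<Prod>n\<in>?S. x n ^ m' n))" by blast
  from bchoice[OF this] obtain b where b: "\<And>m x. m \<in> M \<Longrightarrow> (\<Prod>v\<in>UNIV. (\<Sum>n\<in>?S. x n * E_star G n $ v) ^ m v) =
    (\<Sum>m'\<in>exponents ?S ?d. b m m' * (\<Prod>n\<in>?S. x n ^ m' n))"
    by blast
  define a where "a m' k = (\<Sum>m\<in>M. c m (node_vector k) * b m m') * (\<Prod>n\<in>?S. fact (m' n))" for m' k
  have "node_periodic G (a m')" for m'
    unfolding node_periodic_def
  proof (intro exI[of _ "int N"] conjI ballI impI)
    fix k k' assume eq: "\<forall>n\<in>?S. k n mod int N = k' n mod int N"
    define x where "x = (\<Sum>n\<in>?S. of_int ((k n - k' n) div int N) *\<^sub>R E_star G n)"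
    have x: "x \<in> std_lattice" unfolding x_def by (intro std_lattice_sum std_lattice_scale E_star_std)
    have "node_vector k = node_vector k' + real N *\<^sub>R x"
    proof -
      have "of_int (k n) = of_int (k' n) + real N * of_int ((k n - k' n) div int N)" if "n \<in> ?S" for n
      proof -
        have "int N dvd k n - k' n" using eq that by (simp add: mod_eq_dvd_iff)
        then have "k n = k' n + int N * ((k n - k' n) div int N)" by simp
        then show ?thesis by (metis of_int_add of_int_mult of_int_of_nat_eq)
      qed
      then show ?thesis unfolding node_vector_def x_def scaleR_sum_right sum.distrib[symmetric]
        by (intro sum.cong) (auto simp: scaleR_left_distrib)
    qed
    then show "a m' k = a m' k'" unfolding a_def using M(4)[OF _ node_vector_std x] by (simp cong: sum.cong)
  qed (use M(2) in simp)
  moreover have "\<L> (node_vector k) = (\<Sum>m'\<in>exponents ?S ?d. a m' k * (\<Prod>n\<in>?S. of_int (k n) ^ m' n / fact (m' n)))" for k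
  proof -
    have nth: "node_vector k $ v = (\<Sum>n\<in>?S. of_int (k n) * E_star G n $ v)" for v
      unfolding node_vector_def by simp
    have "\<L> (node_vector k) = (\<Sum>m\<in>M. c m (node_vector k) * (\<Prod>v\<in>UNIV. (\<Sum>n\<in>?S. of_int (k n) * E_star G n $ v) ^ m v))"
      unfolding M(5)[OF node_vector_std] nth ..
    also have "\<dots> = (\<Sum>m\<in>M. \<Sum>m'\<in>exponents ?S ?d. c m (node_vector k) * b m m' * (\<Prod>n\<in>?S. of_int (k n) ^ m' n))"
      by (rule sum.cong) (auto simp: b sum_distrib_left mult_ac)
    also have "\<dots> = (\<Sum>m'\<in>exponents ?S ?d. \<Sum>m\<in>M. c m (node_vector k) * b m m' * (\<Prod>n\<in>?S. of_int (k n) ^ m' n))"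
      by (rule sum.swap)
    also have "\<dots> = (\<Sum>m'\<in>exponents ?S ?d. a m' k * (\<Prod>n\<in>?S. of_int (k n) ^ m' n / fact (m' n)))"
    proof (rule sum.cong[OF refl])
      fix m'
      have F: "(\<Prod>n\<in>?S. fact (m' n) :: real) \<noteq> 0" by simp
      have "(\<Sum>m\<in>M. c m (node_vector k) * b m m' * (\<Prod>n\<in>?S. real_of_int (k n) ^ m' n)) =
        (\<Sum>m\<in>M. c m (node_vector k) * b m m') * (\<Prod>n\<in>?S. real_of_int (k n) ^ m' n)"
        by (rule sum_distrib_right[symmetric])
      then show "(\<Sum>m\<in>M. c m (node_vector k) * b m m' * (\<Prod>n\<in>?S. real_of_int (k n) ^ m' n)) =
        a m' k * (\<Prod>n\<in>?S. real_of_int (k n) ^ m' n / fact (m' n))"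
        unfolding a_def prod_dividef using F by simp
    qed
    finally show ?thesis .
  qed
  ultimately show ?thesis
    unfolding node_expansion_def node_vector_def exponents_def by (intro exI[of _ a]) auto
qed

end

section \<open>Monomials and difference operators\<close>

definition nabla :: "real \<Rightarrow> (real \<Rightarrow> real) \<Rightarrow> real \<Rightarrow> real" where
  "nabla c h y = h y - h (y - c)"

abbreviation mon :: "nat \<Rightarrow> real \<Rightarrow> real" where
  "mon m y \<equiv> y ^ m / fact m"

lemma nabla_funpow_sum:
  "(nabla c ^^ j) (\<lambda>y. \<Sum>i\<in>I. a i * h i y) = (\<lambda>y. \<Sum>i\<in>I. a i * (nabla c ^^ j) (h i) y)"
  by (induction j) (simp_all add: nabla_def fun_eq_iff sum_subtractf right_diff_distrib)

text \<open>The binomial theorem in terms of divided powers. All iterated differences of divided powers are computed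
  from this recursion; only its leading terms survive.\<close>

lemma nabla_mon:
  "nabla c (mon m) = (\<lambda>y. \<Sum>i<m. (- ((- c) ^ (m - i) / fact (m - i))) * mon i y)"
proof
  fix y
  have "(y - c) ^ m = (\<Sum>i\<le>m. of_nat (m choose i) * y ^ i * (- c) ^ (m - i))"
    using binomial_ring[of y "- c" m] by simp
  then have "mon m (y - c) = (\<Sum>i\<le>m. (- c) ^ (m - i) / fact (m - i) * mon i y)"
    by (simp add: sum_divide_distrib binomial_fact cong: sum.cong)
      (rule sum.cong, auto simp: binomial_fact field_simps)
  also have "\<dots> = (\<Sum>i<m. (- c) ^ (m - i) / fact (m - i) * mon i y) + mon m y"
    by (simp add: lessThan_Suc_atMost[symmetric])
  finally show "nabla c (mon m) y = (\<Sum>i<m. (- ((- c) ^ (m - i) / fact (m - i))) * mon i y)"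
    by (simp add: nabla_def sum_negf)
qed

lemma nabla_funpow_Suc_mon:
  "(nabla c ^^ Suc j) (mon m) y = (\<Sum>i<m. (- ((- c) ^ (m - i) / fact (m - i))) * (nabla c ^^ j) (mon i) y)"
proof -
  have "(nabla c ^^ Suc j) (mon m) = (nabla c ^^ j) (nabla c (mon m))"
    by (simp only: funpow_Suc_right o_def)
  then show ?thesis by (simp only: nabla_mon nabla_funpow_sum)
qed

lemma nabla_mon_above: "m < j \<Longrightarrow> (nabla c ^^ j) (mon m) y = 0"
proof (induction j arbitrary: m)
  case (Suc j)
  then show ?case unfolding nabla_funpow_Suc_mon by (intro sum.neutral) auto
qed simp

lemma nabla_mon_same: "(nabla c ^^ m) (mon m) y = c ^ m"
proof (induction m)
  case (Suc m)
  have "(nabla c ^^ Suc m) (mon (Suc m)) y =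
    (- ((- c) ^ (Suc m - m) / fact (Suc m - m))) * (nabla c ^^ m) (mon m) y"
    unfolding nabla_funpow_Suc_mon lessThan_Suc
    by (subst sum.insert) (auto intro!: sum.neutral simp: nabla_mon_above)
  then show ?case using Suc by simp
qed simp

lemma nabla_mon_plus_1: "(nabla 1 ^^ j) (mon (j + 1)) y = y - real j / 2"
proof (induction j)
  case (Suc j)
  have "(nabla 1 ^^ Suc j) (mon (Suc j + 1)) y =
    (nabla 1 ^^ j) (mon (j + 1)) y - 1 / 2 * (nabla 1 ^^ j) (mon j) y"
  proof -
    have "{..<Suc j + 1} = insert (j + 1) (insert j {..<j})" by auto
    moreover have "(\<Sum>i<j. (- ((- 1) ^ (Suc j + 1 - i) / fact (Suc j + 1 - i))) * (nabla 1 ^^ j) (mon i) y) = 0"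
      by (rule sum.neutral) (simp add: nabla_mon_above)
    moreover have "Suc j + 1 - j = 2" "Suc j + 1 - (j + 1) = 1" by simp_all
    ultimately show ?thesis unfolding nabla_funpow_Suc_mon
      by (simp add: fact_2 power2_eq_square del: Suc_eq_plus1)
  qed
  then show ?case unfolding Suc nabla_mon_same by (simp add: field_simps)
qed (simp add: nabla_def)

text \<open>The coefficients are those of \<open>(1 - exp(-t))^j / t^j\<close> up to \<open>t\<^sup>2\<close>, arranged around the centre of symmetry
  \<open>j/2\<close>.\<close>

lemma nabla_mon_plus_2:
  "(nabla 1 ^^ j) (mon (j + 2)) y = (y - real j / 2) ^ 2 / 2 + real j / 24"
proof (induction j)
  case (Suc j)
  have "(nabla 1 ^^ Suc j) (mon (Suc j + 2)) y =
    (nabla 1 ^^ j) (mon (j + 2)) y - 1 / 2 * (nabla 1 ^^ j) (mon (j + 1)) y + 1 / 6 * (nabla 1 ^^ j) (mon j) y"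
  proof -
    have "{..<Suc j + 2} = insert (j + 2) (insert (j + 1) (insert j {..<j}))" by auto
    moreover have "(\<Sum>i<j. (- ((- 1) ^ (Suc j + 2 - i) / fact (Suc j + 2 - i))) * (nabla 1 ^^ j) (mon i) y) = 0"
      by (rule sum.neutral) (simp add: nabla_mon_above)
    moreover have "Suc j + 2 - j = 3" "Suc j + 2 - (j + 1) = 2" "Suc j + 2 - (j + 2) = 1" by simp_all
    ultimately show ?thesis unfolding nabla_funpow_Suc_mon
      by (simp add: fact_numeral power2_eq_square power3_eq_cube del: Suc_eq_plus1)
  qed
  then show ?case unfolding Suc nabla_mon_plus_1 nabla_mon_same
    by (simp add: field_simps power2_eq_square)
qed (simp add: nabla_def power2_eq_square)

lemma iter_diff_zero: "(\<And>x. f x = 0) \<Longrightarrow> iter_diff ss f x = 0"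
  by (induction ss arbitrary: x) auto

text \<open>A difference with step \<open>N s\<close> is a sum of translates of differences with step \<open>s\<close>.\<close>

lemma iter_diff_scale_zero:
  fixes f :: "'a::real_vector \<Rightarrow> real"
  assumes X: "\<And>x s. x \<in> X \<Longrightarrow> s \<in> set ss \<Longrightarrow> x - s \<in> X"
    and zero: "\<And>x. x \<in> X \<Longrightarrow> iter_diff ss f x = 0" and x: "x \<in> X"
  shows "iter_diff (map ((*\<^sub>R) (real N)) ss) f x = 0"
  using assms
proof (induction ss arbitrary: f x)
  case (Cons s ss)
  let ?g = "\<lambda>x. f x - f (x - real N *\<^sub>R s)"
  have mem: "x - real j *\<^sub>R s \<in> X" if "x \<in> X" for x j
  proof (induction j)
    case (Suc j)
    have "x - real j *\<^sub>R s - s \<in> X" by (rule Cons.prems(1)[OF Suc]) simp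
    then show ?case by (simp add: scaleR_left_distrib algebra_simps)
  qed (use that in simp)
  have g: "?g x = (\<Sum>j<N. f (x - real j *\<^sub>R s) - f (x - real j *\<^sub>R s - s))" for x
  proof (induction N)
    case (Suc N)
    have "x - real (Suc N) *\<^sub>R s = x - real N *\<^sub>R s - s" by (simp add: scaleR_left_distrib algebra_simps)
    then show ?case by (simp only: sum.lessThan_Suc Suc[symmetric])
  qed simp
  have "iter_diff ss ?g y = 0" if y: "y \<in> X" for y
  proof -
    have "iter_diff ss ?g y =
      (\<Sum>j<N. iter_diff ss f (y - real j *\<^sub>R s) - iter_diff ss f (y - (real j *\<^sub>R s + s)))"
      unfolding g iter_diff_sum iter_diff_diff iter_diff_translate diff_diff_eq ..
    also have "\<dots> = (\<Sum>j<N. iter_diff (s # ss) f (y - real j *\<^sub>R s))"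
      by (simp add: diff_diff_eq)
    also have "\<dots> = 0" by (rule sum.neutral) (use Cons.prems(2) mem[OF y] in blast)
    finally show ?thesis .
  qed
  then have "iter_diff (map ((*\<^sub>R) (real N)) ss) ?g x = 0"
    by (intro Cons.IH) (use Cons.prems in auto)
  then show ?case by (simp add: iter_diff_diff iter_diff_translate)
qed simp

lemma iter_diff_periodic_mult:
  assumes X: "\<And>x s. x \<in> X \<Longrightarrow> s \<in> set ss \<Longrightarrow> x - s \<in> X"
    and b: "\<And>x s. x \<in> X \<Longrightarrow> s \<in> set ss \<Longrightarrow> b (x - s) = b x" and x: "x \<in> X"
  shows "iter_diff ss (\<lambda>x. b x * g x) x = b x * iter_diff ss g x"
  using assms by (induction ss arbitrary: x) (auto simp: right_diff_distrib)

definition up :: "'i \<Rightarrow> ('i \<Rightarrow> nat) \<Rightarrow> 'i \<Rightarrow> nat" where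
  "up k m = m(k := Suc (m k))"

lemma up_apply: "up k m n = m n + (if n = k then 1 else 0)"
  by (simp add: up_def)

lemma up_eq_iff: "up k m = up k' m \<longleftrightarrow> k = k'"
proof
  assume "up k m = up k' m"
  from fun_cong[OF this, of k] show "k = k'" by (simp add: up_apply split: if_splits)
qed simp

lemma up_up_eq_iff: "up k (up j m) = up k' (up j' m) \<longleftrightarrow> (k = k' \<and> j = j') \<or> (k = j' \<and> j = k')"
proof
  assume eq: "up k (up j m) = up k' (up j' m)"
  have "(if n = j then 1 else 0) + (if n = k then 1 else 0 :: nat) =
    (if n = j' then 1 else 0) + (if n = k' then 1 else 0)" for n
    using fun_cong[OF eq, of n] unfolding up_apply by simp
  from this[of j] this[of k] this[of j'] this[of k']
  show "(k = k' \<and> j = j') \<or> (k = j' \<and> j = k')"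
    by (cases "j = k"; cases "j = j'"; cases "k = k'"; cases "j = k'"; cases "k = j'"; cases "j' = k'"; simp)
next
  assume "(k = k' \<and> j = j') \<or> (k = j' \<and> j = k')"
  then show "up k (up j m) = up k' (up j' m)" by (auto simp: fun_eq_iff up_apply)
qed

lemma sum_up: "finite S \<Longrightarrow> k \<in> S \<Longrightarrow> (\<Sum>n\<in>S. up k m n) = Suc (\<Sum>n\<in>S. m n)"
  by (simp add: up_apply sum.distrib)

lemma up_PiE: "m \<in> S \<rightarrow>\<^sub>E UNIV \<Longrightarrow> k \<in> S \<Longrightarrow> up k m \<in> S \<rightarrow>\<^sub>E UNIV"
  by (auto simp: up_def PiE_def extensional_def)

lemma exists_up_le:
  assumes "m \<in> S \<rightarrow>\<^sub>E UNIV" "q \<in> S \<rightarrow>\<^sub>E UNIV" "\<And>n. n \<in> S \<Longrightarrow> q n \<le> m n" "m \<noteq> q"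
  shows "\<exists>k\<in>S. \<forall>n\<in>S. up k q n \<le> m n"
proof -
  obtain k where k: "k \<in> S" "m k \<noteq> q k" using PiE_ext[OF assms(1,2)] assms(4) by blast
  then have "q k < m k" using assms(3)[of k] by simp
  then show ?thesis using k(1) assms(3) by (intro bexI[of _ k]) (auto simp: up_apply)
qed

lemma exponent_eqI:
  assumes "finite S" "m \<in> S \<rightarrow>\<^sub>E UNIV" "q \<in> S \<rightarrow>\<^sub>E UNIV" "\<And>n. n \<in> S \<Longrightarrow> q n \<le> (m n :: nat)"
    "(\<Sum>n\<in>S. m n) \<le> (\<Sum>n\<in>S. q n)"
  shows "m = q"
proof (rule PiE_ext[OF assms(2,3)])
  fix n assume n: "n \<in> S"
  show "m n = q n"
  proof (rule ccontr)
    assume "m n \<noteq> q n"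
    then have "q n < m n" using assms(4)[OF n] by simp
    then have "(\<Sum>n\<in>S. q n) < (\<Sum>n\<in>S. m n)"
      using assms(1,4) n by (intro sum_strict_mono_ex1) auto
    then show False using assms(5) by simp
  qed
qed

lemma set_subset_if_count_list_0: "(\<And>w. w \<notin> A \<Longrightarrow> count_list xs w = 0) \<Longrightarrow> set xs \<subseteq> A"
  by (auto simp: count_list_0_iff)

lemma exists_list_with_counts:
  fixes f :: "'a \<Rightarrow> nat"
  assumes "finite A"
  shows "\<exists>xs. \<forall>w. count_list xs w = (if w \<in> A then f w else 0)"
  using assms
proof (induction A rule: finite_induct)
  case empty
  show ?case by (rule exI[of _ "[]"]) simp
next
  case (insert x A)
  then obtain xs where xs: "\<And>w. count_list xs w = (if w \<in> A then f w else 0)" by blast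
  have "count_list (replicate n x) w = (if w = x then n else 0)" for n w by (induction n) auto
  then show ?case using insert(2) xs
    by (intro exI[of _ "replicate (f x) x @ xs"]) (auto simp: count_list_append)
qed

context ehrhart_chamber
begin

abbreviation nd :: "'v set" where
  "nd \<equiv> nodes G"

definition node_mon :: "('v \<Rightarrow> nat) \<Rightarrow> real^'v \<Rightarrow> real" where
  "node_mon m x = (\<Prod>n\<in>nd. mon (m n) (dual_coord x n))"

definition node_lattice :: "(real^'v) set" where
  "node_lattice = range node_vector"

lemma dual_coord_node_vector: "dual_coord (node_vector k) n = (if n \<in> nd then of_int (k n) else 0)"
  unfolding node_vector_def by (simp add: if_distrib[of "\<lambda>t. _ * t"] cong: if_cong)

lemma node_vector_shift:
  assumes "n \<in> nd"
  shows "node_vector k - of_int c *\<^sub>R E_star G n = node_vector (k(n := k n - c))"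
  by (rule dual_coord_inject) (use assms in \<open>auto simp: dual_coord_node_vector\<close>)

lemma node_lattice_shift:
  assumes "x \<in> node_lattice" "n \<in> nd" shows "x - of_int c *\<^sub>R E_star G n \<in> node_lattice"
  using assms node_vector_shift unfolding node_lattice_def by auto

lemma node_vector_restrict: "node_vector (restrict k nd) = node_vector k"
  unfolding node_vector_def by (rule sum.cong) auto

text \<open>On the span of the \<open>E\<^sub>n\<^sup>*\<close> a shift by \<open>c E\<^sub>n\<^sup>*\<close> is a shift of the single variable \<open>\<lambda>\<^sub>n\<close> by \<open>c\<close>.\<close>

lemma iter_diff_prod:
  assumes "set qs \<subseteq> nd"
  shows "iter_diff (map (\<lambda>n. c *\<^sub>R E_star G n) qs) (\<lambda>x. \<Prod>n\<in>nd. h n (dual_coord x n)) x =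
    (\<Prod>n\<in>nd. (nabla c ^^ count_list qs n) (h n) (dual_coord x n))"
  using assms
proof (induction qs arbitrary: x)
  case (Cons q qs)
  let ?g = "\<lambda>n. (nabla c ^^ count_list qs n) (h n)"
  have q: "q \<in> nd" using Cons by simp
  have dq: "dual_coord (x - c *\<^sub>R E_star G q) q = dual_coord x q - c" by simp
  have r: "(\<Prod>n\<in>nd - {q}. ?g n (dual_coord (x - c *\<^sub>R E_star G q) n)) = (\<Prod>n\<in>nd - {q}. ?g n (dual_coord x n))"
    by (rule prod.cong) auto
  have r': "(\<Prod>n\<in>nd - {q}. (nabla c ^^ count_list (q # qs) n) (h n) (dual_coord x n)) = (\<Prod>n\<in>nd - {q}. ?g n (dual_coord x n))"
    by (rule prod.cong) auto
  have "iter_diff (map (\<lambda>n. c *\<^sub>R E_star G n) (q # qs)) (\<lambda>x. \<Prod>n\<in>nd. h n (dual_coord x n)) x =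
    (\<Prod>n\<in>nd. ?g n (dual_coord x n)) - (\<Prod>n\<in>nd. ?g n (dual_coord (x - c *\<^sub>R E_star G q) n))"
    using Cons by simp
  also have "\<dots> = (?g q (dual_coord x q) - ?g q (dual_coord x q - c)) * (\<Prod>n\<in>nd - {q}. ?g n (dual_coord x n))"
    by (simp only: prod.remove[of nd q, OF finite q] r dq left_diff_distrib)
  also have "?g q (dual_coord x q) - ?g q (dual_coord x q - c) = (nabla c ^^ count_list (q # qs) q) (h q) (dual_coord x q)"
    by (simp add: nabla_def)
  finally show ?case using q by (simp only: prod.remove[of nd q, OF finite q] r')
qed simp

text \<open>The steps are periods of the coefficients, which therefore pass through the differences like constants.
  The difference operator with \<open>q n\<close> steps for each \<open>n\<close> annihilates the monomials that do not
  dominate \<open>q\<close> and turns the monomial \<open>q\<close> into a non-zero constant.\<close>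

lemma leading_coeff_zero:
  assumes N: "N > 0" and fin: "finite node_exps"
    and per: "\<And>m x n. m \<in> node_exps \<Longrightarrow> x \<in> node_lattice \<Longrightarrow> n \<in> nd \<Longrightarrow> b m (x - real N *\<^sub>R E_star G n) = b m x"
    and zero: "\<And>x. x \<in> node_lattice \<Longrightarrow>
      iter_diff (map (\<lambda>n. real N *\<^sub>R E_star G n) qs) (\<lambda>x. \<Sum>m\<in>node_exps. b m x * node_mon m x) x = 0"
    and qs: "set qs \<subseteq> nd" "\<And>n. n \<in> nd \<Longrightarrow> count_list qs n = q n"
    and q: "q \<in> node_exps" and dom: "\<And>m. m \<in> node_exps \<Longrightarrow> m \<noteq> q \<Longrightarrow> (\<And>n. n \<in> nd \<Longrightarrow> q n \<le> m n) \<Longrightarrow> b m x = 0"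
    and x: "x \<in> node_lattice"
  shows "b q x = 0"
proof -
  let ?ss = "map (\<lambda>n. real N *\<^sub>R E_star G n) qs"
  have shift: "y - s \<in> node_lattice" if "y \<in> node_lattice" "s \<in> set ?ss" for y s
    using that node_lattice_shift[of y _ "int N"] qs(1) by auto
  have eval: "iter_diff ?ss (node_mon m) x = (\<Prod>n\<in>nd. (nabla (real N) ^^ q n) (mon (m n)) (dual_coord x n))" for m
  proof -
    have "iter_diff ?ss (node_mon m) x = (\<Prod>n\<in>nd. (nabla (real N) ^^ count_list qs n) (mon (m n)) (dual_coord x n))"
      unfolding node_mon_def[abs_def] by (rule iter_diff_prod[OF qs(1)])
    then show ?thesis using qs(2) by simp
  qed
  have "0 = (\<Sum>m\<in>node_exps. iter_diff ?ss (\<lambda>x. b m x * node_mon m x) x)"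
    using zero[OF x] unfolding iter_diff_sum by simp
  also have "\<dots> = (\<Sum>m\<in>node_exps. b m x * iter_diff ?ss (node_mon m) x)"
  proof (rule sum.cong[OF refl])
    fix m assume m: "m \<in> node_exps"
    show "iter_diff ?ss (\<lambda>x. b m x * node_mon m x) x = b m x * iter_diff ?ss (node_mon m) x"
      by (rule iter_diff_periodic_mult[where X = node_lattice])
        (use shift x per[OF m] qs(1) in auto)
  qed
  also have "\<dots> = (\<Sum>m\<in>{q}. b m x * iter_diff ?ss (node_mon m) x)"
  proof (rule sum.mono_neutral_right[OF fin])
    show "\<forall>m\<in>node_exps - {q}. b m x * iter_diff ?ss (node_mon m) x = 0"
    proof
      fix m assume m: "m \<in> node_exps - {q}"
      show "b m x * iter_diff ?ss (node_mon m) x = 0"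
      proof (cases "\<forall>n\<in>nd. q n \<le> m n")
        case True
        then show ?thesis using dom[of m] m by auto
      next
        case False
        then obtain n where n: "n \<in> nd" "m n < q n" by auto
        then have "(nabla (real N) ^^ q n) (mon (m n)) (dual_coord x n) = 0"
          by (intro nabla_mon_above)
        then have "iter_diff ?ss (node_mon m) x = 0" unfolding eval using n(1)
          by (intro prod_zero) auto
        then show ?thesis by simp
      qed
    qed
  qed (use q in auto)
  also have "\<dots> = b q x * (\<Prod>n\<in>nd. real N ^ q n)" unfolding eval by (simp add: nabla_mon_same)
  finally show ?thesis using N by simp
qed

text \<open>The least exponent that survives the differences leading from the Ehrhart quasipolynomial to \<open>\<chi> + pc\<close>.\<close>

definition base_exp :: "'v \<Rightarrow> nat" where
  "base_exp = (\<lambda>n\<in>nd. valency G n - 2)"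

definition K_pair :: "'v \<Rightarrow> real" where
  "K_pair n = int_form G (canonical_class G) (E_star G n)"

definition lin_coeff :: "'v \<Rightarrow> real" where
  "lin_coeff n = - (1/2) * K_pair n + (1/2) * (\<Sum>m\<in>nd. real (base_exp m) * J G n m)"

text \<open>The constant of the theorem in the symmetric form in which it comes out of the calculation: the sum of the
  products \<open>d\<^sub>n d\<^sub>m J\<^sub>n\<^sub>m\<close> includes the diagonal.\<close>

definition const_coeff :: real where
  "const_coeff = pc - (\<Sum>n\<in>nd. real (base_exp n) * K_pair n) / 4
     + (\<Sum>n\<in>nd. \<Sum>m\<in>nd. real (base_exp n) * real (base_exp m) * J G n m) / 8
     - (\<Sum>n\<in>nd. real (base_exp n) * J G n n) / 24"

text \<open>The exponent of \<open>\<lambda>\<^sub>n \<lambda>\<^sub>m\<close> occurs twice in a sum over ordered pairs if \<open>n \<noteq> m\<close>, whence the half.\<close>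

definition quad_coeff :: "'v \<Rightarrow> 'v \<Rightarrow> real" where
  "quad_coeff n m = (if n = m then J G n m else J G n m / 2)"

text \<open>The coefficient at \<open>e\<close> of the polynomial with the claimed leading coefficients and all others zero. In this
  form a sum over all exponents collapses to a sum over the nodes.\<close>

definition expected_coeff :: "('v \<Rightarrow> nat) \<Rightarrow> real" where
  "expected_coeff e = (if e = base_exp then const_coeff else 0)
     + (\<Sum>n\<in>nd. if e = up n base_exp then lin_coeff n else 0)
     + (\<Sum>n\<in>nd. \<Sum>m\<in>nd. if e = up n (up m base_exp) then quad_coeff n m else 0)"

lemma chi_node_vector:
  assumes "x \<in> node_lattice"
  shows "chi x = (\<Sum>n\<in>nd. \<Sum>m\<in>nd. J G n m * dual_coord x n * dual_coord x m) / 2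
    - (\<Sum>n\<in>nd. K_pair n * dual_coord x n) / 2"
proof -
  have x: "x = (\<Sum>n\<in>nd. dual_coord x n *\<^sub>R E_star G n)"
  proof -
    obtain k where k: "x = node_vector k" using assms unfolding node_lattice_def by blast
    show ?thesis unfolding k by (subst (1) node_vector_def) (simp add: dual_coord_node_vector)
  qed
  have K: "int_form G (canonical_class G) x = (\<Sum>n\<in>nd. K_pair n * dual_coord x n)"
    by (subst x) (simp add: int_form_sum int_form_linear K_pair_def mult.commute)
  have "int_form G x x = (\<Sum>n\<in>nd. \<Sum>m\<in>nd. dual_coord x n * (dual_coord x m * int_form G (E_star G n) (E_star G m)))"
  proof -
    have 1: "int_form G y x = (\<Sum>m\<in>nd. dual_coord x m * int_form G y (E_star G m))" for y
      by (subst x) (simp add: int_form_sum int_form_linear)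
    have "int_form G x x = (\<Sum>n\<in>nd. dual_coord x n * int_form G (E_star G n) x)"
      by (subst 1) (simp add: int_form_sym[of x])
    then show ?thesis unfolding 1 by (simp only: sum_distrib_left)
  qed
  also have "\<dots> = - (\<Sum>n\<in>nd. \<Sum>m\<in>nd. J G n m * dual_coord x n * dual_coord x m)"
    by (simp add: J_def sum_negf[symmetric] mult_ac)
  finally show ?thesis unfolding chi_def K by (simp add: field_simps)
qed

end

section \<open>The leading coefficients\<close>

context ehrhart_chamber
begin

abbreviation node_exps :: "('v \<Rightarrow> nat) set" where
  "node_exps \<equiv> exponents nd (card (ends G))"

lemma finite_ES: "finite node_exps"
  by (simp add: finite_exponents)

lemma base_exp_PiE: "base_exp \<in> nd \<rightarrow>\<^sub>E UNIV"
  by (simp add: base_exp_def)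

lemma card_ends_dd: "card (ends G) = (\<Sum>n\<in>nd. base_exp n) + 2"
  unfolding card_ends base_exp_def by simp

lemma base_exp_in_ES: "base_exp \<in> node_exps"
  using base_exp_PiE card_ends_dd by (simp add: exponents_def)

lemma up_dd_in_ES: "n \<in> nd \<Longrightarrow> up n base_exp \<in> node_exps"
  using up_PiE[OF base_exp_PiE] card_ends_dd by (simp add: exponents_def sum_up)

lemma up_up_dd_in_ES: "n \<in> nd \<Longrightarrow> m \<in> nd \<Longrightarrow> up n (up m base_exp) \<in> node_exps"
  using up_PiE[OF up_PiE[OF base_exp_PiE]] card_ends_dd by (simp add: exponents_def sum_up)

lemma up_neq: "up n e \<noteq> e" "up n (up m e) \<noteq> e"
  by (auto simp: fun_eq_iff up_apply intro: exI[of _ n])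

lemma up_up_neq_up:
  assumes "n \<in> nd" "m \<in> nd" "k \<in> nd" shows "up n (up m base_exp) \<noteq> up k base_exp"
proof
  assume "up n (up m base_exp) = up k base_exp"
  then have "(\<Sum>j\<in>nd. up n (up m base_exp) j) = (\<Sum>j\<in>nd. up k base_exp j)" by simp
  then show False using assms by (simp add: sum_up)
qed

lemma expected_coeff_dd: "expected_coeff base_exp = const_coeff"
  unfolding expected_coeff_def using up_neq(1)[of _ base_exp] up_neq(2)[of _ _ base_exp] by (simp add: eq_commute[of base_exp])

lemma expected_coeff_up:
  assumes "k \<in> nd" shows "expected_coeff (up k base_exp) = lin_coeff k"
proof -
  have "(\<Sum>n\<in>nd. \<Sum>m\<in>nd. if up k base_exp = up n (up m base_exp) then quad_coeff n m else 0) = 0"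
    using up_up_neq_up assms by (intro sum.neutral ballI) (auto simp: eq_commute[of "up k base_exp"])
  then show ?thesis
    unfolding expected_coeff_def using up_neq(1)[of k base_exp] assms by (simp add: up_eq_iff)
qed

lemma expected_coeff_up_up:
  assumes k: "k \<in> nd" "j \<in> nd" shows "expected_coeff (up k (up j base_exp)) = J G k j"
proof -
  have 1: "(\<Sum>n\<in>nd. if up k (up j base_exp) = up n base_exp then lin_coeff n else 0) = 0"
    using up_up_neq_up assms by (intro sum.neutral ballI) auto
  have "expected_coeff (up k (up j base_exp)) =
    (\<Sum>n\<in>nd. \<Sum>m\<in>nd. if (k = n \<and> j = m) \<or> (k = m \<and> j = n) then quad_coeff n m else 0)"
    unfolding expected_coeff_def 1 using up_neq(2)[of k j base_exp] by (simp add: up_up_eq_iff)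
  also have "\<dots> = (\<Sum>n\<in>nd. \<Sum>m\<in>nd. (if k = n then if j = m then quad_coeff n m else 0 else 0)
    + (if k = j then 0 else if j = n then if k = m then quad_coeff n m else 0 else 0))"
    by (intro sum.cong refl) auto
  also have "\<dots> = (\<Sum>n\<in>nd. if k = n then \<Sum>m\<in>nd. if j = m then quad_coeff n m else 0 else 0)
    + (\<Sum>n\<in>nd. if k = j then 0 else if j = n then \<Sum>m\<in>nd. if k = m then quad_coeff n m else 0 else 0)"
    unfolding sum.distrib by (intro arg_cong2[where f = "(+)"] sum.cong refl) auto
  also have "\<dots> = quad_coeff k j + (if k = j then 0 else quad_coeff j k)"
    using k by (cases "k = j") simp_all
  also have "\<dots> = J G k j" using J_sym[of k j] by (simp add: quad_coeff_def)
  finally show ?thesis .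
qed

text \<open>In the variables \<open>u\<^sub>n = \<lambda>\<^sub>n - d\<^sub>n/2\<close> the surviving divided powers become \<open>1\<close>, \<open>u\<^sub>n\<close> and
  \<open>u\<^sub>n\<^sup>2/2 + d\<^sub>n/24\<close>. Rewriting \<open>\<chi>\<close> in these variables gives the linear and constant coefficients.\<close>

lemma iter_diff_target:
  assumes ns: "\<And>w. count_list ns w = (if w \<in> nd then valency G w - 2 else 0)"
    and x: "x \<in> node_lattice"
  shows "iter_diff (map (E_star G) ns) (\<lambda>x. \<Sum>e\<in>node_exps. expected_coeff e * node_mon e x) x = chi x + pc"
proof -
  define D where "D e = iter_diff (map (E_star G) ns) (node_mon e) x" for e
  define u where "u n = dual_coord x n - real (base_exp n) / 2" for n
  have ns_dd: "count_list ns n = base_exp n" if "n \<in> nd" for n using that ns by (simp add: base_exp_def)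
  have "set ns \<subseteq> nd" using ns by (intro set_subset_if_count_list_0) simp
  then have D: "D e = (\<Prod>n\<in>nd. (nabla 1 ^^ base_exp n) (mon (e n)) (dual_coord x n))" for e
    using iter_diff_prod[of ns 1 "\<lambda>n. mon (e n)" x] unfolding D_def node_mon_def[abs_def]
    by (simp add: ns_dd)
  have D0: "D base_exp = 1" unfolding D by (simp add: nabla_mon_same)
  have D1: "D (up k base_exp) = u k" if k: "k \<in> nd" for k
  proof -
    have "D (up k base_exp) = (\<Prod>n\<in>nd. if n = k then u n else 1)"
      unfolding D by (rule prod.cong) (use nabla_mon_plus_1 in \<open>auto simp: up_apply nabla_mon_same u_def\<close>)
    then show ?thesis using k by simp
  qed
  have D2: "quad_coeff n m * D (up n (up m base_exp)) = J G n m * u n * u m / 2 +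
    (if m = n then real (base_exp n) * J G n n / 24 else 0)" if nm: "n \<in> nd" "m \<in> nd" for n m
  proof (cases "m = n")
    case True
    have "D (up n (up n base_exp)) = (\<Prod>i\<in>nd. if i = n then (u i)^2 / 2 + real (base_exp i) / 24 else 1)"
      unfolding D
      by (rule prod.cong) (use nabla_mon_plus_2 in \<open>auto simp: up_apply nabla_mon_same u_def\<close>)
    then show ?thesis using True nm by (simp add: quad_coeff_def power2_eq_square algebra_simps)
  next
    case False
    have "D (up n (up m base_exp)) = (\<Prod>i\<in>nd. (if i = n then u i else 1) * (if i = m then u i else 1))"
      unfolding D
      by (rule prod.cong) (use nabla_mon_plus_1 False in \<open>auto simp: up_apply nabla_mon_same u_def\<close>)
    also have "\<dots> = u n * u m" using nm by (simp add: prod.distrib)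
    finally show ?thesis using False by (simp add: quad_coeff_def)
  qed
  have delta: "(\<Sum>e\<in>node_exps. (if e = e0 then c else 0) * D e) = c * D e0" if "e0 \<in> node_exps" for e0 c
    using that finite_ES by (simp add: if_distrib[of "\<lambda>t. t * _"] cong: if_cong)
  have "iter_diff (map (E_star G) ns) (\<lambda>x. \<Sum>e\<in>node_exps. expected_coeff e * node_mon e x) x = (\<Sum>e\<in>node_exps. expected_coeff e * D e)"
    unfolding iter_diff_sum D_def
    by (intro sum.cong refl iter_diff_periodic_mult[where X = UNIV]) auto
  also have "\<dots> = (\<Sum>e\<in>node_exps. (if e = base_exp then const_coeff else 0) * D e)
     + (\<Sum>n\<in>nd. \<Sum>e\<in>node_exps. (if e = up n base_exp then lin_coeff n else 0) * D e)
     + (\<Sum>n\<in>nd. \<Sum>m\<in>nd. \<Sum>e\<in>node_exps. (if e = up n (up m base_exp) then quad_coeff n m else 0) * D e)"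
  proof -
    have 1: "(\<Sum>e\<in>node_exps. (\<Sum>n\<in>nd. if e = up n base_exp then lin_coeff n else 0) * D e) =
      (\<Sum>n\<in>nd. \<Sum>e\<in>node_exps. (if e = up n base_exp then lin_coeff n else 0) * D e)"
      unfolding sum_distrib_right by (rule sum.swap)
    have 2: "(\<Sum>e\<in>node_exps. (\<Sum>n\<in>nd. \<Sum>m\<in>nd. if e = up n (up m base_exp) then quad_coeff n m else 0) * D e) =
      (\<Sum>n\<in>nd. \<Sum>m\<in>nd. \<Sum>e\<in>node_exps. (if e = up n (up m base_exp) then quad_coeff n m else 0) * D e)"
      unfolding sum_distrib_right
      by (subst sum.swap) (intro sum.cong refl sum.swap)
    show ?thesis unfolding expected_coeff_def distrib_right sum.distrib 1 2 ..
  qed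
  also have "\<dots> = const_coeff + (\<Sum>n\<in>nd. lin_coeff n * u n)
     + (\<Sum>n\<in>nd. \<Sum>m\<in>nd. J G n m * u n * u m / 2 + (if m = n then real (base_exp n) * J G n n / 24 else 0))"
    using delta base_exp_in_ES up_dd_in_ES up_up_dd_in_ES D0 D1 D2 by (simp cong: sum.cong)
  also have "\<dots> = const_coeff + (\<Sum>n\<in>nd. lin_coeff n * u n)
     + (\<Sum>n\<in>nd. \<Sum>m\<in>nd. J G n m * u n * u m) / 2 + (\<Sum>n\<in>nd. real (base_exp n) * J G n n) / 24"
    by (simp add: sum.distrib sum_divide_distrib)
  also have "\<dots> = chi x + pc"
  proof -
    let ?d = "\<lambda>n. real (base_exp n)"
    have y: "dual_coord x n = u n + ?d n / 2" for n by (simp add: u_def)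
    have swap: "(\<Sum>n\<in>nd. \<Sum>m\<in>nd. J G n m * ?d n * u m) = (\<Sum>n\<in>nd. \<Sum>m\<in>nd. J G n m * u n * ?d m)"
      by (subst sum.swap) (intro sum.cong refl, simp add: J_sym mult_ac)
    have "(\<Sum>n\<in>nd. \<Sum>m\<in>nd. J G n m * dual_coord x n * dual_coord x m) =
      (\<Sum>n\<in>nd. \<Sum>m\<in>nd. J G n m * u n * u m + J G n m * u n * ?d m / 2
        + J G n m * ?d n * u m / 2 + ?d n * ?d m * J G n m / 4)"
      unfolding y by (intro sum.cong refl) (simp add: field_simps)
    also have "\<dots> = (\<Sum>n\<in>nd. \<Sum>m\<in>nd. J G n m * u n * u m)
      + (\<Sum>n\<in>nd. \<Sum>m\<in>nd. J G n m * u n * ?d m) / 2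
      + (\<Sum>n\<in>nd. \<Sum>m\<in>nd. J G n m * ?d n * u m) / 2
      + (\<Sum>n\<in>nd. \<Sum>m\<in>nd. ?d n * ?d m * J G n m) / 4"
      by (simp only: sum.distrib sum_divide_distrib)
    finally have JJ: "(\<Sum>n\<in>nd. \<Sum>m\<in>nd. J G n m * dual_coord x n * dual_coord x m) =
      (\<Sum>n\<in>nd. \<Sum>m\<in>nd. J G n m * u n * u m)
      + (\<Sum>n\<in>nd. \<Sum>m\<in>nd. J G n m * u n * ?d m)
      + (\<Sum>n\<in>nd. \<Sum>m\<in>nd. ?d n * ?d m * J G n m) / 4"
      unfolding swap by simp
    have KK: "(\<Sum>n\<in>nd. K_pair n * dual_coord x n) = (\<Sum>n\<in>nd. K_pair n * u n) + (\<Sum>n\<in>nd. ?d n * K_pair n) / 2"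
      unfolding y by (simp add: distrib_left sum.distrib sum_divide_distrib mult_ac)
    have "(\<Sum>n\<in>nd. lin_coeff n * u n) =
      (\<Sum>n\<in>nd. (\<Sum>m\<in>nd. J G n m * u n * ?d m) / 2 - K_pair n * u n / 2)"
    proof (rule sum.cong[OF refl])
      fix n
      have "(\<Sum>m\<in>nd. J G n m * u n * ?d m) = (\<Sum>m\<in>nd. ?d m * J G n m) * u n"
        unfolding sum_distrib_right by (rule sum.cong) (auto simp: mult_ac)
      then show "lin_coeff n * u n = (\<Sum>m\<in>nd. J G n m * u n * ?d m) / 2 - K_pair n * u n / 2"
        by (simp add: lin_coeff_def algebra_simps)
    qed
    also have "\<dots> = (\<Sum>n\<in>nd. \<Sum>m\<in>nd. J G n m * u n * ?d m) / 2 - (\<Sum>n\<in>nd. K_pair n * u n) / 2"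
      by (simp only: sum_subtractf sum_divide_distrib)
    finally show ?thesis unfolding chi_node_vector[OF x] JJ KK const_coeff_def by (simp add: field_simps)
  qed
  finally show ?thesis .
qed

lemma node_coord:
  assumes "k \<in> nd \<rightarrow>\<^sub>E UNIV" shows "(\<lambda>n\<in>nd. lcoord (node_vector k) n) = k"
  using assms by (auto simp: fun_eq_iff lcoord_def dual_coord_node_vector PiE_def extensional_def)

lemma common_period:
  assumes "\<And>e. e \<in> node_exps \<Longrightarrow> node_periodic G (a e)"
  obtains N :: nat where "N > 0" "\<And>e k k'. e \<in> node_exps \<Longrightarrow> k \<in> nd \<rightarrow>\<^sub>E UNIV \<Longrightarrow> k' \<in> nd \<rightarrow>\<^sub>E UNIV \<Longrightarrow>
    (\<And>n. n \<in> nd \<Longrightarrow> k n mod int N = k' n mod int N) \<Longrightarrow> a e k = a e k'"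
proof -
  have "\<forall>e\<in>node_exps. \<exists>N>0. \<forall>k\<in>nd \<rightarrow>\<^sub>E UNIV. \<forall>k'\<in>nd \<rightarrow>\<^sub>E UNIV.
    (\<forall>n\<in>nd. k n mod N = k' n mod N) \<longrightarrow> a e k = a e k'"
    using assms unfolding node_periodic_def by simp
  from bchoice[OF this] obtain Nf :: "('v \<Rightarrow> nat) \<Rightarrow> int" where Nf: "\<forall>e\<in>node_exps. Nf e > 0 \<and>
    (\<forall>k\<in>nd \<rightarrow>\<^sub>E UNIV. \<forall>k'\<in>nd \<rightarrow>\<^sub>E UNIV. (\<forall>n\<in>nd. k n mod Nf e = k' n mod Nf e) \<longrightarrow> a e k = a e k')"
    by blast
  define N where "N = nat (\<Prod>e\<in>node_exps. Nf e)"
  have pos: "0 < (\<Prod>e\<in>node_exps. Nf e)" using Nf by (intro prod_pos) auto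
  then have N: "int N = (\<Prod>e\<in>node_exps. Nf e)" unfolding N_def by simp
  show thesis
  proof (rule that)
    show "0 < N" using pos N by linarith
    fix e k k' assume e: "e \<in> node_exps" and k: "k \<in> nd \<rightarrow>\<^sub>E UNIV" "k' \<in> nd \<rightarrow>\<^sub>E UNIV"
      and eq: "\<And>n. n \<in> nd \<Longrightarrow> k n mod int N = k' n mod int N"
    have "Nf e dvd int N" unfolding N using finite_ES e by (rule dvd_prodI)
    then have "k n mod Nf e = k' n mod Nf e" if "n \<in> nd" for n
      using mod_mod_cancel[of "Nf e" "int N"] eq[OF that] by metis
    then show "a e k = a e k'" using Nf e k by blast
  qed
qed

text \<open>The differences \<open>b\<close> between the actual and the claimed coefficients expand a function that is
  annihilated by the \<open>d\<^sub>n\<close> differences with unit steps, hence also by those with steps \<open>N\<close>, for \<open>N\<close> a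
  common period, and by any further ones. Taking as many differences as an exponent \<open>q\<close> prescribes
  isolates \<open>b q\<close> once the coefficients above \<open>q\<close> are known to vanish. This is applied to the
  exponents of total degree two, one and zero above \<open>d\<close>, in this order.\<close>

theorem node_expansion_coeffs:
  assumes a: "node_expansion G \<L> a" and k: "k \<in> nd \<rightarrow>\<^sub>E UNIV"
  shows "a base_exp k = const_coeff"
    and "\<And>n. n \<in> nd \<Longrightarrow> a (up n base_exp) k = lin_coeff n"
    and "\<And>n m. n \<in> nd \<Longrightarrow> m \<in> nd \<Longrightarrow> a (up n (up m base_exp)) k = J G n m"
proof -
  define b where "b e x = a e (\<lambda>n\<in>nd. lcoord x n) - expected_coeff e" for e x
  have per_a: "node_periodic G (a e)" if "e \<in> node_exps" for e
    using a that unfolding node_expansion_def exponents_def by blast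
  obtain N :: nat where N: "N > 0" "\<And>e k k'. e \<in> node_exps \<Longrightarrow> k \<in> nd \<rightarrow>\<^sub>E UNIV \<Longrightarrow> k' \<in> nd \<rightarrow>\<^sub>E UNIV \<Longrightarrow>
    (\<And>n. n \<in> nd \<Longrightarrow> k n mod int N = k' n mod int N) \<Longrightarrow> a e k = a e k'"
    using common_period[of a] per_a by blast
  have std: "x \<in> std_lattice" if "x \<in> node_lattice" for x
    using that node_vector_std unfolding node_lattice_def by blast
  have per: "b e (x - real N *\<^sub>R E_star G n) = b e x" if e: "e \<in> node_exps" and x: "x \<in> node_lattice" and n: "n \<in> nd" for e x n
  proof -
    have x': "x - real N *\<^sub>R E_star G n \<in> node_lattice" using node_lattice_shift[OF x n, of "int N"] by simp
    have lc: "lcoord (x - real N *\<^sub>R E_star G n) m = lcoord x m - (if n = m then int N else 0)" for m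
      by (rule lcoord_eqI[OF std[OF x']]) (simp add: lcoord std x)
    have "a e (\<lambda>m\<in>nd. lcoord (x - real N *\<^sub>R E_star G n) m) = a e (\<lambda>m\<in>nd. lcoord x m)"
      by (rule N(2)[OF e]) (auto simp: lc)
    then show ?thesis unfolding b_def by simp
  qed
  have expand: "\<L> x - (\<Sum>e\<in>node_exps. expected_coeff e * node_mon e x) = (\<Sum>e\<in>node_exps. b e x * node_mon e x)"
    if x: "x \<in> node_lattice" for x
  proof -
    obtain j where j: "x = node_vector j" using x unfolding node_lattice_def by blast
    define j' where "j' = restrict j nd"
    have xj: "x = node_vector j'" unfolding j j'_def node_vector_restrict ..
    have j'E: "j' \<in> nd \<rightarrow>\<^sub>E UNIV" unfolding j'_def by simp
    have "\<L> x = (\<Sum>e\<in>node_exps. a e j' * (\<Prod>n\<in>nd. of_int (j' n) ^ e n / fact (e n)))"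
      using a j'E unfolding node_expansion_def xj node_vector_def exponents_def by blast
    also have "\<dots> = (\<Sum>e\<in>node_exps. a e (\<lambda>n\<in>nd. lcoord x n) * node_mon e x)"
      unfolding xj node_coord[OF j'E] node_mon_def by (simp add: dual_coord_node_vector)
    finally show ?thesis by (simp add: b_def left_diff_distrib sum_subtractf)
  qed
  obtain ns where ns: "\<And>w. count_list ns w = (if w \<in> nd then valency G w - 2 else 0)"
    using exists_list_with_counts[of nd "\<lambda>w. valency G w - 2"] by auto
  have set_ns: "set ns \<subseteq> nd" using ns by (intro set_subset_if_count_list_0) simp
  have ns_dd: "count_list ns n = base_exp n" if "n \<in> nd" for n using that ns by (simp add: base_exp_def)
  let ?f = "\<lambda>x. \<Sum>e\<in>node_exps. b e x * node_mon e x"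
  have shift: "x - s \<in> node_lattice" if "x \<in> node_lattice" "s \<in> set (map (E_star G) qs)" "set qs \<subseteq> nd" for x s qs
    using that node_lattice_shift[of x _ 1] by auto
  have zero: "iter_diff (map (E_star G) ns) ?f x = 0" if x: "x \<in> node_lattice" for x
  proof -
    have "iter_diff (map (E_star G) ns) ?f x =
      iter_diff (map (E_star G) ns) (\<lambda>x. \<L> x - (\<Sum>e\<in>node_exps. expected_coeff e * node_mon e x)) x"
      by (rule iter_diff_cong[where X = node_lattice]) (use x shift[OF _ _ set_ns] expand in auto)
    also have "\<dots> = 0"
      unfolding iter_diff_diff iter_diff_\<L>[OF ns std[OF x]] iter_diff_target[OF ns x] by simp
    finally show ?thesis .
  qed
  have zero_more: "iter_diff (map (\<lambda>n. real N *\<^sub>R E_star G n) (ms @ ns)) ?f x = 0"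
    if ms: "set ms \<subseteq> nd" and x: "x \<in> node_lattice" for ms x
  proof -
    have all: "set (ms @ ns) \<subseteq> nd" using ms set_ns by simp
    have "iter_diff (map (E_star G) (ms @ ns)) ?f y = 0" if y: "y \<in> node_lattice" for y
    proof -
      have "iter_diff (map (E_star G) (ms @ ns)) ?f y =
        iter_diff (map (E_star G) ms) (iter_diff (map (E_star G) ns) ?f) y"
        by (simp add: iter_diff_append)
      also have "\<dots> = iter_diff (map (E_star G) ms) (\<lambda>_. 0) y"
        by (rule iter_diff_cong[where X = node_lattice]) (use y shift[OF _ _ ms] zero in auto)
      finally show ?thesis by (simp add: iter_diff_zero)
    qed
    then have "iter_diff (map ((*\<^sub>R) (real N)) (map (E_star G) (ms @ ns))) ?f x = 0"
      using x shift[OF _ _ all] by (intro iter_diff_scale_zero[where X = node_lattice]) auto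
    then show ?thesis by (simp add: o_def)
  qed
  have coeff: "b q x = 0"
    if x: "x \<in> node_lattice" and q: "q \<in> node_exps" and ms: "set ms \<subseteq> nd"
      and cnt: "\<And>n. n \<in> nd \<Longrightarrow> count_list (ms @ ns) n = q n"
      and dom: "\<And>e x. x \<in> node_lattice \<Longrightarrow> e \<in> node_exps \<Longrightarrow> e \<noteq> q \<Longrightarrow> (\<And>n. n \<in> nd \<Longrightarrow> q n \<le> e n) \<Longrightarrow> b e x = 0"
    for q x ms
    by (rule leading_coeff_zero[OF N(1) finite_ES per zero_more[OF ms] _ cnt q dom x])
      (use ms set_ns x in auto)
  have ES_sum: "(\<Sum>n\<in>nd. e n) \<le> (\<Sum>n\<in>nd. base_exp n) + 2" "e \<in> nd \<rightarrow>\<^sub>E UNIV" if "e \<in> node_exps" for e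
    using that card_ends_dd by (auto simp: exponents_def)
  have b2: "b (up n (up m base_exp)) x = 0" if nm: "n \<in> nd" "m \<in> nd" and x: "x \<in> node_lattice" for n m x
  proof (rule coeff[OF x up_up_dd_in_ES[OF nm], of "[n, m]"])
    fix e y assume e: "e \<in> node_exps" "e \<noteq> up n (up m base_exp)" "\<And>i. i \<in> nd \<Longrightarrow> up n (up m base_exp) i \<le> e i"
    have "e = up n (up m base_exp)"
      by (rule exponent_eqI[of nd]) (use e ES_sum[OF e(1)] nm up_PiE[OF up_PiE[OF base_exp_PiE]] in \<open>auto simp: sum_up\<close>)
    then show "b e y = 0" using e(2) by simp
  qed (use nm ns_dd in \<open>auto simp: up_apply\<close>)
  have b1: "b (up n base_exp) x = 0" if n: "n \<in> nd" and x: "x \<in> node_lattice" for n x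
  proof (rule coeff[OF x up_dd_in_ES[OF n], of "[n]"])
    fix e y assume y: "y \<in> node_lattice" and e: "e \<in> node_exps" "e \<noteq> up n base_exp" "\<And>i. i \<in> nd \<Longrightarrow> up n base_exp i \<le> e i"
    obtain m where m: "m \<in> nd" "\<And>i. i \<in> nd \<Longrightarrow> up m (up n base_exp) i \<le> e i"
      using exists_up_le[OF ES_sum(2)[OF e(1)] up_PiE[OF base_exp_PiE n] e(3,2)] by blast
    have "e = up m (up n base_exp)"
      by (rule exponent_eqI[of nd]) (use e m ES_sum[OF e(1)] n up_PiE[OF up_PiE[OF base_exp_PiE]] in \<open>auto simp: sum_up\<close>)
    then show "b e y = 0" using b2 m n y by simp
  qed (use n ns_dd in \<open>auto simp: up_apply\<close>)
  have b0: "b base_exp x = 0" if x: "x \<in> node_lattice" for x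
  proof (rule coeff[OF x base_exp_in_ES, of "[]"])
    fix e y assume y: "y \<in> node_lattice" and e: "e \<in> node_exps" "e \<noteq> base_exp" "\<And>i. i \<in> nd \<Longrightarrow> base_exp i \<le> e i"
    obtain m where m: "m \<in> nd" "\<And>i. i \<in> nd \<Longrightarrow> up m base_exp i \<le> e i"
      using exists_up_le[OF ES_sum(2)[OF e(1)] base_exp_PiE e(3,2)] by blast
    show "b e y = 0"
    proof (cases "e = up m base_exp")
      case False
      obtain n where n: "n \<in> nd" "\<And>i. i \<in> nd \<Longrightarrow> up n (up m base_exp) i \<le> e i"
        using exists_up_le[OF ES_sum(2)[OF e(1)] up_PiE[OF base_exp_PiE m(1)] m(2) False] by blast
      have "e = up n (up m base_exp)"
        by (rule exponent_eqI[of nd]) (use e n m ES_sum[OF e(1)] up_PiE[OF up_PiE[OF base_exp_PiE]] in \<open>auto simp: sum_up\<close>)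
      then show ?thesis using b2 m n y by simp
    qed (use b1 m y in simp)
  qed (use ns_dd in auto)
  have kx: "node_vector k \<in> node_lattice" unfolding node_lattice_def by blast
  have ab: "a e k = b e (node_vector k) + expected_coeff e" for e
    unfolding b_def node_coord[OF k] by simp
  show "a base_exp k = const_coeff" unfolding ab using b0[OF kx] expected_coeff_dd by simp
  show "a (up n base_exp) k = lin_coeff n" if "n \<in> nd" for n
    unfolding ab using b1[OF that kx] expected_coeff_up[OF that] by simp
  show "a (up n (up m base_exp)) k = J G n m" if "n \<in> nd" "m \<in> nd" for n m
    unfolding ab using b2[OF that kx] expected_coeff_up_up[OF that] by simp
qed

end

theorem theorem4p6p1p1:
  fixes G :: "('v::finite) plumbing_graph"
    and C :: "(real^'v) set"
    and \<L> :: "real^'v \<Rightarrow> real"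
  assumes "plumbing_tree G"
    and "negative_definite G"
    and "nodes G \<noteq> {}"
    and "std_lattice = dual_lattice G"
    and "chamber G C"
    and "interior (C \<inter> lipman_cone G) \<noteq> {}"
    and "ehrhart_quasipolynomial G C \<L>"
  shows "(\<exists>a. node_expansion G \<L> a) \<and>
    (\<forall>a. node_expansion G \<L> a \<longrightarrow> (\<forall>k \<in> nodes G \<rightarrow>\<^sub>E UNIV.
      (\<forall>n\<in>nodes G.
         a (\<lambda>q\<in>nodes G. if q = n then valency G q else valency G q - 2) k = J G n n) \<and>
      (\<forall>n\<in>nodes G. \<forall>m\<in>nodes G. n \<noteq> m \<longrightarrow>
         a (\<lambda>q\<in>nodes G. if q = n \<or> q = m then valency G q - 1 else valency G q - 2) k = J G n m) \<and>
      (\<forall>n\<in>nodes G.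
         a (\<lambda>q\<in>nodes G. if q = n then valency G q - 1 else valency G q - 2) k =
           - (1/2) * int_form G (canonical_class G) (E_star G n)
           + (1/2) * (\<Sum>m\<in>nodes G. (real (valency G m) - 2) * J G n m)) \<and>
      a (\<lambda>q\<in>nodes G. valency G q - 2) k =
        periodic_constant (lipman_cone G) (Z_coeff G)
        - (\<Sum>n\<in>nodes G. (real (valency G n) - 2)
             * int_form G (canonical_class G) (E_star G n) / 4)
        + (\<Sum>n\<in>nodes G. (real (valency G n) - 2) * (3 * real (valency G n) - 7) * J G n n / 24)
        + (\<Sum>n\<in>nodes G. \<Sum>m\<in>nodes G - {n}.
             (real (valency G n) - 2) * (real (valency G m) - 2) * J G n m / 8)))"
proof -
  interpret ehrhart_chamber G C \<L>
    by unfold_locales (use assms in auto)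
  have val: "3 \<le> valency G n" if "n \<in> nodes G" for n using that unfolding nodes_def by simp
  have base_exp: "real (base_exp n) = real (valency G n) - 2" if "n \<in> nodes G" for n
    using val[OF that] that unfolding base_exp_def by (simp add: of_nat_diff)
  have e2: "(\<lambda>q\<in>nodes G. if q = n then valency G q else valency G q - 2) = up n (up n base_exp)"
    if n: "n \<in> nodes G" for n
  proof
    fix q show "(\<lambda>q\<in>nodes G. if q = n then valency G q else valency G q - 2) q = up n (up n base_exp) q"
      using n val[of q] by (auto simp: up_apply base_exp_def restrict_def)
  qed
  have e11: "(\<lambda>q\<in>nodes G. if q = n \<or> q = m then valency G q - 1 else valency G q - 2) = up n (up m base_exp)"
    if n: "n \<in> nodes G" "m \<in> nodes G" "n \<noteq> m" for n m
  proof
    fix q show "(\<lambda>q\<in>nodes G. if q = n \<or> q = m then valency G q - 1 else valency G q - 2) q = up n (up m base_exp) q"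
      using n val[of q] by (auto simp: up_apply base_exp_def restrict_def)
  qed
  have e1: "(\<lambda>q\<in>nodes G. if q = n then valency G q - 1 else valency G q - 2) = up n base_exp"
    if n: "n \<in> nodes G" for n
  proof
    fix q show "(\<lambda>q\<in>nodes G. if q = n then valency G q - 1 else valency G q - 2) q = up n base_exp q"
      using n val[of q] by (auto simp: up_apply base_exp_def restrict_def)
  qed
  have lin: "lin_coeff n = - (1/2) * int_form G (canonical_class G) (E_star G n)
    + (1/2) * (\<Sum>m\<in>nodes G. (real (valency G m) - 2) * J G n m)" for n
    unfolding lin_coeff_def K_pair_def by (simp add: base_exp cong: sum.cong)
  have const: "const_coeff = periodic_constant (lipman_cone G) (Z_coeff G)
        - (\<Sum>n\<in>nodes G. (real (valency G n) - 2)
             * int_form G (canonical_class G) (E_star G n) / 4)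
        + (\<Sum>n\<in>nodes G. (real (valency G n) - 2) * (3 * real (valency G n) - 7) * J G n n / 24)
        + (\<Sum>n\<in>nodes G. \<Sum>m\<in>nodes G - {n}.
             (real (valency G n) - 2) * (real (valency G m) - 2) * J G n m / 8)"
  proof -
    let ?d = "\<lambda>n. real (valency G n) - 2"
    have "(\<Sum>n\<in>nodes G. \<Sum>m\<in>nodes G. ?d n * ?d m * J G n m) / 8 =
      (\<Sum>n\<in>nodes G. ?d n * ?d n * J G n n / 8 + (\<Sum>m\<in>nodes G - {n}. ?d n * ?d m * J G n m / 8))"
      unfolding sum_divide_distrib
      by (rule sum.cong[OF refl], subst sum.remove[OF finite]) auto
    moreover have "(\<Sum>n\<in>nodes G. ?d n * J G n n) / 24 = (\<Sum>n\<in>nodes G. ?d n * J G n n / 24)"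
      by (rule sum_divide_distrib)
    moreover have "(\<Sum>n\<in>nodes G. ?d n * (3 * real (valency G n) - 7) * J G n n / 24) =
      (\<Sum>n\<in>nodes G. ?d n * ?d n * J G n n / 8) - (\<Sum>n\<in>nodes G. ?d n * J G n n / 24)"
      unfolding sum_subtractf[symmetric] by (rule sum.cong) (auto simp: field_simps)
    moreover have "const_coeff = pc - (\<Sum>n\<in>nodes G. ?d n * K_pair n) / 4
     + (\<Sum>n\<in>nodes G. \<Sum>m\<in>nodes G. ?d n * ?d m * J G n m) / 8 - (\<Sum>n\<in>nodes G. ?d n * J G n n) / 24"
      unfolding const_coeff_def by (simp add: base_exp cong: sum.cong)
    ultimately show ?thesis
      unfolding pc_def K_pair_def by (simp add: sum.distrib sum_divide_distrib)
  qed
  show ?thesis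
  proof (intro conjI allI impI ballI)
    show "\<exists>a. node_expansion G \<L> a" by (rule node_expansion_exists)
  next
    fix a n and k :: "'v \<Rightarrow> int" assume "node_expansion G \<L> a" "k \<in> nodes G \<rightarrow>\<^sub>E UNIV" "n \<in> nodes G"
    then show "a (\<lambda>q\<in>nodes G. if q = n then valency G q else valency G q - 2) k = J G n n"
      by (simp only: e2 node_expansion_coeffs(3))
  next
    fix a n m and k :: "'v \<Rightarrow> int" assume *: "node_expansion G \<L> a" "k \<in> nodes G \<rightarrow>\<^sub>E UNIV" "n \<in> nodes G" "m \<in> nodes G" "n \<noteq> m"
    show "a (\<lambda>q\<in>nodes G. if q = n \<or> q = m then valency G q - 1 else valency G q - 2) k = J G n m"
      unfolding e11[OF *(3-5)] by (rule node_expansion_coeffs(3)[OF *(1-4)])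
  next
    fix a n and k :: "'v \<Rightarrow> int" assume "node_expansion G \<L> a" "k \<in> nodes G \<rightarrow>\<^sub>E UNIV" "n \<in> nodes G"
    then show "a (\<lambda>q\<in>nodes G. if q = n then valency G q - 1 else valency G q - 2) k =
           - (1/2) * int_form G (canonical_class G) (E_star G n)
           + (1/2) * (\<Sum>m\<in>nodes G. (real (valency G m) - 2) * J G n m)"
      by (simp only: e1 node_expansion_coeffs(2) lin)
  next
    fix a and k :: "'v \<Rightarrow> int" assume "node_expansion G \<L> a" "k \<in> nodes G \<rightarrow>\<^sub>E UNIV"
    then show "a (\<lambda>q\<in>nodes G. valency G q - 2) k =
        periodic_constant (lipman_cone G) (Z_coeff G)
        - (\<Sum>n\<in>nodes G. (real (valency G n) - 2)
             * int_form G (canonical_class G) (E_star G n) / 4)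
        + (\<Sum>n\<in>nodes G. (real (valency G n) - 2) * (3 * real (valency G n) - 7) * J G n n / 24)
        + (\<Sum>n\<in>nodes G. \<Sum>m\<in>nodes G - {n}.
             (real (valency G n) - 2) * (real (valency G m) - 2) * J G n m / 8)"
      using node_expansion_coeffs(1) const unfolding base_exp_def by simp
  qed
qed

end
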